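(* Assume that the coarse median space $(X,\mu,d)$ has quasicubical intervals and is roughly geodesic, and let $\sigma$ be the metric on $X$ defined in the context (for a fixed $K>0$). The metrics $\sigma$ and $d$ are quasi-isometric, $\sigma$ is weakly roughly geodesic, and balls for $\sigma$ are uniformly coarsely median-convex. Moreover, $\sigma$ is invariant under the group of median isometries of $(X,\mu,d)$.
   Context: Median algebras. A median on a set $Q$ is a symmetric map $\mu_Q:Q^3\to Q$ with $\mu_Q(x,x,y)=x$ and $\mu_Q(a,b,\mu_Q(x,y,z))=\mu_Q(\mu_Q(a,b,x),\mu_Q(a,b,y),z)$; $(Q,\mu_Q)$ is a median algebra. Its rank is the supremum of $\nu\in\mathbb N$ such that the cube $\{0,1\}^\nu$ embeds in $Q$ by an injective median homomorphism. Coarse median space. Let $(X,d)$ be a metric space. A map $\mu:X^3\to X$ is a coarse median if there is $h:\mathbb N\to(0,\infty)$ such that: (i) $d(\mu(a,b,c),\mu(a',b',c'))\le h(0)(d(a,a')+d(b,b')+d(c,c'))+h(0)$ for all $a,b,c,a',b',c'\in X$; (ii) for each finite nonempty $A\subset X$ with $|A|\le n$ there are a finite median algebra $(Q,\mu_Q)$ and maps $\pi:A\to Q$, $\lambda:Q\to X$ with $d(\lambda\mu_Q(\alpha,\beta,\gamma),\mu(\lambda\alpha,\lambda\beta,\lambda\gamma))\le h(n)$ for all $\alpha,\beta,\gamma\in Q$ and $d(a,\lambda\pi(a))\le h(n)$ for all $a\in A$. It has rank at most $\nu$ if $Q$ can always be chosen of rank at most $\nu$. We assume $\mu$ is symmetric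 and $\mu(a,a,b)=a$. The median interval is $[a,b]=\{\mu(a,b,x):x\in X\}$. A subset $Y\subset X$ is $M$-coarsely median-convex if $d(Y,\mu(x,y,y'))\le M$ for all $y,y'\in Y$, $x\in X$; "uniformly" means with a common $M$. A median isometry is an isometry $g$ of $(X,d)$ with $g\mu(x,y,z)=\mu(gx,gy,gz)$ for all $x,y,z$. Quasicubical intervals. $(X,\mu,d)$ has quasicubical intervals if it has finite rank $\nu$ and there is $\kappa\ge1$ such that for all $a,b\in X$ there are a finite CAT(0) cube complex $Q$ of dimension at most $\nu$ (identified with its vertex set), with $\ell^1$ metric $d_Q$ and median $\mu_Q$, and a map $\lambda:Q\to[a,b]$ that is $\kappa$-coarsely onto, satisfies $\frac1\kappa d_Q(\alpha,\beta)-\kappa\le d(\lambda(\alpha),\lambda(\beta))\le\kappa d_Q(\alpha,\beta)+\kappa$ for all $\alpha,\beta$, and satisfies $d(\lambda(\mu_Q(\alpha,\beta,\gamma)),\mu(\lambda(\alpha),\lambda(\beta),\lambda(\gamma)))\le\kappa$ for all $\alpha,\beta,\gamma$. Rough geodesicity. A metric $d$ is roughly geodesic if there is $C_d\ge0$ such that any $a,b\in X$ are joined by a $(1,C_d)$-quasi-isometric embedding $f:[0,d(a,b)]\to X$ with $f(0)=a$, $f(d(a,b))=b$. A metric $\sigma$ is weakly roughly geodesic if there is $C'\ge0$ such that for any $a,b\in X$ and $0\le r\le\sigma(a,b)$ there is $c\in X$ with $|\sigma(a,c)-r|\le C'$ and $\sigma(a,c)+\sigma(c,b)\le\sigma(a,b)+C'$.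 The metric $\sigma$. Fix $K>0$. A $K$-contraction is a map $\Phi:X\to\mathbb R$ with $|\Phi(x)-\Phi(y)|\le d(x,y)+K$ and $|\Phi(\mu(x,y,z))-\mu_{\mathbb R}(\Phi(x),\Phi(y),\Phi(z))|\le K$ for all $x,y,z\in X$, where $\mu_{\mathbb R}$ is the standard median on $\mathbb R$. Then $\sigma(a,b)$ is the supremum of all $r\ge0$ for which there is a $K$-contraction $\Phi$ with $\Phi(a)=0$ and $\Phi(b)=r$. "$\sigma$ and $d$ are quasi-isometric" means that the identity map $(X,d)\to(X,\sigma)$ is a quasi-isometry. *)

theory Defs
  imports "HOL-Analysis.Analysis" "HOL-Library.Extended_Nat"
begin

section \<open>Median algebras\<close>

definition median_algebra :: "'q set \<Rightarrow> ('q \<Rightarrow> 'q \<Rightarrow> 'q \<Rightarrow> 'q) \<Rightarrow> bool" where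
  "median_algebra Q m \<longleftrightarrow>
     (\<forall>x\<in>Q. \<forall>y\<in>Q. \<forall>z\<in>Q. m x y z \<in> Q) \<and>
     (\<forall>x\<in>Q. \<forall>y\<in>Q. \<forall>z\<in>Q. m x y z = m y x z \<and> m x y z = m x z y) \<and>
     (\<forall>x\<in>Q. \<forall>y\<in>Q. m x x y = x) \<and>
     (\<forall>a\<in>Q. \<forall>b\<in>Q. \<forall>x\<in>Q. \<forall>y\<in>Q. \<forall>z\<in>Q. m a b (m x y z) = m (m a b x) (m a b y) z)"

definition median_hom ::
  "'p set \<Rightarrow> ('p \<Rightarrow> 'p \<Rightarrow> 'p \<Rightarrow> 'p) \<Rightarrow> 'q set \<Rightarrow> ('q \<Rightarrow> 'q \<Rightarrow> 'q \<Rightarrow> 'q) \<Rightarrow> ('p \<Rightarrow> 'q) \<Rightarrow> bool" where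
  "median_hom P mP Q mQ f \<longleftrightarrow>
     f \<in> P \<rightarrow> Q \<and> (\<forall>x\<in>P. \<forall>y\<in>P. \<forall>z\<in>P. f (mP x y z) = mQ (f x) (f y) (f z))"

text \<open>The cube \<open>{0,1}\<^sup>k\<close> is \<open>Pow {..<k}\<close>, a subset being identified with its indicator function;
  the coordinatewise median is then the majority operation.\<close>

definition majority :: "'i set \<Rightarrow> 'i set \<Rightarrow> 'i set \<Rightarrow> 'i set" where
  "majority A B C = (A \<inter> B) \<union> (B \<inter> C) \<union> (C \<inter> A)"

definition median_rank :: "'q set \<Rightarrow> ('q \<Rightarrow> 'q \<Rightarrow> 'q \<Rightarrow> 'q) \<Rightarrow> enat" where
  "median_rank Q m =
     (SUP k \<in> {k::nat. \<exists>f. median_hom (Pow {..<k}) majority Q m f \<and> inj_on f (Pow {..<k})}. enat k)"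

section \<open>Coarse median spaces\<close>

text \<open>Finite median algebras are taken on finite sets of natural numbers, which covers all of
  them up to isomorphism. The bound \<open>r\<close> on their rank is \<open>\<infinity>\<close> when no bound is imposed.\<close>

definition coarse_median_with ::
  "'a set \<Rightarrow> ('a \<Rightarrow> 'a \<Rightarrow> real) \<Rightarrow> ('a \<Rightarrow> 'a \<Rightarrow> 'a \<Rightarrow> 'a) \<Rightarrow> (nat \<Rightarrow> real) \<Rightarrow> enat \<Rightarrow> bool" where
  "coarse_median_with X d \<mu> h r \<longleftrightarrow>
     (\<forall>n. h n > 0) \<and>
     (\<forall>a\<in>X. \<forall>b\<in>X. \<forall>c\<in>X. \<forall>a'\<in>X. \<forall>b'\<in>X. \<forall>c'\<in>X.
        d (\<mu> a b c) (\<mu> a' b' c') \<le> h 0 * (d a a' + d b b' + d c c') + h 0) \<and>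
     (\<forall>n A. finite A \<and> A \<noteq> {} \<and> A \<subseteq> X \<and> card A \<le> n \<longrightarrow>
        (\<exists>(Q :: nat set) mQ \<pi> l.
           finite Q \<and> median_algebra Q mQ \<and> median_rank Q mQ \<le> r \<and>
           \<pi> \<in> A \<rightarrow> Q \<and> l \<in> Q \<rightarrow> X \<and>
           (\<forall>\<alpha>\<in>Q. \<forall>\<beta>\<in>Q. \<forall>\<gamma>\<in>Q. d (l (mQ \<alpha> \<beta> \<gamma>)) (\<mu> (l \<alpha>) (l \<beta>) (l \<gamma>)) \<le> h n) \<and>
           (\<forall>a\<in>A. d a (l (\<pi> a)) \<le> h n)))"

definition coarse_median_space ::
  "'a set \<Rightarrow> ('a \<Rightarrow> 'a \<Rightarrow> 'a \<Rightarrow> 'a) \<Rightarrow> ('a \<Rightarrow> 'a \<Rightarrow> real) \<Rightarrow> bool" where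
  "coarse_median_space X \<mu> d \<longleftrightarrow>
     Metric_space X d \<and>
     (\<forall>a\<in>X. \<forall>b\<in>X. \<forall>c\<in>X. \<mu> a b c \<in> X) \<and>
     (\<forall>a\<in>X. \<forall>b\<in>X. \<forall>c\<in>X. \<mu> a b c = \<mu> b a c \<and> \<mu> a b c = \<mu> a c b) \<and>
     (\<forall>a\<in>X. \<forall>b\<in>X. \<mu> a a b = a) \<and>
     (\<exists>h. coarse_median_with X d \<mu> h \<infinity>)"

definition coarse_rank_at_most ::
  "'a set \<Rightarrow> ('a \<Rightarrow> 'a \<Rightarrow> 'a \<Rightarrow> 'a) \<Rightarrow> ('a \<Rightarrow> 'a \<Rightarrow> real) \<Rightarrow> nat \<Rightarrow> bool" where
  "coarse_rank_at_most X \<mu> d \<nu> \<longleftrightarrow> (\<exists>h. coarse_median_with X d \<mu> h (enat \<nu>))"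

definition has_coarse_rank ::
  "'a set \<Rightarrow> ('a \<Rightarrow> 'a \<Rightarrow> 'a \<Rightarrow> 'a) \<Rightarrow> ('a \<Rightarrow> 'a \<Rightarrow> real) \<Rightarrow> nat \<Rightarrow> bool" where
  "has_coarse_rank X \<mu> d \<nu> \<longleftrightarrow>
     coarse_rank_at_most X \<mu> d \<nu> \<and> (\<forall>\<nu>'. coarse_rank_at_most X \<mu> d \<nu>' \<longrightarrow> \<nu> \<le> \<nu>')"

definition median_interval :: "'a set \<Rightarrow> ('a \<Rightarrow> 'a \<Rightarrow> 'a \<Rightarrow> 'a) \<Rightarrow> 'a \<Rightarrow> 'a \<Rightarrow> 'a set" where
  "median_interval X \<mu> a b = {\<mu> a b x | x. x \<in> X}"

text \<open>The infimum is the distance from \<open>\<mu> x y y'\<close> to \<open>Y\<close>, which is nonempty where it is taken.\<close>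

definition coarsely_median_convex ::
  "'a set \<Rightarrow> ('a \<Rightarrow> 'a \<Rightarrow> 'a \<Rightarrow> 'a) \<Rightarrow> ('a \<Rightarrow> 'a \<Rightarrow> real) \<Rightarrow> real \<Rightarrow> 'a set \<Rightarrow> bool" where
  "coarsely_median_convex X \<mu> d M Y \<longleftrightarrow>
     Y \<subseteq> X \<and> (\<forall>y\<in>Y. \<forall>y'\<in>Y. \<forall>x\<in>X. (INF z\<in>Y. d z (\<mu> x y y')) \<le> M)"

definition median_isometry ::
  "'a set \<Rightarrow> ('a \<Rightarrow> 'a \<Rightarrow> 'a \<Rightarrow> 'a) \<Rightarrow> ('a \<Rightarrow> 'a \<Rightarrow> real) \<Rightarrow> ('a \<Rightarrow> 'a) \<Rightarrow> bool" where
  "median_isometry X \<mu> d g \<longleftrightarrow>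
     bij_betw g X X \<and>
     (\<forall>x\<in>X. \<forall>y\<in>X. d (g x) (g y) = d x y) \<and>
     (\<forall>x\<in>X. \<forall>y\<in>X. \<forall>z\<in>X. g (\<mu> x y z) = \<mu> (g x) (g y) (g z))"

section \<open>CAT(0) cube complexes\<close>

text \<open>A cube complex is presented by the collection \<open>C\<close> of the vertex sets of its cubes, all faces
  included; its vertex set is \<open>\<Union>C\<close>. A chart identifies the vertices of a cube with
  \<open>{0,1}\<^sup>n = Pow {..<n}\<close> in such a way that the members of \<open>C\<close> contained in the cube are
  precisely its faces; the faces of \<open>{0,1}\<^sup>n\<close> are the nonempty intervals of \<open>Pow {..<n}\<close>. Distinct
  cubes meet in a common face, if at all.\<close>

definition cube_chart :: "'v set set \<Rightarrow> 'v set \<Rightarrow> nat \<Rightarrow> (nat set \<Rightarrow> 'v) \<Rightarrow> bool" where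
  "cube_chart C c n \<phi> \<longleftrightarrow>
     bij_betw \<phi> (Pow {..<n}) c \<and>
     {F \<in> C. F \<subseteq> c} = {\<phi> ` {B. A \<subseteq> B \<and> B \<subseteq> A'} | A A'. A \<subseteq> A' \<and> A' \<subseteq> {..<n}}"

definition cube_complex :: "'v set set \<Rightarrow> bool" where
  "cube_complex C \<longleftrightarrow>
     (\<forall>c\<in>C. \<exists>n \<phi>. cube_chart C c n \<phi>) \<and>
     (\<forall>c\<in>C. \<forall>c'\<in>C. c \<inter> c' \<noteq> {} \<longrightarrow> c \<inter> c' \<in> C)"

definition cc_dim_at_most :: "'v set set \<Rightarrow> nat \<Rightarrow> bool" where
  "cc_dim_at_most C \<nu> \<longleftrightarrow> (\<forall>c\<in>C. \<forall>n \<phi>. cube_chart C c n \<phi> \<longrightarrow> n \<le> \<nu>)"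

text \<open>The geometric realisation, as a subspace of the space of functions from the vertices to the
  reals: the point of a cube with coordinates \<open>t \<in> [0,1]\<^sup>n\<close> becomes the function whose value at a
  vertex of the cube is the multilinear weight of that vertex (the probability of the vertex when
  the \<open>i\<close>-th coordinate is 1 with probability \<open>t i\<close>, independently). The weights are compatible
  with passing to faces and determine \<open>t\<close>, so for a finite complex this is
  the space obtained by gluing the cubes along their common faces.\<close>

definition cc_realization :: "'v set set \<Rightarrow> ('v \<Rightarrow> real) set" where
  "cc_realization C =
     {w. \<exists>c\<in>C. \<exists>n \<phi> t. cube_chart C c n \<phi> \<and> (\<forall>i<n. 0 \<le> t i \<and> t i \<le> 1) \<and>
           (\<forall>A. A \<subseteq> {..<n} \<longrightarrow> w (\<phi> A) = (\<Prod>i\<in>A. t i) * (\<Prod>i\<in>{..<n} - A. 1 - t i)) \<and>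
           (\<forall>v. v \<notin> c \<longrightarrow> w v = 0)}"

definition cc_edges :: "'v set set \<Rightarrow> ('v \<times> 'v) set" where
  "cc_edges C = {(u, v). u \<noteq> v \<and> {u, v} \<in> C}"

text \<open>The link of a vertex \<open>v\<close>, as an abstract simplicial complex on the set of neighbours of \<open>v\<close>:
  every cube containing \<open>v\<close> contributes the simplex spanned by its edges at \<open>v\<close>.\<close>

definition cc_link :: "'v set set \<Rightarrow> 'v \<Rightarrow> 'v set set" where
  "cc_link C v = {{u \<in> c. (v, u) \<in> cc_edges C} | c. c \<in> C \<and> v \<in> c}"

definition flag_complex :: "'v set set \<Rightarrow> bool" where
  "flag_complex L \<longleftrightarrow>
     (\<forall>S. finite S \<and> S \<noteq> {} \<and> (\<forall>s\<in>S. \<forall>t\<in>S. {s, t} \<in> L) \<longrightarrow> S \<in> L)"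

definition finite_CAT0_cube_complex :: "'v set set \<Rightarrow> bool" where
  "finite_CAT0_cube_complex C \<longleftrightarrow>
     finite C \<and> C \<noteq> {} \<and> cube_complex C \<and>
     simply_connected (cc_realization C) \<and>
     (\<forall>v\<in>\<Union>C. flag_complex (cc_link C v))"

text \<open>On vertices the \<open>\<ell>\<^sup>1\<close> metric is the path metric of the 1-skeleton.\<close>

definition cc_dist :: "'v set set \<Rightarrow> 'v \<Rightarrow> 'v \<Rightarrow> real" where
  "cc_dist C u v = real (LEAST n. (u, v) \<in> cc_edges C ^^ n)"

definition cc_interval :: "'v set set \<Rightarrow> 'v \<Rightarrow> 'v \<Rightarrow> 'v set" where
  "cc_interval C u v = {x \<in> \<Union>C. cc_dist C u x + cc_dist C x v = cc_dist C u v}"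

text \<open>\<open>m\<close> is the median operation on the vertices of \<open>C\<close>.\<close>

definition is_cc_median :: "'v set set \<Rightarrow> ('v \<Rightarrow> 'v \<Rightarrow> 'v \<Rightarrow> 'v) \<Rightarrow> bool" where
  "is_cc_median C m \<longleftrightarrow>
     (\<forall>u\<in>\<Union>C. \<forall>v\<in>\<Union>C. \<forall>w\<in>\<Union>C.
        cc_interval C u v \<inter> cc_interval C v w \<inter> cc_interval C w u = {m u v w})"

section \<open>Coarse geometry\<close>

definition qi_embedding ::
  "'a set \<Rightarrow> ('a \<Rightarrow> 'a \<Rightarrow> real) \<Rightarrow> 'b set \<Rightarrow> ('b \<Rightarrow> 'b \<Rightarrow> real) \<Rightarrow> real \<Rightarrow> real \<Rightarrow> ('a \<Rightarrow> 'b) \<Rightarrow> bool" where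
  "qi_embedding S dS T dT L c f \<longleftrightarrow>
     f \<in> S \<rightarrow> T \<and>
     (\<forall>x\<in>S. \<forall>y\<in>S. 1 / L * dS x y - c \<le> dT (f x) (f y) \<and> dT (f x) (f y) \<le> L * dS x y + c)"

definition coarsely_onto ::
  "'a set \<Rightarrow> 'b set \<Rightarrow> ('b \<Rightarrow> 'b \<Rightarrow> real) \<Rightarrow> real \<Rightarrow> ('a \<Rightarrow> 'b) \<Rightarrow> bool" where
  "coarsely_onto S T dT c f \<longleftrightarrow> (\<forall>y\<in>T. \<exists>x\<in>S. dT y (f x) \<le> c)"

definition quasi_isometry ::
  "'a set \<Rightarrow> ('a \<Rightarrow> 'a \<Rightarrow> real) \<Rightarrow> 'b set \<Rightarrow> ('b \<Rightarrow> 'b \<Rightarrow> real) \<Rightarrow> ('a \<Rightarrow> 'b) \<Rightarrow> bool" where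
  "quasi_isometry S dS T dT f \<longleftrightarrow>
     (\<exists>L\<ge>1. \<exists>c\<ge>0. qi_embedding S dS T dT L c f \<and> coarsely_onto S T dT c f)"

definition roughly_geodesic :: "'a set \<Rightarrow> ('a \<Rightarrow> 'a \<Rightarrow> real) \<Rightarrow> bool" where
  "roughly_geodesic X d \<longleftrightarrow>
     (\<exists>C\<ge>0. \<forall>a\<in>X. \<forall>b\<in>X. \<exists>f. qi_embedding {0..d a b} dist X d 1 C f \<and> f 0 = a \<and> f (d a b) = b)"

definition weakly_roughly_geodesic :: "'a set \<Rightarrow> ('a \<Rightarrow> 'a \<Rightarrow> real) \<Rightarrow> bool" where
  "weakly_roughly_geodesic X s \<longleftrightarrow>
     (\<exists>C\<ge>0. \<forall>a\<in>X. \<forall>b\<in>X. \<forall>r. 0 \<le> r \<and> r \<le> s a b \<longrightarrow>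
        (\<exists>c\<in>X. \<bar>s a c - r\<bar> \<le> C \<and> s a c + s c b \<le> s a b + C))"

section \<open>Quasicubical intervals\<close>

text \<open>Again, finite cube complexes may be assumed to have natural numbers as vertices.\<close>

definition quasicubical_intervals ::
  "'a set \<Rightarrow> ('a \<Rightarrow> 'a \<Rightarrow> 'a \<Rightarrow> 'a) \<Rightarrow> ('a \<Rightarrow> 'a \<Rightarrow> real) \<Rightarrow> bool" where
  "quasicubical_intervals X \<mu> d \<longleftrightarrow>
     (\<exists>\<nu>. has_coarse_rank X \<mu> d \<nu> \<and>
       (\<exists>\<kappa>\<ge>1. \<forall>a\<in>X. \<forall>b\<in>X.
         \<exists>(C :: nat set set) mQ l.
           finite_CAT0_cube_complex C \<and> cc_dim_at_most C \<nu> \<and> is_cc_median C mQ \<and>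
           qi_embedding (\<Union>C) (cc_dist C) (median_interval X \<mu> a b) d \<kappa> \<kappa> l \<and>
           coarsely_onto (\<Union>C) (median_interval X \<mu> a b) d \<kappa> l \<and>
           (\<forall>\<alpha>\<in>\<Union>C. \<forall>\<beta>\<in>\<Union>C. \<forall>\<gamma>\<in>\<Union>C.
              d (l (mQ \<alpha> \<beta> \<gamma>)) (\<mu> (l \<alpha>) (l \<beta>) (l \<gamma>)) \<le> \<kappa>)))"

section \<open>The metric \<open>\<sigma>\<close>\<close>

definition real_median :: "real \<Rightarrow> real \<Rightarrow> real \<Rightarrow> real" where
  "real_median x y z = max (min x y) (max (min y z) (min z x))"

definition K_contraction ::
  "'a set \<Rightarrow> ('a \<Rightarrow> 'a \<Rightarrow> 'a \<Rightarrow> 'a) \<Rightarrow> ('a \<Rightarrow> 'a \<Rightarrow> real) \<Rightarrow> real \<Rightarrow> ('a \<Rightarrow> real) \<Rightarrow> bool" where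
  "K_contraction X \<mu> d K \<Phi> \<longleftrightarrow>
     (\<forall>x\<in>X. \<forall>y\<in>X. \<bar>\<Phi> x - \<Phi> y\<bar> \<le> d x y + K) \<and>
     (\<forall>x\<in>X. \<forall>y\<in>X. \<forall>z\<in>X. \<bar>\<Phi> (\<mu> x y z) - real_median (\<Phi> x) (\<Phi> y) (\<Phi> z)\<bar> \<le> K)"

text \<open>The value 0 off \<open>X\<close> is a convention, needed because \<^const>\<open>Metric_space\<close> asks for symmetry and
  nonnegativity on the whole type.\<close>

definition sigma_metric ::
  "'a set \<Rightarrow> ('a \<Rightarrow> 'a \<Rightarrow> 'a \<Rightarrow> 'a) \<Rightarrow> ('a \<Rightarrow> 'a \<Rightarrow> real) \<Rightarrow> real \<Rightarrow> 'a \<Rightarrow> 'a \<Rightarrow> real" where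
  "sigma_metric X \<mu> d K a b =
     (if a \<in> X \<and> b \<in> X
      then Sup {r. r \<ge> 0 \<and> (\<exists>\<Phi>. K_contraction X \<mu> d K \<Phi> \<and> \<Phi> a = 0 \<and> \<Phi> b = r)}
      else 0)"

lemma real_median_translate: "real_median (x - c) (y - c) (z - c) = real_median x y z - c"
  by (simp add: real_median_def min_diff_distrib_left max_diff_distrib_left)

lemma real_median_uminus: "real_median (- x) (- y) (- z) = - real_median x y z"
  by (cases "x \<le> y"; cases "y \<le> z"; cases "z \<le> x") (simp_all add: real_median_def max_def min_def)

lemma K_contraction_translate:
  assumes "K_contraction X \<mu> d K \<Phi>"
  shows "K_contraction X \<mu> d K (\<lambda>x. \<Phi> x - c)"
  using assms by (auto simp: K_contraction_def real_median_translate)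

lemma K_contraction_uminus:
  assumes "K_contraction X \<mu> d K \<Phi>"
  shows "K_contraction X \<mu> d K (\<lambda>x. - \<Phi> x)"
proof -
  have "\<bar>- \<Phi> x - - \<Phi> y\<bar> = \<bar>\<Phi> x - \<Phi> y\<bar>" for x y by linarith
  moreover have "\<bar>- \<Phi> (\<mu> x y z) - real_median (- \<Phi> x) (- \<Phi> y) (- \<Phi> z)\<bar>
      = \<bar>\<Phi> (\<mu> x y z) - real_median (\<Phi> x) (\<Phi> y) (\<Phi> z)\<bar>" for x y z
    unfolding real_median_uminus by (simp add: abs_minus_commute)
  ultimately show ?thesis using assms by (simp add: K_contraction_def)
qed

text \<open>The supremum is that of a nonempty bounded set of reals.\<close>

lemma
  fixes X :: "'a set" and \<mu> :: "'a \<Rightarrow> 'a \<Rightarrow> 'a \<Rightarrow> 'a" and K :: real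
  assumes "K > 0" "Metric_space X d" "a \<in> X" "b \<in> X"
  defines "R \<equiv> {r. r \<ge> 0 \<and> (\<exists>\<Phi>. K_contraction X \<mu> d K \<Phi> \<and> \<Phi> a = 0 \<and> \<Phi> b = r)}"
  shows zero_mem_sigma: "0 \<in> R" and sigma_bound: "r \<in> R \<Longrightarrow> r \<le> d a b + K"
    and sigma_bdd: "bdd_above R"
proof -
  have nn: "d x y \<ge> 0" for x y using assms(2) by (simp add: Metric_space.nonneg)
  have "K_contraction X \<mu> d K (\<lambda>_. 0)"
    using assms(1) nn by (simp add: K_contraction_def real_median_def add_nonneg_nonneg)
  then show "0 \<in> R" unfolding R_def by auto
  show *: "r \<le> d a b + K" if "r \<in> R" for r
  proof -
    from that obtain \<Phi> where "K_contraction X \<mu> d K \<Phi>" "\<Phi> a = 0" "\<Phi> b = r"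
      unfolding R_def by auto
    then have "\<bar>0 - r\<bar> \<le> d a b + K"
      using assms(3,4) unfolding K_contraction_def by metis
    then show ?thesis by linarith
  qed
  show "bdd_above R" by (rule bdd_aboveI[OF *])
qed

lemma K_contraction_le_sigma:
  fixes X :: "'a set"
  assumes K: "K > 0" and X: "Metric_space X d" and ab: "a \<in> X" "b \<in> X"
    and \<Phi>: "K_contraction X \<mu> d K \<Phi>"
  shows "\<bar>\<Phi> b - \<Phi> a\<bar> \<le> sigma_metric X \<mu> d K a b"
proof (cases "\<Phi> a \<le> \<Phi> b")
  case True
  have "K_contraction X \<mu> d K (\<lambda>x. \<Phi> x - \<Phi> a)" by (rule K_contraction_translate[OF \<Phi>])
  with True have "\<exists>\<Psi>. K_contraction X \<mu> d K \<Psi> \<and> \<Psi> a = 0 \<and> \<Psi> b = \<bar>\<Phi> b - \<Phi> a\<bar>"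
    by (intro exI[of _ "\<lambda>x. \<Phi> x - \<Phi> a"]) auto
  then show ?thesis
    using ab sigma_bdd[OF K X ab, of \<mu>] unfolding sigma_metric_def by (auto intro!: cSup_upper)
next
  case False
  have "K_contraction X \<mu> d K (\<lambda>x. - \<Phi> x - - \<Phi> a)"
    by (intro K_contraction_translate K_contraction_uminus \<Phi>)
  with False have "\<exists>\<Psi>. K_contraction X \<mu> d K \<Psi> \<and> \<Psi> a = 0 \<and> \<Psi> b = \<bar>\<Phi> b - \<Phi> a\<bar>"
    by (intro exI[of _ "\<lambda>x. - \<Phi> x - - \<Phi> a"]) auto
  then show ?thesis
    using ab sigma_bdd[OF K X ab, of \<mu>] unfolding sigma_metric_def by (auto intro!: cSup_upper)
qed

lemma sigma_leI:
  fixes X :: "'a set"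
  assumes K: "K > 0" and X: "Metric_space X d" and ab: "a \<in> X" "b \<in> X"
    and le: "\<And>\<Phi>. K_contraction X \<mu> d K \<Phi> \<Longrightarrow> \<bar>\<Phi> b - \<Phi> a\<bar> \<le> B"
  shows "sigma_metric X \<mu> d K a b \<le> B"
proof -
  have "r \<le> B" if "K_contraction X \<mu> d K \<Phi>" "\<Phi> a = 0" "\<Phi> b = r" for \<Phi> r
    using le[OF that(1)] that(2,3) by linarith
  then show ?thesis
    using ab zero_mem_sigma[OF K X ab, of \<mu>] unfolding sigma_metric_def
    by (auto intro!: cSup_least)
qed

theorem Metric_space_sigma:
  fixes X :: "'a set"
  assumes K: "K > 0" and X: "Metric_space X d"
  shows "Metric_space X (sigma_metric X \<mu> d K)"
proof
  let ?s = "sigma_metric X \<mu> d K"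
  have nn: "d x y \<ge> 0" for x y using X by (simp add: Metric_space.nonneg)
  have const: "K_contraction X \<mu> d K (\<lambda>_. 0)"
    using K nn by (simp add: K_contraction_def real_median_def add_nonneg_nonneg)
  show nonneg: "0 \<le> ?s x y" for x y
    using K_contraction_le_sigma[OF K X _ _ const, of x y]
    by (cases "x \<in> X \<and> y \<in> X") (auto simp: sigma_metric_def)
  have sym: "?s x y \<le> ?s y x" if "x \<in> X" "y \<in> X" for x y
    using that
    by (intro sigma_leI[OF K X]) (auto simp: abs_minus_commute intro: K_contraction_le_sigma[OF K X])
  show "?s x y = ?s y x" for x y
    using sym[of x y] sym[of y x]
    by (cases "x \<in> X \<and> y \<in> X") (force, auto simp: sigma_metric_def)
  show "(?s x y = 0) = (x = y)" if xy: "x \<in> X" "y \<in> X" for x y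
  proof
    assume "x = y"
    then have "?s x y \<le> 0" using xy by (intro sigma_leI[OF K X]) auto
    then show "?s x y = 0" using nonneg[of x y] by linarith
  next
    assume 0: "?s x y = 0"
    show "x = y"
    proof (rule ccontr)
      assume "x \<noteq> y"
      define \<Phi> where "\<Phi> = (\<lambda>z. if z = y then K else 0)"
      have "\<bar>\<Phi> u - \<Phi> v\<bar> \<le> d u v + K" for u v
        using K nn[of u v] by (auto simp: \<Phi>_def)
      moreover have "\<bar>\<Phi> u - real_median (\<Phi> v) (\<Phi> w) (\<Phi> z)\<bar> \<le> K" for u v w z
      proof -
        have *: "0 \<le> \<Phi> t" "\<Phi> t \<le> K" for t using K by (auto simp: \<Phi>_def)
        have "0 \<le> real_median (\<Phi> v) (\<Phi> w) (\<Phi> z)" "real_median (\<Phi> v) (\<Phi> w) (\<Phi> z) \<le> K"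
          unfolding real_median_def by (simp_all add: * le_max_iff_disj min_le_iff_disj)
        then show ?thesis using *[of u] by linarith
      qed
      ultimately have "K_contraction X \<mu> d K \<Phi>" by (auto simp: K_contraction_def)
      from K_contraction_le_sigma[OF K X xy this] \<open>x \<noteq> y\<close> 0 K show False
        by (simp add: \<Phi>_def)
    qed
  qed
  show "?s x z \<le> ?s x y + ?s y z" if "x \<in> X" "y \<in> X" "z \<in> X" for x y z
  proof (rule sigma_leI[OF K X \<open>x \<in> X\<close> \<open>z \<in> X\<close>])
    fix \<Phi> assume "K_contraction X \<mu> d K \<Phi>"
    then show "\<bar>\<Phi> z - \<Phi> x\<bar> \<le> ?s x y + ?s y z"
      using K_contraction_le_sigma[OF K X _ _, of x y \<mu> \<Phi>]
        K_contraction_le_sigma[OF K X _ _, of y z \<mu> \<Phi>] that by linarith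
  qed
qed

end

theory Submission
  imports Defs
begin

text \<open>Each interval is modelled, through its cube complex, by a ring of subsets of \<open>{..<n}\<close>: the coordinates
  are the halfspaces crossed by a geodesic between the ends. Finite coarse rank bounds the size of sets of
  pairwise crossing coordinates, since many of them would give a large coarse median cube of too high
  dimension; so the dimension of the complex itself is never used. Hence a definite proportion of the
  coordinates forms a chain, and counting that chain, suitably scaled, gives a contraction showing that
  \<open>\<sigma>\<close> is bounded below by \<open>d\<close>. Also unions and intersections in the ring reduce to boundedly many members,
  so \<open>\<sigma>\<close>-balls have coarse gates; the gate of \<open>b\<close> in the ball of radius \<open>r\<close> about \<open>a\<close> is the point required by
  weak rough geodesicity, because contractions can be concatenated there. The concatenation keeps the constant
  \<open>K\<close> since \<open>d\<close> is roughly geodesic, and a gap left between the two contractions absorbs all additive errors.\<close>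

section \<open>Discrete median metric spaces\<close>

text \<open>The constant \<open>K\<close> is fixed while \<open>\<sigma>\<close> is a supremum. A
  sum of two \<open>K\<close>-contractions has in general only the error \<open>2 * K\<close>, and
  scaling this back to \<open>K\<close> would lose a multiplicative factor, whereas weak rough
  geodesicity forgives additive losses only. So the sum has to be a \<open>K\<close>-contraction
  itself, and the two summands must grow in different places. Their positions are read off in the
  ring \<open>L\<close>: the members in the ball of radius \<open>r\<close> about \<open>a\<close>
  are contained in one member \<open>J\<close>, the members where a contraction vanishing at
  \<open>J\<close> is large contain one member \<open>P\<close>, and \<open>P\<close> is not
  contained in \<open>J\<close>; therefore \<open>P\<close> lies outside the ball, and some
  contraction exceeds \<open>r\<close> there.

  All constants must be common to all pairs \<open>a\<close>, \<open>b\<close>, although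
  \<open>n\<close> and \<open>L\<close> vary with the pair. This is why errors may involve the size
  of crossing sets but never \<open>n\<close>.\<close>

definition metric_interval :: "'v set \<Rightarrow> ('v \<Rightarrow> 'v \<Rightarrow> real) \<Rightarrow> 'v \<Rightarrow> 'v \<Rightarrow> 'v set" where
  "metric_interval V D u v = {x \<in> V. D u x + D x v = D u v}"

locale median_metric_space = Metric_space M d for M :: "'v set" and d :: "'v \<Rightarrow> 'v \<Rightarrow> real" +
  fixes m :: "'v \<Rightarrow> 'v \<Rightarrow> 'v \<Rightarrow> 'v"
  assumes median: "\<lbrakk>x \<in> M; y \<in> M; z \<in> M\<rbrakk> \<Longrightarrow>
    metric_interval M d x y \<inter> metric_interval M d y z \<inter> metric_interval M d z x = {m x y z}"
begin

abbreviation I :: "'v \<Rightarrow> 'v \<Rightarrow> 'v set" where "I \<equiv> metric_interval M d"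

lemma I_subset: "I x y \<subseteq> M"
  by (auto simp: metric_interval_def)

lemma I_sym: "I x y = I y x"
  by (auto simp: metric_interval_def commute add.commute)

lemma I_flip: "z \<in> I x y \<Longrightarrow> z \<in> I y x"
  using I_sym by blast

lemma I_ends: "x \<in> M \<Longrightarrow> y \<in> M \<Longrightarrow> x \<in> I x y" "x \<in> M \<Longrightarrow> y \<in> M \<Longrightarrow> y \<in> I x y"
  by (auto simp: metric_interval_def)

lemma I_trans:
  assumes "y \<in> I a x" "x \<in> I a b" "a \<in> M" "b \<in> M"
  shows "y \<in> I a b" "x \<in> I y b"
  using assms triangle[of a y b] triangle[of y x b]
  by (auto simp: metric_interval_def)

lemma I_antisym:
  assumes "y \<in> I a x" "x \<in> I a y" "a \<in> M"
  shows "x = y"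
proof -
  have M: "x \<in> M" "y \<in> M" and "d a y + d y x = d a x" "d a x + d x y = d a y"
    using assms unfolding metric_interval_def by blast+
  then have "d x y = 0" using nonneg[of x y] nonneg[of y x] by linarith
  then show ?thesis using zero M by blast
qed

lemma median_mem:
  assumes "x \<in> M" "y \<in> M" "z \<in> M"
  shows "m x y z \<in> M" "m x y z \<in> I x y" "m x y z \<in> I y z" "m x y z \<in> I x z"
  using median[OF assms] I_subset I_sym by blast+

lemma median_eqI:
  assumes "w \<in> I x y" "w \<in> I y z" "w \<in> I x z" "x \<in> M" "y \<in> M" "z \<in> M"
  shows "w = m x y z"
  using median[of x y z] assms I_sym by blast

text \<open>For every base point \<open>p\<close>, \<open>m p x y\<close> is the meet in the order \<open>z \<le> x \<longleftrightarrow> z \<in> I p x\<close>.\<close>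

lemma median_greatest:
  assumes "z \<in> I p x" "z \<in> I p y" and M: "p \<in> M" "x \<in> M" "y \<in> M"
  shows "z \<in> I p (m p x y)"
proof -
  have z: "z \<in> M" using assms I_subset by blast
  \<comment> \<open>This is already the median of \<open>p\<close>, \<open>x\<close> and
    \<open>y\<close>: since \<open>z\<close> lies between \<open>p\<close> and either of
    \<open>x\<close>, \<open>y\<close>, a point between \<open>z\<close> and \<open>x\<close> or
    \<open>y\<close> lies on \<open>I p x\<close> or \<open>I p y\<close> as well.\<close>
  let ?w = "m z x y"
  have w: "?w \<in> M" "?w \<in> I z x" "?w \<in> I x y" "?w \<in> I z y"
    using median_mem[OF z M(2,3)] by auto
  have px: "?w \<in> I p x" and pz: "z \<in> I p ?w"
    using I_trans[OF I_flip[OF w(2)] I_flip[OF assms(1)] M(2,1)] I_flip by auto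
  have "?w \<in> I p y"
    using I_trans[OF I_flip[OF w(4)] I_flip[OF assms(2)] M(3,1)] I_flip by auto
  then have "?w = m p x y"
    using median_eqI[OF px w(3)] M by blast
  then show ?thesis using pz by simp
qed

text \<open>Seen from \<open>a\<close>, medians with \<open>a\<close> are meets and, inside
  \<open>I a b\<close>, medians with \<open>b\<close> act as joins. The point \<open>z\<close> turns
  out to lie below the join \<open>j\<close> of its meets \<open>s\<close> and \<open>q\<close> with
  \<open>x\<close> and \<open>y\<close>: the meet \<open>r\<close> of \<open>z\<close> and
  \<open>j\<close> is above \<open>s\<close> and \<open>q\<close>, while \<open>z\<close> lies
  between \<open>s\<close> and \<open>q\<close>, and this forces \<open>r = z\<close>.\<close>

lemma I_convex:
  assumes x: "x \<in> I a b" and y: "y \<in> I a b" and z: "z \<in> I x y" and ab: "a \<in> M" "b \<in> M"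
  shows "z \<in> I a b"
proof -
  have M: "x \<in> M" "y \<in> M" "z \<in> M" using assms I_subset by blast+
  \<comment> \<open>Replacing \<open>x\<close> and \<open>y\<close> by \<open>s\<close> and \<open>q\<close> makes \<open>z\<close> an upper bound of both in the order based at \<open>a\<close>.\<close>
  define s where "s = m z a x"
  have s: "s \<in> M" "s \<in> I a z" "s \<in> I a x" "s \<in> I z x"
    using median_mem[of z a x] M ab I_flip by (auto simp: s_def)
  have sab: "s \<in> I a b" by (rule I_trans(1)[OF s(3) x ab])
  have z1: "z \<in> I s y" by (rule I_trans(2)[OF I_flip[OF s(4)] z M(1,2)])
  define q where "q = m z a y"
  have q: "q \<in> M" "q \<in> I a z" "q \<in> I a y" "q \<in> I z y"
    using median_mem[of z a y] M ab I_flip by (auto simp: q_def)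
  have qab: "q \<in> I a b" by (rule I_trans(1)[OF q(3) y ab])
  have z2: "z \<in> I s q" by (rule I_flip[OF I_trans(2)[OF I_flip[OF q(4)] I_flip[OF z1] M(2) s(1)]])
  define j where "j = m b s q"
  have j: "j \<in> M" "j \<in> I b s" "j \<in> I b q" "j \<in> I s q"
    using median_mem[of b s q] s q ab by (auto simp: j_def)
  have jab: "j \<in> I a b" "s \<in> I a j"
    using I_trans[OF j(2) I_flip[OF sab] ab(2,1)] I_flip by auto
  have qj: "q \<in> I a j"
    using I_trans[OF j(3) I_flip[OF qab] ab(2,1)] I_flip by auto
  define r where "r = m a z j"
  have r: "r \<in> M" "r \<in> I a z" "r \<in> I a j"
    using median_mem[of a z j] ab M j by (auto simp: r_def)
  have sr: "s \<in> I a r" "q \<in> I a r"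
    using median_greatest[of s a z j] median_greatest[of q a z j] s q jab qj ab M j
    by (auto simp: r_def)
  have rs: "r \<in> I s z" and rq: "r \<in> I q z"
    using I_trans(2)[OF sr(1) r(2) ab(1) M(3)] I_trans(2)[OF sr(2) r(2) ab(1) M(3)] by auto
  have "z \<in> I r q" by (rule I_trans(2)[OF rs z2 s(1) q(1)])
  then have "r = z" by (rule I_antisym[OF I_flip rq q(1)])
  then show ?thesis using I_trans(1)[OF r(3) jab(1) ab] by simp
qed

text \<open>The median of \<open>u\<close>, \<open>z\<close> and \<open>m u x y\<close> stays in
  \<open>I x y\<close> by convexity and lies on \<open>I u x\<close> and \<open>I u y\<close>, so
  uniqueness of medians identifies it with \<open>m u x y\<close>. Thus every point of
  \<open>I x y\<close> is reached from \<open>u\<close> through this one point.\<close>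

lemma gate:
  assumes z: "z \<in> I x y" and M: "x \<in> M" "y \<in> M" "u \<in> M"
  shows "m u x y \<in> I u z"
proof -
  let ?s = "m u x y" let ?g = "m u z ?s"
  have zM: "z \<in> M" using z I_subset by blast
  have s: "?s \<in> M" "?s \<in> I u x" "?s \<in> I x y" "?s \<in> I u y" using median_mem M by auto
  have g: "?g \<in> I u z" "?g \<in> I z ?s" "?g \<in> I u ?s" using median_mem[of u z ?s] s zM M by auto
  have "?g \<in> I x y" using I_convex[OF z s(3) g(2)] M by blast
  moreover have "?g \<in> I u x" "?g \<in> I u y" using I_trans(1)[OF g(3)] s M by auto
  ultimately have "?g = ?s" using median_eqI[of ?g u x y] M by blast
  then show ?thesis using g by simp
qed

text \<open>From \<open>w\<close>, the point \<open>e\<close> is below \<open>x\<close> and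
  \<open>y\<close>, hence below their meet \<open>m w x y\<close>, which is the gate of
  \<open>w\<close> in \<open>I x y\<close> and so lies below every \<open>z\<close> there.\<close>

lemma halfspace_convex:
  assumes "e \<in> I w x" "e \<in> I w y" "z \<in> I x y" and M: "w \<in> M" "x \<in> M" "y \<in> M"
  shows "e \<in> I w z"
  using I_trans(1)[OF median_greatest[OF assms(1,2) M] gate[OF assms(3) M(2,3,1)]]
    M assms(3) I_subset by auto

end

locale discrete_median_space = median_metric_space +
  assumes geodesics: "\<lbrakk>x \<in> M; y \<in> M\<rbrakk> \<Longrightarrow> \<exists>n v. d x y = real n \<and> v 0 = x \<and> v n = y \<and>
    (\<forall>i\<le>n. v i \<in> M) \<and> (\<forall>i<n. d (v i) (v (Suc i)) = 1)"
begin

text \<open>Distances are integers, so the median of \<open>u\<close>, \<open>w\<close> and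
  \<open>x\<close> is an end of the edge; which end it is tells the side of the edge on which
  \<open>x\<close> lies.\<close>

lemma edge_dichotomy:
  assumes "d u w = 1" and M: "u \<in> M" "w \<in> M" "x \<in> M"
  shows "w \<in> I u x \<longleftrightarrow> u \<notin> I w x"
proof
  assume "w \<in> I u x" then show "u \<notin> I w x"
    using I_antisym[of w x u, OF I_flip I_flip] assms(1) M by (auto simp: zero)
next
  assume *: "u \<notin> I w x"
  let ?p = "m u w x"
  have p: "?p \<in> M" "?p \<in> I u w" "?p \<in> I u x" "?p \<in> I w x" using median_mem M by auto
  obtain i where i: "d u ?p = real i" using geodesics[OF M(1) p(1)] by auto
  obtain j where j: "d ?p w = real j" using geodesics[OF p(1) M(2)] by auto
  have "real i + real j = 1" using p(2) i j assms(1) by (simp add: metric_interval_def)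
  then have "i = 0 \<or> j = 0" by linarith
  then have "d u ?p = 0 \<or> d ?p w = 0" using i j by auto
  then have "?p = u \<or> ?p = w" using zero[OF M(1) p(1)] zero[OF p(1) M(2)] by auto
  then show "w \<in> I u x" using p * by auto
qed

end

section \<open>Coordinates of an interval along a geodesic between its ends\<close>

locale discrete_median_interval = discrete_median_space +
  fixes n :: nat and v :: "nat \<Rightarrow> 'a"
  assumes n: "d (v 0) (v n) = real n"
    and v_mem: "i \<le> n \<Longrightarrow> v i \<in> M"
    and v_step: "i < n \<Longrightarrow> d (v i) (v (Suc i)) = 1"
begin

text \<open>The \<open>i\<close>-th edge of the geodesic cuts \<open>M\<close> into two halfspaces;
  coordinate \<open>i\<close> stands for the one that leaves out \<open>v 0\<close>.\<close>

definition \<theta> :: "'a \<Rightarrow> nat set" where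
  "\<theta> x = {i. i < n \<and> v (Suc i) \<in> I (v i) x}"

lemma \<theta>_iff: "i < n \<Longrightarrow> x \<in> M \<Longrightarrow> i \<notin> \<theta> x \<longleftrightarrow> v i \<in> I (v (Suc i)) x"
  using edge_dichotomy[of "v i" "v (Suc i)" x] v_mem v_step by (auto simp: \<theta>_def)

lemma \<theta>_subset: "\<theta> x \<subseteq> {..<n}"
  by (auto simp: \<theta>_def)

lemma finite_\<theta> [simp]: "finite (\<theta> x)"
  using \<theta>_subset finite_subset by blast

lemma \<theta>_convex:
  assumes "z \<in> I x y" "x \<in> M" "y \<in> M"
  shows "i \<in> \<theta> x \<Longrightarrow> i \<in> \<theta> y \<Longrightarrow> i \<in> \<theta> z"
    and "i \<notin> \<theta> x \<Longrightarrow> i \<notin> \<theta> y \<Longrightarrow> i \<notin> \<theta> z"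
proof -
  have z: "z \<in> M" using assms I_subset by blast
  show "i \<in> \<theta> z" if "i \<in> \<theta> x" "i \<in> \<theta> y"
    using that halfspace_convex[OF _ _ assms(1)] v_mem[of i] assms unfolding \<theta>_def by auto
  show "i \<notin> \<theta> z" if "i \<notin> \<theta> x" "i \<notin> \<theta> y"
  proof (cases "i < n")
    case True
    then show ?thesis
      using that \<theta>_iff[OF True] halfspace_convex[OF _ _ assms(1)] v_mem[of "Suc i"] assms z by auto
  qed (auto simp: \<theta>_def)
qed

text \<open>Two of the three points lie on the same side of halfspace \<open>i\<close>, and the
  median lies between these two; both sides are convex.\<close>

lemma \<theta>_median:
  assumes "x \<in> M" "y \<in> M" "z \<in> M"
  shows "\<theta> (m x y z) = majority (\<theta> x) (\<theta> y) (\<theta> z)"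
proof -
  have 1: "m x y z \<in> I x y" "m x y z \<in> I y z" "m x y z \<in> I x z"
    using median_mem assms by auto
  have "i \<in> \<theta> (m x y z) \<longleftrightarrow> i \<in> majority (\<theta> x) (\<theta> y) (\<theta> z)" for i
    using \<theta>_convex[OF 1(1), of i] \<theta>_convex[OF 1(2), of i] \<theta>_convex[OF 1(3), of i] assms
    unfolding majority_def by blast
  then show ?thesis by blast
qed

lemma v_dist:
  assumes "i \<le> j" "j \<le> n"
  shows "d (v i) (v j) = real (j - i)"
proof -
  have le: "d (v i) (v j) \<le> real (j - i)" if "i \<le> j" "j \<le> n" for i j
    using that
  proof (induction j rule: dec_induct)
    case base then show ?case using v_mem by simp
  next
    case (step j)
    then show ?case
      using triangle[of "v i" "v j" "v (Suc j)"] v_step[of j] v_mem by (simp add: Suc_diff_le)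
  qed
  have "real n \<le> d (v 0) (v i) + d (v i) (v j) + d (v j) (v n)"
    using triangle[of "v 0" "v i" "v n"] triangle[of "v i" "v j" "v n"] n v_mem assms by simp
  then show ?thesis using le[of 0 i] le[of i j] le[of j n] assms by (simp add: of_nat_diff)
qed

lemma \<theta>_v:
  assumes "j \<le> n" shows "\<theta> (v j) = {..<j}"
proof -
  have "i \<in> \<theta> (v j) \<longleftrightarrow> i < j" if "i < n" for i
  proof (cases "i < j")
    case True
    then have "v (Suc i) \<in> I (v i) (v j)"
      using v_dist[of i j] v_dist[of "Suc i" j] v_dist[of i "Suc i"] v_mem assms
      by (simp add: metric_interval_def)
    then show ?thesis using True that by (auto simp: \<theta>_def)
  next
    case False
    then have "v i \<in> I (v (Suc i)) (v j)"
      using v_dist[of j i] v_dist[of j "Suc i"] v_dist[of i "Suc i"] v_mem that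
      by (simp add: metric_interval_def commute)
    then show ?thesis using \<theta>_iff[OF that v_mem[OF assms]] False by auto
  qed
  then show ?thesis using \<theta>_subset[of "v j"] assms by auto
qed

text \<open>An edge is crossed by one halfspace only: a halfspace containing \<open>w\<close> but not the adjacent
  vertex \<open>u\<close> consists of the \<open>x\<close> with \<open>w \<in> I u x\<close>.\<close>

lemma \<theta>_edge_determined:
  assumes e: "d u w = 1" and M: "u \<in> M" "w \<in> M" "x \<in> M"
    and i: "i \<notin> \<theta> u" "i \<in> \<theta> w"
  shows "i \<in> \<theta> x \<longleftrightarrow> w \<in> I u x"
proof
  assume "w \<in> I u x" then show "i \<in> \<theta> x" using \<theta>_convex(2)[of w u x i] i M by blast
next
  assume "i \<in> \<theta> x" then show "w \<in> I u x"
    using edge_dichotomy[OF e M] \<theta>_convex(1)[of u w x i] i M by blast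
qed

text \<open>Two coordinates that change along the same edge agree on all of \<open>M\<close>,
  because both leave out \<open>v 0\<close>. But the sets \<open>\<theta> (v j)\<close> are the
  initial segments, which tell any two coordinates apart.\<close>

lemma \<theta>_edge:
  assumes e: "d u w = 1" and M: "u \<in> M" "w \<in> M"
  shows "card (sym_diff (\<theta> u) (\<theta> w)) \<le> 1"
proof -
  have "i = j" if ij: "i \<in> sym_diff (\<theta> u) (\<theta> w)" "j \<in> sym_diff (\<theta> u) (\<theta> w)" for i j
  proof -
    have lt: "i < n" "j < n" using ij \<theta>_subset by auto
    have e': "d w u = 1" using e commute by simp
    have "(\<forall>x\<in>M. i \<in> \<theta> x \<longleftrightarrow> w \<in> I u x) \<or> (\<forall>x\<in>M. i \<in> \<theta> x \<longleftrightarrow> u \<in> I w x)"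
      and "(\<forall>x\<in>M. j \<in> \<theta> x \<longleftrightarrow> w \<in> I u x) \<or> (\<forall>x\<in>M. j \<in> \<theta> x \<longleftrightarrow> u \<in> I w x)"
      using ij \<theta>_edge_determined[OF e M] \<theta>_edge_determined[OF e' M(2,1)] by blast+
    moreover have "i \<notin> \<theta> (v 0)" "j \<notin> \<theta> (v 0)" "v 0 \<in> M" using \<theta>_v[of 0] v_mem by auto
    ultimately have "\<forall>x\<in>M. i \<in> \<theta> x \<longleftrightarrow> j \<in> \<theta> x"
      using edge_dichotomy[OF e M] by meson
    then have "i \<in> \<theta> (v (Suc j))" "j \<in> \<theta> (v (Suc i))"
      using \<theta>_v[of "Suc j"] \<theta>_v[of "Suc i"] v_mem lt by auto
    then show "i = j" using \<theta>_v[of "Suc j"] \<theta>_v[of "Suc i"] lt by auto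
  qed
  then show ?thesis
    using card_le_Suc0_iff_eq[of "sym_diff (\<theta> u) (\<theta> w)"] by (metis One_nat_def finite_Diff finite_UnI finite_\<theta>)
qed

lemma \<theta>_lipschitz:
  assumes "x \<in> M" "y \<in> M"
  shows "real (card (sym_diff (\<theta> x) (\<theta> y))) \<le> d x y"
proof -
  obtain k w where w: "d x y = real k" "w 0 = x" "w k = y" "\<And>i. i \<le> k \<Longrightarrow> w i \<in> M"
    "\<And>i. i < k \<Longrightarrow> d (w i) (w (Suc i)) = 1"
    using geodesics[OF assms] by metis
  have "card (sym_diff (\<theta> (w 0)) (\<theta> (w i))) \<le> i" if "i \<le> k" for i
    using that
  proof (induction i)
    case (Suc i)
    have "sym_diff (\<theta> (w 0)) (\<theta> (w (Suc i))) \<subseteq>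
      sym_diff (\<theta> (w 0)) (\<theta> (w i)) \<union> sym_diff (\<theta> (w i)) (\<theta> (w (Suc i)))" by auto
    then have "card (sym_diff (\<theta> (w 0)) (\<theta> (w (Suc i)))) \<le>
      card (sym_diff (\<theta> (w 0)) (\<theta> (w i))) + card (sym_diff (\<theta> (w i)) (\<theta> (w (Suc i))))"
      by (meson card_Un_le card_mono dual_order.trans finite_Diff finite_UnI finite_\<theta>)
    then show ?case using Suc \<theta>_edge[OF w(5)[of i] w(4) w(4)] by fastforce
  qed simp
  then show ?thesis using w by fastforce
qed

text \<open>The Lipschitz bound yields lower bounds for the distances of \<open>x\<close> from
  \<open>v 0\<close> and from \<open>v n\<close>. On the interval these distances add up to
  \<open>n\<close>, as do the bounds, so both bounds are attained.\<close>

lemma dist_base: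
  assumes "x \<in> I (v 0) (v n)"
  shows "d (v 0) x = real (card (\<theta> x))"
proof -
  have x: "x \<in> M" using assms I_subset by blast
  have v: "v 0 \<in> M" "v n \<in> M" using v_mem by auto
  have "real (card (\<theta> x)) \<le> d (v 0) x" using \<theta>_lipschitz[OF v(1) x] \<theta>_v[of 0] by simp
  moreover have "real (card ({..<n} - \<theta> x)) \<le> d x (v n)"
    using \<theta>_lipschitz[OF x v(2)] \<theta>_v[of n] \<theta>_subset[of x] by (simp add: Diff_eq_empty_iff[THEN iffD2])
  moreover have "card ({..<n} - \<theta> x) = n - card (\<theta> x)" "card (\<theta> x) \<le> n"
    using \<theta>_subset[of x] card_Diff_subset[of "\<theta> x" "{..<n}"] card_mono[of "{..<n}" "\<theta> x"] by auto
  ultimately show ?thesis using assms n by (simp add: metric_interval_def of_nat_diff)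
qed

text \<open>The meet \<open>m (v 0) x y\<close> has coordinates
  \<open>\<theta> x \<inter> \<theta> y\<close> and lies between \<open>x\<close> and
  \<open>y\<close>, so the distance splits there into two parts known from \<open>dist_base\<close>.
  Hence \<open>\<theta>\<close> embeds the interval isometrically into a Hamming cube.\<close>

lemma dist_\<theta>:
  assumes x: "x \<in> I (v 0) (v n)" and y: "y \<in> I (v 0) (v n)"
  shows "d x y = real (card (sym_diff (\<theta> x) (\<theta> y)))"
proof -
  have M: "x \<in> M" "y \<in> M" "v 0 \<in> M" "v n \<in> M" using assms v_mem I_subset by auto
  let ?w = "m (v 0) x y"
  have w: "?w \<in> I (v 0) x" "?w \<in> I x y" "?w \<in> I (v 0) y" using median_mem M by auto
  have wI: "?w \<in> I (v 0) (v n)" using I_trans(1)[OF w(1) x] M by blast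
  have "\<theta> ?w = \<theta> x \<inter> \<theta> y" using \<theta>_median[OF M(3,1,2)] \<theta>_v[of 0] by (auto simp: majority_def)
  then have c: "d (v 0) ?w = real (card (\<theta> x \<inter> \<theta> y))" using dist_base[OF wI] by simp
  have "card (sym_diff (\<theta> x) (\<theta> y)) = card (\<theta> x - \<theta> y) + card (\<theta> y - \<theta> x)"
    by (intro card_Un_disjoint) auto
  moreover have "card (\<theta> x) = card (\<theta> x \<inter> \<theta> y) + card (\<theta> x - \<theta> y)"
    "card (\<theta> y) = card (\<theta> x \<inter> \<theta> y) + card (\<theta> y - \<theta> x)"
    using card_Int_Diff[of "\<theta> x" "\<theta> y"] card_Int_Diff[of "\<theta> y" "\<theta> x"] by (auto simp: Int_commute)
  ultimately show ?thesis
    using c dist_base[OF x] dist_base[OF y] w by (simp add: metric_interval_def commute)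
qed

lemma \<theta>_inj: "inj_on \<theta> (I (v 0) (v n))"
proof
  fix x y assume "x \<in> I (v 0) (v n)" "y \<in> I (v 0) (v n)" "\<theta> x = \<theta> y"
  then show "x = y" using dist_\<theta>[of x y] zero[of x y] I_subset by auto
qed

end

section \<open>Finite CAT(0) cube complexes\<close>

text \<open>Any two loops are homotopic, in particular two constant ones, and the image of the
  square under the homotopy is a connected set containing both base points. The realisation lives in
  a function space, so the argument is purely topological.\<close>

lemma simply_connected_imp_connected_topological:
  fixes S :: "'a::topological_space set"
  assumes "simply_connected S"
  shows "connected S"
proof -
  have "\<exists>T. connected T \<and> T \<subseteq> S \<and> a \<in> T \<and> b \<in> T" if "a \<in> S" "b \<in> S" for a b
  proof -
    have "homotopic_loops S (\<lambda>_. a) (\<lambda>_. b)"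
      using assms[unfolded simply_connected_def, rule_format, of "\<lambda>_. a" "\<lambda>_. b"] that
      by (simp add: path_def pathstart_def pathfinish_def path_image_def image_subset_iff)
    then obtain h :: "real \<times> real \<Rightarrow> 'a" where h: "continuous_on ({0..1} \<times> {0..1}) h"
      "h ` ({0..1} \<times> {0..1}) \<subseteq> S" "\<forall>x\<in>{0..1}. h (0, x) = a" "\<forall>x\<in>{0..1}. h (1, x) = b"
      by (auto simp: homotopic_loops image_subset_iff_funcset)
    have "connected (h ` ({0..1} \<times> {0..1}))"
      by (intro connected_continuous_image h(1) connected_Times) auto
    moreover have "a \<in> h ` ({0..1} \<times> {0..1})" "b \<in> h ` ({0..1} \<times> {0..1})"
      using imageI[of "(0, 0)" "{0..1} \<times> {0..1}" h] imageI[of "(1, 0)" "{0..1} \<times> {0..1}" h] h(3,4)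
      by auto
    ultimately show ?thesis using h(2) by blast
  qed
  then show ?thesis
    by (subst connected_iff_connected_component) (simp add: connected_component_def)
qed

lemma cube_complex_chart:
  assumes "cube_complex C" "c \<in> C"
  obtains k \<phi> where "cube_chart C c k \<phi>"
  using assms by (auto simp: cube_complex_def)

lemma cube_chart_face:
  assumes "cube_chart C c k \<phi>" "A \<subseteq> A'" "A' \<subseteq> {..<k}"
  shows "\<phi> ` {B. A \<subseteq> B \<and> B \<subseteq> A'} \<in> C"
  using assms unfolding cube_chart_def by blast

lemma cube_complex_vertex:
  assumes "cube_complex C" "c \<in> C" "v \<in> c"
  shows "{v} \<in> C"
proof -
  obtain k \<phi> where \<phi>: "cube_chart C c k \<phi>" using cube_complex_chart[OF assms(1,2)] .
  then obtain A where A: "A \<subseteq> {..<k}" "\<phi> A = v"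
    using assms(3) unfolding cube_chart_def bij_betw_def by blast
  have "{B. A \<subseteq> B \<and> B \<subseteq> A} = {A}" by auto
  then show ?thesis using cube_chart_face[OF \<phi> _ A(1), of A] A(2) by simp
qed

lemma cube_connected:
  assumes "cube_complex C" "c \<in> C" "u \<in> c" "w \<in> c"
  shows "(u, w) \<in> (cc_edges C)\<^sup>*"
proof -
  obtain k \<phi> where \<phi>: "cube_chart C c k \<phi>" using cube_complex_chart[OF assms(1,2)] .
  have inj: "inj_on \<phi> (Pow {..<k})" and c: "c = \<phi> ` Pow {..<k}"
    using \<phi> unfolding cube_chart_def bij_betw_def by auto
  have "(\<phi> A, \<phi> {}) \<in> (cc_edges C)\<^sup>* \<and> (\<phi> {}, \<phi> A) \<in> (cc_edges C)\<^sup>*" if "A \<subseteq> {..<k}" for A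
  proof -
    have "finite A" using that finite_subset by blast
    then show ?thesis using that
    proof (induction A rule: finite_induct)
      case (insert i A)
      have "{B. A \<subseteq> B \<and> B \<subseteq> insert i A} = {A, insert i A}" by auto
      then have "{\<phi> A, \<phi> (insert i A)} \<in> C"
        using cube_chart_face[OF \<phi>, of A "insert i A"] insert by auto
      moreover have "\<phi> A \<noteq> \<phi> (insert i A)"
        using inj_onD[OF inj, of A "insert i A"] insert by auto
      ultimately have "(\<phi> A, \<phi> (insert i A)) \<in> cc_edges C" "(\<phi> (insert i A), \<phi> A) \<in> cc_edges C"
        by (auto simp: cc_edges_def insert_commute)
      with insert show ?case by (auto intro: converse_rtrancl_into_rtrancl rtrancl_into_rtrancl)
    qed simp
  qed
  then show ?thesis using assms(3,4) c by (auto intro: rtrancl_trans)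
qed

lemma cc_realization_vertex:
  assumes "cube_complex C" "v \<in> \<Union>C"
  shows "(\<lambda>x. if x = v then 1 else 0) \<in> cc_realization C"
proof -
  have v: "{v} \<in> C" using assms(2) cube_complex_vertex[OF assms(1)] by auto
  then obtain k \<phi> where \<phi>: "cube_chart C {v} k \<phi>" using cube_complex_chart[OF assms(1)] by auto
  then have b: "bij_betw \<phi> (Pow {..<k}) {v}" by (simp add: cube_chart_def)
  then have "k = 0" using bij_betw_same_card[OF b] by (simp add: card_Pow)
  moreover have "\<phi> {} = v" using b by (auto simp: bij_betw_def)
  ultimately show ?thesis
    unfolding cc_realization_def mem_Collect_eq using v \<phi>
    by (intro bexI[of _ "{v}"] exI[of _ k] exI[of _ \<phi>] exI[of _ "\<lambda>_. 0"]) auto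
qed

text \<open>A point of the realisation is a probability distribution on the vertices of one cube,
  and \<open>U\<close> does not split any cube.\<close>

lemma cc_realization_mass:
  assumes "finite U" and w: "w \<in> cc_realization C"
    and U: "\<And>c. c \<in> C \<Longrightarrow> c \<subseteq> U \<or> c \<inter> U = {}"
  shows "sum w U \<in> {0, 1}"
proof -
  obtain c k \<phi> t where c: "c \<in> C" "cube_chart C c k \<phi>"
    and wt: "\<And>A. A \<subseteq> {..<k} \<Longrightarrow> w (\<phi> A) = (\<Prod>i\<in>A. t i) * (\<Prod>i\<in>{..<k} - A. 1 - t i)"
    and w0: "\<And>v. v \<notin> c \<Longrightarrow> w v = 0"
    using w unfolding cc_realization_def by blast
  show ?thesis
  proof (cases "c \<subseteq> U")
    case True
    have b: "bij_betw \<phi> (Pow {..<k}) c" using c by (simp add: cube_chart_def)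
    have "sum w U = sum w c" using w0 assms(1) True by (intro sum.mono_neutral_right) auto
    also have "\<dots> = (\<Sum>A\<in>Pow {..<k}. w (\<phi> A))" by (rule sum.reindex_bij_betw[OF b, symmetric])
    also have "\<dots> = (\<Sum>A\<in>Pow {..<k}. (\<Prod>i\<in>A. t i) * (\<Prod>i\<in>{..<k} - A. 1 - t i))"
      using wt by (intro sum.cong) auto
    also have "\<dots> = (\<Prod>i<k. t i + (1 - t i))" by (rule prod_add[symmetric]) simp
    finally show ?thesis by simp
  next
    case False
    then have "sum w U = 0" using U[OF c(1)] w0 by (intro sum.neutral) blast
    then show ?thesis by simp
  qed
qed

lemma finite_cube_complex_vertices:
  assumes "cube_complex C" "finite C"
  shows "finite (\<Union>C)"
proof -
  have "finite c" if c: "c \<in> C" for c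
  proof -
    obtain k \<phi> where "cube_chart C c k \<phi>" using cube_complex_chart[OF assms(1) c] .
    then have "bij_betw \<phi> (Pow {..<k}) c" by (simp add: cube_chart_def)
    then show ?thesis using bij_betw_finite[of \<phi> "Pow {..<k}" c] by simp
  qed
  then show ?thesis using assms(2) by (intro finite_Union) auto
qed

lemma cc_edges_sym: "(u, w) \<in> cc_edges C \<Longrightarrow> (w, u) \<in> cc_edges C"
  by (auto simp: cc_edges_def insert_commute)

lemma cc_edges_vertices: "(u, w) \<in> cc_edges C \<Longrightarrow> u \<in> \<Union>C \<and> w \<in> \<Union>C"
  by (auto simp: cc_edges_def)

text \<open>The mass that a point of the realisation gives to the edge component of \<open>u\<close>
  is continuous with values 0 and 1 only; on a connected space it cannot be 1 at \<open>u\<close>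
  and 0 at \<open>w\<close>. Connectedness of the graph is what makes \<open>LEAST\<close> in
  \<open>cc_dist\<close> meaningful.\<close>

lemma cc_connected:
  assumes "finite_CAT0_cube_complex C" and v: "u \<in> \<Union>C" "w \<in> \<Union>C"
  shows "(u, w) \<in> (cc_edges C)\<^sup>*"
proof (rule ccontr)
  assume nw: "(u, w) \<notin> (cc_edges C)\<^sup>*"
  have C: "finite C" "cube_complex C" "simply_connected (cc_realization C)"
    using assms by (auto simp: finite_CAT0_cube_complex_def)
  define U where "U = {x \<in> \<Union>C. (u, x) \<in> (cc_edges C)\<^sup>*}"
  define F where "F p = sum p U" for p :: "'a \<Rightarrow> real"
  have U: "finite U" using finite_subset[OF _ finite_cube_complex_vertices[OF C(2,1)], of U] by (auto simp: U_def)
  have cU: "c \<subseteq> U \<or> c \<inter> U = {}" if "c \<in> C" for c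
    using cube_connected[OF C(2) that] that unfolding U_def by (auto intro: rtrancl_trans)
  have "continuous_on (cc_realization C) F"
    unfolding F_def by (intro continuous_on_sum continuous_on_subset[OF continuous_on_product_coordinates]) auto
  then have "connected (F ` cc_realization C)"
    using connected_continuous_image simply_connected_imp_connected_topological[OF C(3)] by blast
  moreover have "F ` cc_realization C \<subseteq> {0, 1}"
    using cc_realization_mass[OF U _ cU] by (auto simp: F_def)
  moreover have "F (\<lambda>x. if x = u then 1 else 0) = 1" "F (\<lambda>x. if x = w then 1 else 0) = 0"
    using U v nw by (auto simp: F_def U_def)
  then have "0 \<in> F ` cc_realization C" "1 \<in> F ` cc_realization C"
    using cc_realization_vertex[OF C(2)] v by (metis imageI)+
  ultimately have "{0..1} \<subseteq> {0, 1::real}" using connected_contains_Icc by blast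
  moreover have "(1/2::real) \<in> {0..1}" by simp
  ultimately have "(1/2::real) \<in> {0, 1}" by (rule subsetD)
  then show False by simp
qed

lemma cc_dist_witness:
  assumes "finite_CAT0_cube_complex C" "u \<in> \<Union>C" "w \<in> \<Union>C"
  obtains k where "cc_dist C u w = real k" "(u, w) \<in> cc_edges C ^^ k"
proof
  show "cc_dist C u w = real (LEAST n. (u, w) \<in> cc_edges C ^^ n)" by (simp add: cc_dist_def)
  obtain j where "(u, w) \<in> cc_edges C ^^ j" using cc_connected[OF assms] rtrancl_imp_relpow by blast
  then show "(u, w) \<in> cc_edges C ^^ (LEAST n. (u, w) \<in> cc_edges C ^^ n)" by (rule LeastI)
qed

lemma cc_dist_le: "(u, w) \<in> cc_edges C ^^ j \<Longrightarrow> cc_dist C u w \<le> real j"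
  unfolding cc_dist_def by (simp add: Least_le)

lemma relpow_cc_edges_sym: "(u, w) \<in> cc_edges C ^^ k \<Longrightarrow> (w, u) \<in> cc_edges C ^^ k"
proof (induction k arbitrary: w)
  case (Suc k)
  then obtain x where "(u, x) \<in> cc_edges C ^^ k" "(x, w) \<in> cc_edges C" by auto
  then show ?case using Suc.IH cc_edges_sym by (metis relpow_Suc_I2)
qed simp

lemma cc_dist_commute: "cc_dist C u w = cc_dist C w u"
  unfolding cc_dist_def using relpow_cc_edges_sym by metis

lemma cc_dist_edge:
  assumes "(u, w) \<in> cc_edges C"
  shows "cc_dist C u w = 1"
proof -
  have "(LEAST n. (u, w) \<in> cc_edges C ^^ n) = 1"
  proof (rule Least_equality)
    show "1 \<le> n" if "(u, w) \<in> cc_edges C ^^ n" for n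
      using that assms by (cases n) (auto simp: cc_edges_def)
  qed (use assms in simp)
  then show ?thesis by (simp add: cc_dist_def)
qed

lemma discrete_median_space_cc:
  assumes C: "finite_CAT0_cube_complex C" and m: "is_cc_median C m"
  shows "discrete_median_space (\<Union>C) (cc_dist C) m"
proof
  show "0 \<le> cc_dist C u w" "cc_dist C u w = cc_dist C w u" for u w
    using cc_dist_commute[of C u w] by (auto simp: cc_dist_def)
  show "(cc_dist C u w = 0) = (u = w)" if uw: "u \<in> \<Union>C" "w \<in> \<Union>C" for u w
  proof
    assume 0: "cc_dist C u w = 0"
    obtain k where "cc_dist C u w = real k" "(u, w) \<in> cc_edges C ^^ k"
      using cc_dist_witness[OF C uw] .
    then show "u = w" using 0 by simp
  next
    assume "u = w"
    then have "(u, w) \<in> cc_edges C ^^ 0" by simp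
    from cc_dist_le[OF this] show "cc_dist C u w = 0" by (simp add: cc_dist_def)
  qed
  show "cc_dist C u z \<le> cc_dist C u w + cc_dist C w z"
    if uw: "u \<in> \<Union>C" and w: "w \<in> \<Union>C" and z: "z \<in> \<Union>C" for u w z
  proof -
    obtain i where i: "cc_dist C u w = real i" "(u, w) \<in> cc_edges C ^^ i"
      using cc_dist_witness[OF C uw w] .
    obtain j where j: "cc_dist C w z = real j" "(w, z) \<in> cc_edges C ^^ j"
      using cc_dist_witness[OF C w z] .
    have "(u, z) \<in> cc_edges C ^^ (i + j)" using i j by (auto simp: relpow_add)
    from cc_dist_le[OF this] show ?thesis using i j by simp
  qed
  show "metric_interval (\<Union>C) (cc_dist C) x y \<inter> metric_interval (\<Union>C) (cc_dist C) y z \<inter>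
      metric_interval (\<Union>C) (cc_dist C) z x = {m x y z}"
    if "x \<in> \<Union>C" "y \<in> \<Union>C" "z \<in> \<Union>C" for x y z
    using m that unfolding is_cc_median_def cc_interval_def metric_interval_def by blast
  show "\<exists>n v. cc_dist C x y = real n \<and> v 0 = x \<and> v n = y \<and> (\<forall>i\<le>n. v i \<in> \<Union>C) \<and>
      (\<forall>i<n. cc_dist C (v i) (v (Suc i)) = 1)" if xy: "x \<in> \<Union>C" "y \<in> \<Union>C" for x y
  proof -
    obtain n where n: "cc_dist C x y = real n" "(x, y) \<in> cc_edges C ^^ n"
      using cc_dist_witness[OF C xy] .
    then obtain v where v: "v 0 = x" "v n = y" "\<forall>i<n. (v i, v (Suc i)) \<in> cc_edges C"
      unfolding relpow_fun_conv by blast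
    have "v i \<in> \<Union>C" if "i \<le> n" for i
      using that v xy cc_edges_vertices[of "v i" "v (Suc i)" C] by (cases "i = n") auto
    then show ?thesis using n v cc_dist_edge[of _ _ C] by (intro exI[of _ n] exI[of _ v]) auto
  qed
qed

section \<open>Cubes in median algebras\<close>

locale median_alg =
  fixes Q :: "'q set" and m :: "'q \<Rightarrow> 'q \<Rightarrow> 'q \<Rightarrow> 'q"
  assumes median_algebra: "median_algebra Q m"
begin

lemma m_closed [simp, intro]: "\<lbrakk>u \<in> Q; v \<in> Q; w \<in> Q\<rbrakk> \<Longrightarrow> m u v w \<in> Q"
  and comm1: "\<lbrakk>u \<in> Q; v \<in> Q; w \<in> Q\<rbrakk> \<Longrightarrow> m u v w = m v u w"
  and comm2: "\<lbrakk>u \<in> Q; v \<in> Q; w \<in> Q\<rbrakk> \<Longrightarrow> m u v w = m u w v"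
  and idem [simp]: "\<lbrakk>u \<in> Q; v \<in> Q\<rbrakk> \<Longrightarrow> m u u v = u"
  and dist: "\<lbrakk>a \<in> Q; b \<in> Q; u \<in> Q; v \<in> Q; w \<in> Q\<rbrakk> \<Longrightarrow> m a b (m u v w) = m (m a b u) (m a b v) w"
  using median_algebra unfolding median_algebra_def by blast+

lemma idem' [simp]: "\<lbrakk>u \<in> Q; v \<in> Q\<rbrakk> \<Longrightarrow> m u v u = u" "\<lbrakk>u \<in> Q; v \<in> Q\<rbrakk> \<Longrightarrow> m v u u = u"
  using comm1[of u v u] comm2[of u v u] idem[of u v] by auto

text \<open>The axiom distributes over two arguments. As \<open>m a b\<close> is idempotent, it may
  be applied once more, and this second application reaches the third argument.\<close>

lemma dist3:
  assumes "a \<in> Q" "b \<in> Q" "u \<in> Q" "v \<in> Q" "w \<in> Q"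
  shows "m a b (m u v w) = m (m a b u) (m a b v) (m a b w)"
proof -
  note [simp] = assms
  have "m a b (m a b t) = m a b t" if "t \<in> Q" for t
    using that dist[of a b a b t] by simp
  then have "m a b (m u v w) = m a b (m (m a b u) (m a b v) w)"
    using dist[of a b u v w] by (metis assms m_closed)
  also have "\<dots> = m a b (m (m a b u) w (m a b v))" using comm2[of "m a b u" "m a b v" w] by simp
  also have "\<dots> = m (m a b (m a b u)) (m a b w) (m a b v)" by (simp add: dist)
  also have "\<dots> = m (m a b u) (m a b v) (m a b w)"
    using dist[of a b a b u] comm2[of "m a b u" "m a b w" "m a b v"] by simp
  finally show ?thesis .
qed

end

section \<open>The distributive lattice on an interval of a median algebra\<close>

locale median_alg_interval = median_alg +
  fixes x y :: 'a
  assumes x [simp, intro]: "x \<in> Q" and y [simp, intro]: "y \<in> Q"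
begin

definition L :: "'a set" where "L = {u \<in> Q. m x y u = u}"

definition meet (infixl "\<sqinter>" 70) where "u \<sqinter> v = m x u v"
definition join (infixl "\<squnion>" 65) where "u \<squnion> v = m y u v"

lemma L_Q [simp]: "u \<in> L \<Longrightarrow> u \<in> Q" and L_eq: "u \<in> L \<Longrightarrow> m x y u = u"
  and L_I: "u \<in> Q \<Longrightarrow> m x y u = u \<Longrightarrow> u \<in> L"
  by (simp_all add: L_def)

lemma L_med:
  assumes "u \<in> L" "v \<in> L" "w \<in> Q"
  shows "m u v w \<in> L"
proof -
  have uv: "u \<in> Q" "v \<in> Q" "m x y u = u" "m x y v = v" using assms L_eq by auto
  have "m x y (m u v w) = m u v w" using dist[OF x y uv(1,2) assms(3)] unfolding uv .
  then show ?thesis using uv assms by (simp add: L_I)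
qed

lemma x_L [simp]: "x \<in> L" and y_L [simp]: "y \<in> L"
  by (auto intro: L_I)

lemma proj_L: "u \<in> Q \<Longrightarrow> m x y u \<in> L"
  using L_med[of x y u] by simp

lemma med_closed [simp]: "\<lbrakk>u \<in> L; v \<in> L; w \<in> L\<rbrakk> \<Longrightarrow> m u v w \<in> L"
  by (simp add: L_med)

lemma meet_closed [simp]: "u \<in> L \<Longrightarrow> v \<in> L \<Longrightarrow> u \<sqinter> v \<in> L"
  and join_closed [simp]: "u \<in> L \<Longrightarrow> v \<in> L \<Longrightarrow> u \<squnion> v \<in> L"
  by (simp_all add: meet_def join_def)

lemma meet_comm: "u \<in> L \<Longrightarrow> v \<in> L \<Longrightarrow> u \<sqinter> v = v \<sqinter> u"
  and join_comm: "u \<in> L \<Longrightarrow> v \<in> L \<Longrightarrow> u \<squnion> v = v \<squnion> u"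
  by (simp_all add: meet_def join_def comm2)

lemma meet_assoc: "\<lbrakk>u \<in> L; v \<in> L; w \<in> L\<rbrakk> \<Longrightarrow> u \<sqinter> (v \<sqinter> w) = u \<sqinter> v \<sqinter> w"
  using dist[of x u x v w] by (simp add: meet_def)

lemma join_assoc: "\<lbrakk>u \<in> L; v \<in> L; w \<in> L\<rbrakk> \<Longrightarrow> u \<squnion> (v \<squnion> w) = u \<squnion> v \<squnion> w"
  using dist[of y u y v w] by (simp add: join_def)

lemma meet_idem [simp]: "u \<in> L \<Longrightarrow> u \<sqinter> u = u" and join_idem [simp]: "u \<in> L \<Longrightarrow> u \<squnion> u = u"
  by (simp_all add: meet_def join_def)

lemma m_xuy: "u \<in> L \<Longrightarrow> m x u y = u" and m_yux: "u \<in> L \<Longrightarrow> m y u x = u"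
proof -
  assume u: "u \<in> L"
  show 1: "m x u y = u" using u comm2[of x u y] L_eq by simp
  show "m y u x = u" using u 1 comm1[of y u x] comm2[of u y x] comm1[of u x y] by simp
qed

lemma meet_join_absorb: "u \<in> L \<Longrightarrow> v \<in> L \<Longrightarrow> u \<sqinter> (u \<squnion> v) = u"
  using dist[of x u y u v] by (simp add: meet_def join_def m_xuy)

lemma join_meet_absorb: "u \<in> L \<Longrightarrow> v \<in> L \<Longrightarrow> u \<squnion> (u \<sqinter> v) = u"
  using dist[of y u x u v] by (simp add: meet_def join_def m_yux)

lemma meet_join_distrib: "\<lbrakk>u \<in> L; v \<in> L; w \<in> L\<rbrakk> \<Longrightarrow> u \<sqinter> (v \<squnion> w) = (u \<sqinter> v) \<squnion> (u \<sqinter> w)"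
  using dist[of x u v w y] comm1[of y v w] comm2[of v y w] comm1[of y "m x u v" "m x u w"]
    comm2[of "m x u v" y "m x u w"]
  by (simp add: meet_def join_def)

lemma join_meet_distrib: "\<lbrakk>u \<in> L; v \<in> L; w \<in> L\<rbrakk> \<Longrightarrow> u \<squnion> (v \<sqinter> w) = (u \<squnion> v) \<sqinter> (u \<squnion> w)"
  using dist[of y u v w x] comm1[of x v w] comm2[of v x w] comm1[of x "m y u v" "m y u w"]
    comm2[of "m y u v" x "m y u w"]
  by (simp add: meet_def join_def)

text \<open>Writing \<open>w\<close> as \<open>m x y w\<close> and distributing \<open>m u v\<close>
  gives \<open>m ?P ?S w\<close>. As \<open>?P\<close> is below \<open>?S\<close>, this is the
  lattice term \<open>?P \<squnion> (w \<sqinter> ?S)\<close>, and distributivity gives the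
  symmetric form.\<close>

lemma median_eq:
  assumes [simp]: "u \<in> L" "v \<in> L" "w \<in> L"
  shows "m u v w = (u \<sqinter> v) \<squnion> ((v \<sqinter> w) \<squnion> (w \<sqinter> u))"
proof -
  let ?P = "u \<sqinter> v" and ?S = "u \<squnion> v"
  have PS: "?P \<sqinter> ?S = ?P" "?P \<squnion> ?S = ?S"
    using meet_assoc[of v u ?S] meet_join_absorb[of u v] meet_comm[of u v]
      join_assoc[of ?P u v] join_meet_absorb[of u v] join_comm[of ?P u] by simp_all
  have "m u v w = m u v (m x y w)" using L_eq[OF assms(3)] by simp
  also have "\<dots> = m (m u v x) (m u v y) w" by (simp add: dist)
  also have "m u v x = ?P" using comm2[of u v x] comm1[of u x v] by (simp add: meet_def)
  also have "m u v y = ?S" using comm2[of u v y] comm1[of u y v] by (simp add: join_def)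
  also have "m ?P ?S w = m ?P (m y ?P ?S) w" using PS by (simp add: join_def)
  also have "\<dots> = m (m ?P ?S y) (m ?P ?S ?P) w"
    using PS comm1[of ?P y ?S] comm2[of ?P y ?S] comm1[of ?P ?S w] by (simp add: join_def)
  also have "\<dots> = m ?P ?S (m y ?P w)" by (simp add: dist)
  also have "\<dots> = m (m y ?P w) ?P ?S"
    using comm2[of ?P ?S "m y ?P w"] comm1[of ?P "m y ?P w" ?S] by simp
  also have "\<dots> = m (m y ?P w) (m y ?P x) ?S" by (simp add: m_yux)
  also have "\<dots> = m y ?P (m w x ?S)" by (simp add: dist)
  also have "m w x ?S = w \<sqinter> ?S" using comm1[of w x ?S] by (simp add: meet_def)
  also have "w \<sqinter> ?S = (v \<sqinter> w) \<squnion> (w \<sqinter> u)"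
    using meet_join_distrib[of w u v] meet_comm[of v w] join_comm[of "w \<sqinter> u" "w \<sqinter> v"] by simp
  finally show ?thesis by (simp add: join_def)
qed

end

section \<open>Cubes spanned by families that are disjoint over a base\<close>

locale disjoint_family = median_alg_interval +
  fixes b :: 'a and c :: "nat \<Rightarrow> 'a"
  assumes b [simp]: "b \<in> L" and c [simp]: "c i \<in> L"
    and bc: "b \<sqinter> c i = b" and disj: "i \<noteq> j \<Longrightarrow> c i \<sqinter> c j = b"
begin

primrec G :: "nat \<Rightarrow> nat set \<Rightarrow> 'a" where
  "G 0 A = b"
| "G (Suc k) A = (if k \<in> A then c k \<squnion> G k A else G k A)"

lemma G_L [simp]: "G k A \<in> L"
  by (induction k) auto

lemma cb: "c i \<sqinter> b = b" using bc meet_comm by simp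

lemma b_join: "c i \<squnion> b = c i" using join_meet_absorb[of "c i" b] cb by simp

lemma b_G: "b \<sqinter> G k A = b"
  by (induction k) (auto simp: meet_join_distrib bc)

lemma b_join_G: "b \<squnion> G k A = G k A"
  using join_meet_absorb[of "G k A" b] b_G[of k A] meet_comm[of "G k A" b] join_comm[of b "G k A"] by simp

lemma c_G_notin: "i \<notin> A \<or> k \<le> i \<Longrightarrow> c i \<sqinter> G k A = b"
proof (induction k)
  case (Suc k)
  show ?case
  proof (cases "k \<in> A")
    case True
    then have "i \<noteq> k" "c i \<sqinter> G k A = b" using Suc by auto
    then show ?thesis using True disj[of i k] by (simp add: meet_join_distrib)
  qed (use Suc in auto)
qed (simp add: cb)

lemma c_G_in: "i \<in> A \<Longrightarrow> i < k \<Longrightarrow> c i \<sqinter> G k A = c i"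
proof (induction k)
  case (Suc k)
  show ?case
  proof (cases "i = k")
    case True then show ?thesis using Suc by (simp add: meet_join_absorb)
  next
    case False
    then have "c i \<sqinter> G k A = c i" "c i \<sqinter> c k = b" using Suc disj by auto
    then show ?thesis
      using Suc b_join[of i] by (simp add: meet_join_distrib join_comm[of b "c i"])
  qed
qed simp

lemma G_Int: "G k A \<sqinter> G k B = G k (A \<inter> B)"
proof (induction k)
  case (Suc k)
  have 1: "G k A' \<sqinter> c k = b" for A' using c_G_notin[of k A' k] meet_comm[of "c k" "G k A'"] by simp
  have 2: "(c k \<squnion> G k A) \<sqinter> G k B = G k (A \<inter> B)"
    using meet_join_distrib[of "G k B" "c k" "G k A"] meet_comm[of "c k \<squnion> G k A" "G k B"]
      meet_comm[of "G k A" "G k B"] Suc 1[of B] b_join_G[of k "A \<inter> B"] by simp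
  have 3: "G k A \<sqinter> (c k \<squnion> G k B) = G k (A \<inter> B)"
    using meet_join_distrib[of "G k A" "c k" "G k B"] Suc 1[of A] b_join_G[of k "A \<inter> B"] by simp
  have 4: "(c k \<squnion> G k A) \<sqinter> (c k \<squnion> G k B) = c k \<squnion> G k (A \<inter> B)"
    using join_meet_distrib[of "c k" "G k A" "G k B"] Suc by simp
  show ?case using Suc 2 3 4 by auto
qed simp

lemma G_Un: "G k A \<squnion> G k B = G k (A \<union> B)"
proof (induction k)
  case (Suc k)
  have 2: "(c k \<squnion> G k A) \<squnion> G k B = c k \<squnion> G k (A \<union> B)"
    using join_assoc[of "c k" "G k A" "G k B"] Suc by simp
  have 3: "G k A \<squnion> (c k \<squnion> G k B) = c k \<squnion> G k (A \<union> B)"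
    using join_assoc[of "G k A" "c k" "G k B"] join_assoc[of "c k" "G k A" "G k B"]
      join_comm[of "c k" "G k A"] Suc by simp
  have 4: "(c k \<squnion> G k A) \<squnion> (c k \<squnion> G k B) = c k \<squnion> G k (A \<union> B)"
    using join_assoc[of "c k" "G k A" "c k \<squnion> G k B"] join_assoc[of "c k" "c k" "G k (A \<union> B)"] 3 by simp
  show ?case using Suc 2 3 4 by auto
qed simp

lemma G_hom: "median_hom (Pow {..<k}) majority Q m (G k)"
  using G_L by (auto simp: median_hom_def median_eq G_Int G_Un majority_def Un_assoc)

lemma G_inj:
  assumes "\<And>i. i < k \<Longrightarrow> c i \<noteq> b"
  shows "inj_on (G k) (Pow {..<k})"
proof (rule inj_onI)
  fix A B assume AB: "A \<in> Pow {..<k}" "B \<in> Pow {..<k}" "G k A = G k B"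
  have "i \<in> A \<longleftrightarrow> i \<in> B" if "i < k" for i
    using c_G_in[of i A k] c_G_in[of i B k] c_G_notin[of i A k] c_G_notin[of i B k]
      that AB(3) assms[OF that] by (cases "i \<in> A"; cases "i \<in> B") auto
  then show "A = B" using AB by blast
qed

end

context median_alg_interval
begin

text \<open>A list fixes the order of the joins, so that errors can be counted join by join when
  this term is followed in a coarse median space.\<close>

definition overlap :: "(nat \<Rightarrow> 'a) \<Rightarrow> (nat \<times> nat) list \<Rightarrow> 'a" where
  "overlap c ps = foldr (\<lambda>(i, j) v. (c i \<sqinter> c j) \<squnion> v) ps x"

lemma overlap_L [simp]: "(\<And>i. c i \<in> L) \<Longrightarrow> overlap c ps \<in> L"
  by (induction ps) (auto simp: overlap_def)

lemma overlap_ge: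
  assumes c: "\<And>i. c i \<in> L" and "(i, j) \<in> set ps"
  shows "(c i \<sqinter> c j) \<squnion> overlap c ps = overlap c ps"
  using assms(2)
proof (induction ps)
  case (Cons p ps)
  obtain i' j' where p: "p = (i', j')" by force
  have [simp]: "c i \<in> L" for i by (rule c)
  have eq: "overlap c (p # ps) = (c i' \<sqinter> c j') \<squnion> overlap c ps" by (simp add: overlap_def p)
  show ?case
  proof (cases "p = (i, j)")
    case True
    then show ?thesis unfolding eq using p
      by (simp add: join_assoc)
  next
    case False
    then have "(c i \<sqinter> c j) \<squnion> overlap c ps = overlap c ps" using Cons by auto
    then show ?thesis unfolding eq
      using join_assoc[of "c i \<sqinter> c j" "c i' \<sqinter> c j'" "overlap c ps"]
        join_assoc[of "c i' \<sqinter> c j'" "c i \<sqinter> c j" "overlap c ps"]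
        join_comm[of "c i \<sqinter> c j" "c i' \<sqinter> c j'"] by simp
  qed
qed simp

text \<open>Joining every \<open>c i\<close> with all pairwise meets makes the family disjoint over that join; a disjoint
  family with all members above the base spans a cube.\<close>

lemma rank_cube:
  assumes c: "\<And>i. c i \<in> L" and "\<not> enat k \<le> median_rank Q m"
    and ps: "\<And>i j. \<lbrakk>i < k; j < k; i \<noteq> j\<rbrakk> \<Longrightarrow> (i, j) \<in> set ps"
  shows "\<exists>i<k. c i \<squnion> overlap c ps = overlap c ps"
proof (rule ccontr)
  assume ne: "\<not> ?thesis"
  let ?b = "overlap c ps"
  \<comment> \<open>Beyond \<open>k\<close> the base itself is a harmless value: it keeps the family
    disjoint over \<open>?b\<close> and contributes no direction.\<close>
  define c' where "c' i = (if i < k then ?b \<squnion> c i else ?b)" for i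
  have [simp]: "c i \<in> L" "?b \<in> L" for i using c by auto
  have "?b \<sqinter> c' i = ?b" for i by (simp add: c'_def meet_join_absorb)
  moreover have "c' i \<sqinter> c' j = ?b" if "i \<noteq> j" for i j
  proof (cases "i < k \<and> j < k")
    case True
    then have "c' i \<sqinter> c' j = ?b \<squnion> (c i \<sqinter> c j)" by (simp add: c'_def join_meet_distrib)
    then show ?thesis using overlap_ge[of c i j ps] True ps that by (simp add: join_comm)
  next
    case False
    then show ?thesis using meet_comm[of "?b \<squnion> c i" ?b] by (auto simp: c'_def meet_join_absorb)
  qed
  ultimately interpret disjoint_family Q m x y ?b c'
    by unfold_locales (auto simp: c'_def)
  have "c' i \<noteq> ?b" if "i < k" for i
    using ne that join_comm[of "c i" ?b] by (auto simp: c'_def)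
  then have "median_hom (Pow {..<k}) majority Q m (G k) \<and> inj_on (G k) (Pow {..<k})"
    using G_hom G_inj by blast
  then have "enat k \<le> median_rank Q m" unfolding median_rank_def by (intro SUP_upper) blast
  then show False using assms(2) by simp
qed

end

section \<open>Consequences of finite coarse rank\<close>

text \<open>One step of error propagation: it says how far a median in the approximating algebra
  drifts from the median of the points that its arguments follow.\<close>

lemma coarse_median_track:
  assumes X: "Metric_space X d" and \<mu>_closed: "\<And>a b c. \<lbrakk>a \<in> X; b \<in> X; c \<in> X\<rbrakk> \<Longrightarrow> \<mu> a b c \<in> X"
    and lip: "\<And>a b c a' b' c'. \<lbrakk>a \<in> X; b \<in> X; c \<in> X; a' \<in> X; b' \<in> X; c' \<in> X\<rbrakk> \<Longrightarrow>
      d (\<mu> a b c) (\<mu> a' b' c') \<le> H * (d a a' + d b b' + d c c') + H"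
    and H: "H \<ge> 0"
    and l: "l \<in> Q \<rightarrow> X" and Q: "z1 \<in> Q" "z2 \<in> Q" "z3 \<in> Q" "m z1 z2 z3 \<in> Q"
    and hom: "d (l (m z1 z2 z3)) (\<mu> (l z1) (l z2) (l z3)) \<le> \<eta>"
    and w: "w1 \<in> X" "w2 \<in> X" "w3 \<in> X"
    and e: "d (l z1) w1 \<le> e" "d (l z2) w2 \<le> e" "d (l z3) w3 \<le> e"
  shows "d (l (m z1 z2 z3)) (\<mu> w1 w2 w3) \<le> \<eta> + H * (3 * e) + H"
proof -
  interpret Metric_space X d by (rule X)
  have lX: "l z1 \<in> X" "l z2 \<in> X" "l z3 \<in> X" "l (m z1 z2 z3) \<in> X" using l Q by auto
  have "d (\<mu> (l z1) (l z2) (l z3)) (\<mu> w1 w2 w3) \<le> H * (d (l z1) w1 + d (l z2) w2 + d (l z3) w3) + H"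
    using lip lX w by blast
  also have "\<dots> \<le> H * (3 * e) + H"
    using e H by (intro add_right_mono mult_left_mono) auto
  finally show ?thesis
    using triangle[OF lX(4) \<mu>_closed[OF lX(1-3)] \<mu>_closed[OF w]] hom by linarith
qed

lemma coarse_median_withD:
  assumes "coarse_median_with X d \<mu> h r"
  shows "h n > 0"
    and "\<lbrakk>a \<in> X; b \<in> X; c \<in> X; a' \<in> X; b' \<in> X; c' \<in> X\<rbrakk> \<Longrightarrow>
      d (\<mu> a b c) (\<mu> a' b' c') \<le> h 0 * (d a a' + d b b' + d c c') + h 0"
    and "\<lbrakk>finite A; A \<noteq> {}; A \<subseteq> X; card A \<le> n\<rbrakk> \<Longrightarrow>
        \<exists>(Q :: nat set) mQ \<pi> l.
           finite Q \<and> median_algebra Q mQ \<and> median_rank Q mQ \<le> r \<and>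
           \<pi> \<in> A \<rightarrow> Q \<and> l \<in> Q \<rightarrow> X \<and>
           (\<forall>\<alpha>\<in>Q. \<forall>\<beta>\<in>Q. \<forall>\<gamma>\<in>Q. d (l (mQ \<alpha> \<beta> \<gamma>)) (\<mu> (l \<alpha>) (l \<beta>) (l \<gamma>)) \<le> h n) \<and>
           (\<forall>a\<in>A. d a (l (\<pi> a)) \<le> h n)"
  using assms unfolding coarse_median_with_def by simp_all

text \<open>Both sides are median terms in at most five points, and the corresponding identity holds
  exactly in a finite median algebra approximating these points; the terms are then compared through
  that algebra.\<close>

lemma coarse_median_five_points:
  assumes X: "Metric_space X d" and \<mu>_closed: "\<And>a b c. \<lbrakk>a \<in> X; b \<in> X; c \<in> X\<rbrakk> \<Longrightarrow> \<mu> a b c \<in> X"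
    and cm: "coarse_median_with X d \<mu> h r"
  obtains E where
    "\<And>a b x y z. \<lbrakk>a \<in> X; b \<in> X; x \<in> X; y \<in> X; z \<in> X\<rbrakk> \<Longrightarrow>
      d (\<mu> a b (\<mu> x y z)) (\<mu> (\<mu> a b x) (\<mu> a b y) (\<mu> a b z)) \<le> E"
    and "\<And>a b x. \<lbrakk>a \<in> X; b \<in> X; x \<in> X\<rbrakk> \<Longrightarrow> d (\<mu> a b (\<mu> a b x)) (\<mu> a b x) \<le> E"
proof -
  interpret Metric_space X d by (rule X)
  note lip = coarse_median_withD(2)[OF cm]
  \<comment> \<open>\<open>e1\<close> and \<open>e2\<close> bound the drift of a term with one and
    with two nested medians.\<close>
  define e1 where "e1 = h 5 + h 0 * (3 * h 5) + h 0"
  define e2 where "e2 = h 5 + h 0 * (3 * e1) + h 0"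
  have pos: "h 0 > 0" "h 5 > 0" "e1 > 0" using coarse_median_withD(1)[OF cm] by (auto simp: e1_def add_pos_pos)
  have *: "d (\<mu> a b (\<mu> x y z)) (\<mu> (\<mu> a b x) (\<mu> a b y) (\<mu> a b z)) \<le> 2 * e2 \<and>
      d (\<mu> a b (\<mu> a b x)) (\<mu> a b x) \<le> e1 + e2"
    if M: "a \<in> X" "b \<in> X" "x \<in> X" "y \<in> X" "z \<in> X" for a b x y z
  proof -
    have "card {a, b, x, y, z} \<le> 5"
      by (simp add: card_insert_if)
    then obtain Q :: "nat set" and mQ \<pi> l where ma: "median_algebra Q mQ" and \<pi>: "\<pi> \<in> {a, b, x, y, z} \<rightarrow> Q"
      and l: "l \<in> Q \<rightarrow> X"
      and hom: "\<forall>\<alpha>\<in>Q. \<forall>\<beta>\<in>Q. \<forall>\<gamma>\<in>Q. d (l (mQ \<alpha> \<beta> \<gamma>)) (\<mu> (l \<alpha>) (l \<beta>) (l \<gamma>)) \<le> h 5"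
      and near: "\<forall>t\<in>{a, b, x, y, z}. d t (l (\<pi> t)) \<le> h 5"
      using coarse_median_withD(3)[OF cm, of "{a, b, x, y, z}" 5] M by auto
    interpret median_alg Q mQ by unfold_locales (rule ma)
    have \<pi>Q [simp]: "\<pi> a \<in> Q" "\<pi> b \<in> Q" "\<pi> x \<in> Q" "\<pi> y \<in> Q" "\<pi> z \<in> Q" using \<pi> by auto
    have n: "d (l (\<pi> a)) a \<le> h 5" "d (l (\<pi> b)) b \<le> h 5" "d (l (\<pi> x)) x \<le> h 5"
      "d (l (\<pi> y)) y \<le> h 5" "d (l (\<pi> z)) z \<le> h 5"
      using near commute by auto
    have T: "d (l (mQ z1 z2 z3)) (\<mu> w1 w2 w3) \<le> h 5 + h 0 * (3 * e) + h 0"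
      if "z1 \<in> Q" "z2 \<in> Q" "z3 \<in> Q" "w1 \<in> X" "w2 \<in> X" "w3 \<in> X"
        "d (l z1) w1 \<le> e" "d (l z2) w2 \<le> e" "d (l z3) w3 \<le> e" for z1 z2 z3 w1 w2 w3 e
      using coarse_median_track[OF X \<mu>_closed lip _ l, where m = mQ] hom that pos(1) by simp
    have T1: "d (l (mQ (\<pi> a) (\<pi> b) (\<pi> t))) (\<mu> a b t) \<le> e1" if "t \<in> {x, y, z}" for t
      using T[of "\<pi> a" "\<pi> b" "\<pi> t" a b t "h 5"] that n M by (auto simp: e1_def)
    have Txyz: "d (l (mQ (\<pi> x) (\<pi> y) (\<pi> z))) (\<mu> x y z) \<le> e1"
      using T[of "\<pi> x" "\<pi> y" "\<pi> z" x y z "h 5"] n M by (auto simp: e1_def)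
    have le: "h 5 \<le> e1" using pos by (simp add: e1_def)
    then have n': "d (l (\<pi> a)) a \<le> e1" "d (l (\<pi> b)) b \<le> e1" using n by linarith+
    have A: "d (l (mQ (\<pi> a) (\<pi> b) (mQ (\<pi> x) (\<pi> y) (\<pi> z)))) (\<mu> a b (\<mu> x y z)) \<le> e2"
      using T[of "\<pi> a" "\<pi> b" "mQ (\<pi> x) (\<pi> y) (\<pi> z)" a b "\<mu> x y z" e1] Txyz n' M \<mu>_closed
      by (simp add: e2_def)
    have B: "d (l (mQ (mQ (\<pi> a) (\<pi> b) (\<pi> x)) (mQ (\<pi> a) (\<pi> b) (\<pi> y)) (mQ (\<pi> a) (\<pi> b) (\<pi> z))))
        (\<mu> (\<mu> a b x) (\<mu> a b y) (\<mu> a b z)) \<le> e2"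
      using T[of "mQ (\<pi> a) (\<pi> b) (\<pi> x)" "mQ (\<pi> a) (\<pi> b) (\<pi> y)" "mQ (\<pi> a) (\<pi> b) (\<pi> z)"
        "\<mu> a b x" "\<mu> a b y" "\<mu> a b z" e1] T1 M \<mu>_closed by (simp add: e2_def)
    have C: "d (l (mQ (\<pi> a) (\<pi> b) (mQ (\<pi> a) (\<pi> b) (\<pi> x)))) (\<mu> a b (\<mu> a b x)) \<le> e2"
      using T[of "\<pi> a" "\<pi> b" "mQ (\<pi> a) (\<pi> b) (\<pi> x)" a b "\<mu> a b x" e1] T1[of x] n' M \<mu>_closed
      by (simp add: e2_def)
    have lX: "l t \<in> X" if "t \<in> Q" for t using l that by auto
    have e: "mQ (\<pi> a) (\<pi> b) (mQ (\<pi> a) (\<pi> b) (\<pi> x)) = mQ (\<pi> a) (\<pi> b) (\<pi> x)"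
      using dist[of "\<pi> a" "\<pi> b" "\<pi> a" "\<pi> b" "\<pi> x"] by simp
    have "d (\<mu> a b (\<mu> x y z)) (\<mu> (\<mu> a b x) (\<mu> a b y) (\<mu> a b z)) \<le> 2 * e2"
      using triangle''[of "\<mu> a b (\<mu> x y z)" "l (mQ (\<pi> a) (\<pi> b) (mQ (\<pi> x) (\<pi> y) (\<pi> z)))"
          "\<mu> (\<mu> a b x) (\<mu> a b y) (\<mu> a b z)"] A B dist3[of "\<pi> a" "\<pi> b" "\<pi> x" "\<pi> y" "\<pi> z"] M \<mu>_closed lX
      by simp
    moreover have "d (\<mu> a b (\<mu> a b x)) (\<mu> a b x) \<le> e1 + e2"
      using triangle''[of "\<mu> a b (\<mu> a b x)" "l (mQ (\<pi> a) (\<pi> b) (\<pi> x))" "\<mu> a b x"]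
        C T1[of x] M \<mu>_closed lX unfolding e by simp
    ultimately show ?thesis by blast
  qed
  have "e1 \<le> e2" using pos by (simp add: e2_def e1_def mult_left_mono)
  then have "e1 + e2 \<le> 2 * e2" by simp
  then show thesis using * by (intro that[of "2 * e2"]) force+
qed

text \<open>In a median algebra approximating a large coarse median cube, the corners would, after removing
  overlaps, generate an actual cube.\<close>

lemma coarse_rank_cube:
  assumes X: "Metric_space X d" and \<mu>_closed: "\<And>a b c. \<lbrakk>a \<in> X; b \<in> X; c \<in> X\<rbrakk> \<Longrightarrow> \<mu> a b c \<in> X"
    and cm: "coarse_median_with X d \<mu> h (enat \<nu>)" and \<kappa>: "\<kappa> \<ge> 0"
  obtains E where "\<And>F. \<lbrakk>F \<in> Pow {..<Suc \<nu>} \<rightarrow> X;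
      \<And>A B C. \<lbrakk>A \<subseteq> {..<Suc \<nu>}; B \<subseteq> {..<Suc \<nu>}; C \<subseteq> {..<Suc \<nu>}\<rbrakk> \<Longrightarrow>
        d (F (majority A B C)) (\<mu> (F A) (F B) (F C)) \<le> \<kappa>\<rbrakk> \<Longrightarrow> \<exists>i<Suc \<nu>. d (F {i}) (F {}) \<le> E"
proof -
  interpret Metric_space X d by (rule X)
  note lip = coarse_median_withD(2)[OF cm]
  define k where "k = Suc \<nu>"
  define n :: nat where "n = 2 ^ k"
  \<comment> \<open>\<open>\<phi> e\<close> is the drift after a median of points with drift
    \<open>e\<close>: it collects the errors of \<open>l\<close>, of \<open>\<mu>\<close> and of
    \<open>F\<close>. The last summand \<open>e\<close> makes \<open>lev\<close>, the drift of terms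
    of depth \<open>i\<close>, increasing.\<close>
  define \<phi> where "\<phi> e = h n + h 0 * (3 * e) + h 0 + \<kappa> + e" for e
  define lev where "lev i = (\<phi> ^^ i) (h n)" for i
  define ps where "ps = filter (\<lambda>(i, j). i \<noteq> j) (List.product [0..<k] [0..<k])"
  have pos: "h 0 > 0" "h n > 0" using coarse_median_withD(1)[OF cm] by auto
  have lev_Suc: "lev (Suc i) = h n + h 0 * (3 * lev i) + h 0 + \<kappa> + lev i" for i
    by (simp add: lev_def \<phi>_def)
  have lev_pos: "lev i \<ge> 0" for i
    by (induction i) (use pos \<kappa> in \<open>auto simp: lev_Suc, simp add: lev_def\<close>)
  have lev_mono: "lev i \<le> lev j" if "i \<le> j" for i j
    using that
  proof (induction j rule: dec_induct)
    case (step j)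
    have "lev j \<le> lev (Suc j)" unfolding lev_Suc using pos \<kappa> lev_pos[of j] by simp
    then show ?case using step by linarith
  qed simp
  have main: "\<exists>i<k. d (F {i}) (F {}) \<le> 2 * lev (3 + length ps)"
    if F: "F \<in> Pow {..<k} \<rightarrow> X" and Fm: "\<And>A B C. \<lbrakk>A \<subseteq> {..<k}; B \<subseteq> {..<k}; C \<subseteq> {..<k}\<rbrakk> \<Longrightarrow>
        d (F (majority A B C)) (\<mu> (F A) (F B) (F C)) \<le> \<kappa>" for F
  proof -
    have FX: "F A \<in> X" if "A \<subseteq> {..<k}" for A using F that by auto
    have card: "card (F ` Pow {..<k}) \<le> n"
      using card_image_le[of "Pow {..<k}" F] by (simp add: card_Pow n_def)
    have fin: "finite (F ` Pow {..<k})" and ne: "F ` Pow {..<k} \<noteq> {}" by auto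
    have FP: "F ` Pow {..<k} \<subseteq> X" using F by auto
    obtain Q :: "nat set" and mQ \<pi> l where ma: "median_algebra Q mQ" "median_rank Q mQ \<le> enat \<nu>"
      and \<pi>: "\<pi> \<in> F ` Pow {..<k} \<rightarrow> Q" and l: "l \<in> Q \<rightarrow> X"
      and hom: "\<forall>\<alpha>\<in>Q. \<forall>\<beta>\<in>Q. \<forall>\<gamma>\<in>Q. d (l (mQ \<alpha> \<beta> \<gamma>)) (\<mu> (l \<alpha>) (l \<beta>) (l \<gamma>)) \<le> h n"
      and near: "\<forall>t\<in>F ` Pow {..<k}. d t (l (\<pi> t)) \<le> h n"
      using coarse_median_withD(3)[OF cm fin ne FP card] by (elim exE conjE) (rule that)
    have \<pi>Q: "\<pi> (F A) \<in> Q" if "A \<subseteq> {..<k}" for A using \<pi> that by auto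
    define x y where "x = \<pi> (F {})" and "y = \<pi> (F {..<k})"
    interpret median_alg_interval Q mQ x y
      using ma(1) \<pi>Q by unfold_locales (auto simp: x_def y_def)
    define Tr where "Tr i z A \<longleftrightarrow> z \<in> Q \<and> A \<subseteq> {..<k} \<and> d (l z) (F A) \<le> lev i" for i z A
    have base: "Tr 0 (\<pi> (F A)) A" if "A \<subseteq> {..<k}" for A
      using that near \<pi>Q commute by (auto simp: Tr_def lev_def)
    have mono: "Tr j z A" if "Tr i z A" "i \<le> j" for i j z A
      using that lev_mono[of i j] by (auto simp: Tr_def)
    have step: "Tr (Suc i) (mQ z1 z2 z3) B"
      if t: "Tr i z1 A1" "Tr i z2 A2" "Tr i z3 A3" and B: "majority A1 A2 A3 = B" for i z1 z2 z3 A1 A2 A3 B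
    proof -
      have t': "z1 \<in> Q" "z2 \<in> Q" "z3 \<in> Q" "A1 \<subseteq> {..<k}" "A2 \<subseteq> {..<k}" "A3 \<subseteq> {..<k}"
        "d (l z1) (F A1) \<le> lev i" "d (l z2) (F A2) \<le> lev i" "d (l z3) (F A3) \<le> lev i"
        using t unfolding Tr_def by auto
      have 1: "d (l (mQ z1 z2 z3)) (\<mu> (F A1) (F A2) (F A3)) \<le> h n + h 0 * (3 * lev i) + h 0"
        using coarse_median_track[OF X \<mu>_closed lip _ l, where m = mQ] hom t' pos(1) FX by simp
      have 2: "d (\<mu> (F A1) (F A2) (F A3)) (F B) \<le> \<kappa>" using Fm[OF t'(4-6)] B commute by simp
      have B': "B \<subseteq> {..<k}" using t'(4-6) B by (auto simp: majority_def)
      have "l (mQ z1 z2 z3) \<in> X" using l t' by auto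
      then have "d (l (mQ z1 z2 z3)) (F B) \<le> lev (Suc i)"
        using triangle[of "l (mQ z1 z2 z3)" "\<mu> (F A1) (F A2) (F A3)" "F B"] 1 2 lev_pos[of i]
          FX[OF B'] \<mu>_closed[OF FX[OF t'(4)] FX[OF t'(5)] FX[OF t'(6)]] by (simp add: lev_Suc)
      then show ?thesis using t' B' by (simp add: Tr_def)
    qed
    have Trx: "Tr i x {}" and Try: "Tr i y {..<k}" for i
      using mono[OF base, of "{}" i] mono[OF base, of "{..<k}" i] by (auto simp: x_def y_def)
    \<comment> \<open>The corner \<open>{i}\<close> is projected into the interval, where the
      lattice operations live; in the model cube this changes nothing, since the median of
      \<open>{}\<close>, \<open>{..<k}\<close> and \<open>{i}\<close> is \<open>{i}\<close>.\<close>
    define c where "c i = (if i < k then mQ x y (\<pi> (F {i})) else x)" for i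
    have cL: "c i \<in> L" for i using proj_L \<pi>Q by (auto simp: c_def)
    have Trc: "Tr (Suc 0) (c i) {i}" if "i < k" for i
      using step[OF Trx Try base, of "{i}" "{i}"] that by (simp add: c_def majority_def)
    \<comment> \<open>In the cube of corners all pairwise meets are \<open>{}\<close>, so the
      overlap stays near \<open>F {}\<close> even though it may differ from
      \<open>x\<close>.\<close>
    have Trb: "Tr (2 + length qs) (overlap c qs) {}" if "\<And>i j. (i, j) \<in> set qs \<Longrightarrow> i < k \<and> j < k \<and> i \<noteq> j" for qs
      using that
    proof (induction qs)
      case Nil then show ?case using Trx by (simp add: overlap_def)
    next
      case (Cons p qs)
      obtain i j where p: "p = (i, j)" by force
      have ij: "i < k" "j < k" "i \<noteq> j" using Cons.prems p by auto
      have "Tr 2 (meet (c i) (c j)) {}"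
        using step[OF Trx Trc Trc, of i j "{}"] ij by (simp add: meet_def majority_def numeral_2_eq_2)
      then have 1: "Tr (2 + length qs) (meet (c i) (c j)) {}" by (rule mono) simp
      have 2: "Tr (2 + length qs) (overlap c qs) {}"
        by (rule Cons.IH) (rule Cons.prems, simp)
      have "overlap c (p # qs) = mQ y (meet (c i) (c j)) (overlap c qs)" by (simp add: overlap_def p join_def)
      then show ?case using step[OF Try 1 2, of "{}"] by (simp add: majority_def)
    qed
    have pset: "(i, j) \<in> set ps \<longleftrightarrow> i < k \<and> j < k \<and> i \<noteq> j" for i j by (auto simp: ps_def)
    \<comment> \<open>Rank at most \<open>\<nu>\<close> forbids a cube with \<open>k\<close>
      directions, so some \<open>c i\<close> is absorbed by the overlap. The resulting point follows
      both corners \<open>{i}\<close> and \<open>{}\<close>, which are therefore close.\<close>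
    have "\<not> enat k \<le> median_rank Q mQ" using ma(2) by (auto simp: k_def dest: order_trans)
    then obtain i where i: "i < k" "join (c i) (overlap c ps) = overlap c ps"
      using rank_cube[of c k ps] cL pset by blast
    have b: "Tr (2 + length ps) (overlap c ps) {}" using Trb pset by blast
    have "Tr (2 + length ps) (c i) {i}" by (rule mono[OF Trc[OF i(1)]]) simp
    from step[OF Try this b, of "{i}"] i(1) have "Tr (3 + length ps) (join (c i) (overlap c ps)) {i}"
      by (auto simp: join_def majority_def numeral_3_eq_3)
    moreover have "Tr (3 + length ps) (overlap c ps) {}" by (rule mono[OF b]) simp
    ultimately have "d (l (overlap c ps)) (F {i}) \<le> lev (3 + length ps)"
      "d (l (overlap c ps)) (F {}) \<le> lev (3 + length ps)" "overlap c ps \<in> Q"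
      using i(2) by (auto simp: Tr_def)
    then have "d (F {i}) (F {}) \<le> 2 * lev (3 + length ps)"
      using triangle''[of "F {i}" "l (overlap c ps)" "F {}"] FX[of "{i}"] FX[of "{}"] i(1)
        funcset_mem[OF l] by simp
    then show ?thesis using i(1) by blast
  qed
  show thesis by (rule that) (rule main[unfolded k_def])
qed

section \<open>Combinatorial models of intervals\<close>

locale coarse_median = Metric_space X d for X :: "'a set" and d :: "'a \<Rightarrow> 'a \<Rightarrow> real" +
  fixes \<mu> :: "'a \<Rightarrow> 'a \<Rightarrow> 'a \<Rightarrow> 'a" and H :: real
  assumes H: "H \<ge> 1"
    and \<mu>_closed [simp]: "\<lbrakk>x \<in> X; y \<in> X; z \<in> X\<rbrakk> \<Longrightarrow> \<mu> x y z \<in> X"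
    and \<mu>_sym: "\<lbrakk>x \<in> X; y \<in> X; z \<in> X\<rbrakk> \<Longrightarrow> \<mu> x y z = \<mu> y x z \<and> \<mu> x y z = \<mu> x z y"
    and \<mu>_idem: "\<lbrakk>x \<in> X; y \<in> X\<rbrakk> \<Longrightarrow> \<mu> x x y = x"
    and \<mu>_lip: "\<lbrakk>x \<in> X; y \<in> X; z \<in> X; x' \<in> X; y' \<in> X; z' \<in> X\<rbrakk> \<Longrightarrow>
      d (\<mu> x y z) (\<mu> x' y' z') \<le> H * (d x x' + d y y' + d z z') + H"
    and five_points: "\<lbrakk>a \<in> X; b \<in> X; x \<in> X; y \<in> X; z \<in> X\<rbrakk> \<Longrightarrow>
      d (\<mu> a b (\<mu> x y z)) (\<mu> (\<mu> a b x) (\<mu> a b y) (\<mu> a b z)) \<le> H"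
    and \<mu>_proj: "\<lbrakk>a \<in> X; b \<in> X; x \<in> X\<rbrakk> \<Longrightarrow> d (\<mu> a b (\<mu> a b x)) (\<mu> a b x) \<le> H"
begin

lemma \<mu>_ends: "\<lbrakk>a \<in> X; b \<in> X\<rbrakk> \<Longrightarrow> \<mu> a b a = a" "\<lbrakk>a \<in> X; b \<in> X\<rbrakk> \<Longrightarrow> \<mu> a b b = b"
  using \<mu>_sym[of a b a] \<mu>_idem[of a b] \<mu>_sym[of a b b] \<mu>_sym[of b a b] \<mu>_idem[of b a] by auto

end

lemma coarse_median_of_space:
  assumes "coarse_median_space X \<mu> d"
  obtains H where "coarse_median X d \<mu> H"
proof -
  have X: "Metric_space X d" and \<mu>_closed: "\<And>a b c. \<lbrakk>a \<in> X; b \<in> X; c \<in> X\<rbrakk> \<Longrightarrow> \<mu> a b c \<in> X"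
    and sym: "\<And>a b c. \<lbrakk>a \<in> X; b \<in> X; c \<in> X\<rbrakk> \<Longrightarrow> \<mu> a b c = \<mu> b a c \<and> \<mu> a b c = \<mu> a c b"
    and idem: "\<And>a b. \<lbrakk>a \<in> X; b \<in> X\<rbrakk> \<Longrightarrow> \<mu> a a b = a"
    using assms unfolding coarse_median_space_def by simp_all
  obtain h where h: "coarse_median_with X d \<mu> h \<infinity>"
    using assms unfolding coarse_median_space_def by blast
  obtain E where E: "\<And>a b x y z. \<lbrakk>a \<in> X; b \<in> X; x \<in> X; y \<in> X; z \<in> X\<rbrakk> \<Longrightarrow>
      d (\<mu> a b (\<mu> x y z)) (\<mu> (\<mu> a b x) (\<mu> a b y) (\<mu> a b z)) \<le> E"
    "\<And>a b x. \<lbrakk>a \<in> X; b \<in> X; x \<in> X\<rbrakk> \<Longrightarrow> d (\<mu> a b (\<mu> a b x)) (\<mu> a b x) \<le> E"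
    using coarse_median_five_points[OF X \<mu>_closed h] by blast
  interpret Metric_space X d by (rule X)
  define H where "H = max 1 (max (h 0) E)"
  have H: "H \<ge> 1" "h 0 \<le> H" "E \<le> H" by (auto simp: H_def)
  have "coarse_median X d \<mu> H"
  proof unfold_locales
    show "d (\<mu> x y z) (\<mu> x' y' z') \<le> H * (d x x' + d y y' + d z z') + H"
      if "x \<in> X" "y \<in> X" "z \<in> X" "x' \<in> X" "y' \<in> X" "z' \<in> X" for x y z x' y' z'
    proof -
      have "d (\<mu> x y z) (\<mu> x' y' z') \<le> h 0 * (d x x' + d y y' + d z z') + h 0"
        using coarse_median_withD(2)[OF h] that by blast
      also have "\<dots> \<le> H * (d x x' + d y y' + d z z') + H"
        using H by (intro add_mono mult_right_mono) auto
      finally show ?thesis .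
    qed
  qed (use H \<mu>_closed sym idem order_trans[OF E(1) H(3)] order_trans[OF E(2) H(3)] in auto)
  then show thesis by (rule that)
qed

text \<open>A ring of sets \<open>L\<close> modelling the interval from \<open>a\<close> to \<open>b\<close>: \<open>f\<close> is the coarse median
  parametrisation, and \<open>p\<close> the gate map onto the interval in these coordinates.\<close>

locale interval_model = coarse_median +
  fixes \<kappa> :: real and a b :: 'a and n :: nat and L :: "nat set set"
    and f :: "nat set \<Rightarrow> 'a" and p :: "'a \<Rightarrow> nat set"
  assumes \<kappa>: "\<kappa> \<ge> 1" and a [simp]: "a \<in> X" and b [simp]: "b \<in> X"
    and L_sub: "A \<in> L \<Longrightarrow> A \<subseteq> {..<n}"
    and L_init: "j \<le> n \<Longrightarrow> {..<j} \<in> L"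
    and L_Int: "A \<in> L \<Longrightarrow> B \<in> L \<Longrightarrow> A \<inter> B \<in> L"
    and L_Un: "A \<in> L \<Longrightarrow> B \<in> L \<Longrightarrow> A \<union> B \<in> L"
    and f [simp]: "A \<in> L \<Longrightarrow> f A \<in> X"
    and p [simp]: "x \<in> X \<Longrightarrow> p x \<in> L"
    and f_lower: "A \<in> L \<Longrightarrow> B \<in> L \<Longrightarrow> real (card (sym_diff A B)) \<le> \<kappa> * d (f A) (f B) + \<kappa>"
    and f_upper: "A \<in> L \<Longrightarrow> B \<in> L \<Longrightarrow> d (f A) (f B) \<le> \<kappa> * real (card (sym_diff A B)) + \<kappa>"
    and f_median: "\<lbrakk>A \<in> L; B \<in> L; C \<in> L\<rbrakk> \<Longrightarrow> d (f (majority A B C)) (\<mu> (f A) (f B) (f C)) \<le> \<kappa>"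
    and f_a: "d (f {}) a \<le> \<kappa>" and f_b: "d (f {..<n}) b \<le> \<kappa>"
    and f_p: "x \<in> X \<Longrightarrow> d (f (p x)) (\<mu> a b x) \<le> \<kappa>"

lemma (in coarse_median) interval_models:
  assumes "quasicubical_intervals X \<mu> d"
  obtains \<kappa> where "\<And>a b. a \<in> X \<Longrightarrow> b \<in> X \<Longrightarrow> \<exists>n L f p. interval_model X d \<mu> H \<kappa> a b n L f p"
proof -
  obtain \<nu> \<kappa>0 where \<kappa>0: "\<kappa>0 \<ge> 1" and qc: "\<forall>a\<in>X. \<forall>b\<in>X.
         \<exists>(C :: nat set set) mQ l.
           finite_CAT0_cube_complex C \<and> cc_dim_at_most C \<nu> \<and> is_cc_median C mQ \<and>
           qi_embedding (\<Union>C) (cc_dist C) (median_interval X \<mu> a b) d \<kappa>0 \<kappa>0 l \<and>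
           coarsely_onto (\<Union>C) (median_interval X \<mu> a b) d \<kappa>0 l \<and>
           (\<forall>\<alpha>\<in>\<Union>C. \<forall>\<beta>\<in>\<Union>C. \<forall>\<gamma>\<in>\<Union>C.
              d (l (mQ \<alpha> \<beta> \<gamma>)) (\<mu> (l \<alpha>) (l \<beta>) (l \<gamma>)) \<le> \<kappa>0)"
    using assms unfolding quasicubical_intervals_def by (elim exE conjE) (rule that)
  \<comment> \<open>\<open>\<kappa>0 * \<kappa>0\<close> arises from solving the lower
    quasi-isometry bound for the distance in the complex. The terms with \<open>H\<close> serve the
    gate map: one comparison of medians, followed by coarse idempotence of the projection to the
    interval.\<close>
  define \<kappa> where "\<kappa> = \<kappa>0 + \<kappa>0 * \<kappa>0 + (H * (3 * \<kappa>0) + H) + H"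
  have pos: "\<kappa>0 * \<kappa>0 \<ge> 0" "H * (3 * \<kappa>0) + H \<ge> 0" "H \<ge> 0" using \<kappa>0 H by auto
  then have \<kappa>: "\<kappa> \<ge> 1" "\<kappa>0 \<le> \<kappa>" "\<kappa>0 * \<kappa>0 \<le> \<kappa>"
    using \<kappa>0 unfolding \<kappa>_def by linarith+
  have "\<exists>n L f p. interval_model X d \<mu> H \<kappa> a b n L f p" if ab: "a \<in> X" "b \<in> X" for a b
  proof -
    obtain C :: "nat set set" and mQ l where C: "finite_CAT0_cube_complex C" "is_cc_median C mQ"
      and qi: "qi_embedding (\<Union>C) (cc_dist C) (median_interval X \<mu> a b) d \<kappa>0 \<kappa>0 l"
      and onto: "coarsely_onto (\<Union>C) (median_interval X \<mu> a b) d \<kappa>0 l"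
      and hom: "\<forall>\<alpha>\<in>\<Union>C. \<forall>\<beta>\<in>\<Union>C. \<forall>\<gamma>\<in>\<Union>C. d (l (mQ \<alpha> \<beta> \<gamma>)) (\<mu> (l \<alpha>) (l \<beta>) (l \<gamma>)) \<le> \<kappa>0"
      using qc[THEN bspec, OF ab(1), THEN bspec, OF ab(2)] by (elim exE conjE) (rule that)
    define V where "V = \<Union>C"
    define D where "D = cc_dist C"
    have MX: "median_interval X \<mu> a b \<subseteq> X" using ab by (auto simp: median_interval_def)
    have l: "l v \<in> X" if "v \<in> V" for v
      using qi MX that by (auto simp: qi_embedding_def V_def)
    note hom' = hom[folded V_def, THEN bspec, THEN bspec, THEN bspec]
    interpret Q: discrete_median_space V D mQ
      unfolding V_def D_def by (rule discrete_median_space_cc[OF C])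
    have "\<exists>v\<in>V. d (\<mu> a b x) (l v) \<le> \<kappa>0" if "x \<in> X" for x
      using onto that unfolding coarsely_onto_def median_interval_def V_def by blast
    then obtain q where q: "\<And>x. x \<in> X \<Longrightarrow> q x \<in> V" "\<And>x. x \<in> X \<Longrightarrow> d (\<mu> a b x) (l (q x)) \<le> \<kappa>0"
      by metis
    \<comment> \<open>The complex may extend beyond the interval between \<open>\<alpha>\<close> and
      \<open>\<beta>\<close>. Only that interval enters the model; the median with
      \<open>\<alpha>\<close> and \<open>\<beta>\<close> moves all other vertices into it.\<close>
    define \<alpha> \<beta> where "\<alpha> = q a" and "\<beta> = q b"
    have V: "\<alpha> \<in> V" "\<beta> \<in> V" using q ab by (auto simp: \<alpha>_def \<beta>_def)
    have \<alpha>\<beta>: "d (l \<alpha>) a \<le> \<kappa>0" "d (l \<beta>) b \<le> \<kappa>0"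
      using q(2)[of a] q(2)[of b] ab \<mu>_ends commute by (auto simp: \<alpha>_def \<beta>_def)
    obtain n v where v: "D \<alpha> \<beta> = real n" "v 0 = \<alpha>" "v n = \<beta>" "\<And>i. i \<le> n \<Longrightarrow> v i \<in> V"
      "\<And>i. i < n \<Longrightarrow> D (v i) (v (Suc i)) = 1"
      using Q.geodesics[OF V] by metis
    interpret Q: discrete_median_interval V D mQ n v
      using v by unfold_locales auto
    define J where "J = metric_interval V D \<alpha> \<beta>"
    define e where "e = inv_into J Q.\<theta>"
    define L where "L = Q.\<theta> ` J"
    have JV: "w \<in> V" if "w \<in> J" for w using that by (auto simp: J_def metric_interval_def)
    have inj: "inj_on Q.\<theta> J" using Q.\<theta>_inj v by (simp add: J_def)
    have e\<theta>: "e (Q.\<theta> w) = w" if "w \<in> J" for w using inv_into_f_f[OF inj that] by (simp add: e_def)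
    have eJ: "e A \<in> J" "Q.\<theta> (e A) = A" if "A \<in> L" for A
      using that inv_into_into[of A Q.\<theta> J] f_inv_into_f[of A Q.\<theta> J] by (auto simp: e_def L_def)
    have \<alpha>J: "\<alpha> \<in> J" and \<beta>J: "\<beta> \<in> J" using Q.I_ends[OF V] by (auto simp: J_def)
    have \<theta>\<alpha>: "Q.\<theta> \<alpha> = {}" and \<theta>\<beta>: "Q.\<theta> \<beta> = {..<n}" using Q.\<theta>_v[of 0] Q.\<theta>_v[of n] v by auto
    have mJ: "mQ x y z \<in> J" if "x \<in> J" "y \<in> J" "z \<in> V" for x y z
      using Q.I_convex[of x \<alpha> \<beta> y] Q.median_mem(2)[of x y z] that JV V unfolding J_def by blast
    have \<theta>m: "Q.\<theta> (mQ x y z) = majority (Q.\<theta> x) (Q.\<theta> y) (Q.\<theta> z)" if "x \<in> V" "y \<in> V" "z \<in> V" for x y z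
      using Q.\<theta>_median that by blast
    \<comment> \<open>The third argument is an arbitrary vertex: with \<open>\<alpha>\<close>, whose
      coordinates are empty, this yields intersections, and with \<open>\<beta>\<close>
      unions.\<close>
    have L_maj: "majority A B (Q.\<theta> z) \<in> L \<and> e (majority A B (Q.\<theta> z)) = mQ (e A) (e B) z"
      if "A \<in> L" "B \<in> L" "z \<in> V" for A B z
    proof -
      have "Q.\<theta> (mQ (e A) (e B) z) = majority A B (Q.\<theta> z)"
        using \<theta>m[of "e A" "e B" z] eJ JV that by simp
      moreover have "mQ (e A) (e B) z \<in> J" using mJ eJ that by blast
      ultimately show ?thesis using e\<theta> L_def by (metis imageI)
    qed
    have D_card: "D (e A) (e B) = real (card (sym_diff A B))" if "A \<in> L" "B \<in> L" for A B
      using Q.dist_\<theta>[of "e A" "e B"] eJ that v by (simp add: J_def)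
    have "interval_model X d \<mu> H \<kappa> a b n L (l \<circ> e) (\<lambda>x. Q.\<theta> (mQ \<alpha> \<beta> (q x)))"
    proof unfold_locales
      show "1 \<le> \<kappa>" "a \<in> X" "b \<in> X" using \<kappa> ab by auto
      show "A \<subseteq> {..<n}" if "A \<in> L" for A using that Q.\<theta>_subset by (auto simp: L_def)
      show "{..<j} \<in> L" if j: "j \<le> n" for j
      proof -
        have "v j \<in> J" using Q.v_dist[of 0 j] Q.v_dist[of j n] v j
          by (auto simp: J_def metric_interval_def)
        then show ?thesis using Q.\<theta>_v[OF j] by (auto simp: L_def)
      qed
      show "A \<inter> B \<in> L" if "A \<in> L" "B \<in> L" for A B
        using L_maj[OF that V(1)] \<theta>\<alpha> by (simp add: majority_def)
      show "A \<union> B \<in> L" if AB: "A \<in> L" "B \<in> L" for A B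
      proof -
        have "A \<subseteq> {..<n}" "B \<subseteq> {..<n}" using AB Q.\<theta>_subset by (auto simp: L_def)
        then have "majority A B {..<n} = A \<union> B" by (auto simp: majority_def)
        then show ?thesis using L_maj[OF AB V(2)] \<theta>\<beta> by simp
      qed
      show "(l \<circ> e) A \<in> X" if "A \<in> L" for A using l JV eJ that by simp
      show "Q.\<theta> (mQ \<alpha> \<beta> (q x)) \<in> L" if "x \<in> X" for x
        using mJ[OF \<alpha>J \<beta>J] q that by (auto simp: L_def)
      show "real (card (sym_diff A B)) \<le> \<kappa> * d ((l \<circ> e) A) ((l \<circ> e) B) + \<kappa>"
        if AB: "A \<in> L" "B \<in> L" for A B
      proof -
        have "1 / \<kappa>0 * D (e A) (e B) - \<kappa>0 \<le> d (l (e A)) (l (e B))"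
          using qi[unfolded qi_embedding_def, folded V_def D_def, THEN conjunct2, THEN bspec, THEN bspec]
            JV[OF eJ(1)] AB by blast
        then have "D (e A) (e B) \<le> \<kappa>0 * d (l (e A)) (l (e B)) + \<kappa>0 * \<kappa>0"
          using \<kappa>0 by (simp add: field_simps)
        also have "\<dots> \<le> \<kappa> * d (l (e A)) (l (e B)) + \<kappa>"
          using \<kappa> by (intro add_mono mult_right_mono) auto
        finally show ?thesis using D_card[OF AB] by simp
      qed
      show "d ((l \<circ> e) A) ((l \<circ> e) B) \<le> \<kappa> * real (card (sym_diff A B)) + \<kappa>"
        if AB: "A \<in> L" "B \<in> L" for A B
      proof -
        have "d (l (e A)) (l (e B)) \<le> \<kappa>0 * D (e A) (e B) + \<kappa>0"
          using qi[unfolded qi_embedding_def, folded V_def D_def, THEN conjunct2, THEN bspec, THEN bspec]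
            JV[OF eJ(1)] AB by blast
        also have "\<dots> \<le> \<kappa> * D (e A) (e B) + \<kappa>"
          using \<kappa> by (intro add_mono mult_right_mono) auto
        finally show ?thesis using D_card[OF AB] by simp
      qed
      show "d ((l \<circ> e) (majority A B C)) (\<mu> ((l \<circ> e) A) ((l \<circ> e) B) ((l \<circ> e) C)) \<le> \<kappa>"
        if ABC: "A \<in> L" "B \<in> L" "C \<in> L" for A B C
      proof -
        have "e (majority A B C) = mQ (e A) (e B) (e C)"
          using L_maj[OF ABC(1,2), of "e C"] eJ[OF ABC(3)] JV by simp
        moreover have "e A \<in> V" "e B \<in> V" "e C \<in> V" using eJ JV ABC by auto
        ultimately show ?thesis using hom'[of "e A" "e B" "e C"] \<kappa>(2) by simp
      qed
      show "d ((l \<circ> e) {}) a \<le> \<kappa>" using e\<theta>[OF \<alpha>J] \<theta>\<alpha> \<alpha>\<beta> \<kappa> by simp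
      show "d ((l \<circ> e) {..<n}) b \<le> \<kappa>" using e\<theta>[OF \<beta>J] \<theta>\<beta> \<alpha>\<beta> \<kappa> by simp
      show "d ((l \<circ> e) (Q.\<theta> (mQ \<alpha> \<beta> (q x)))) (\<mu> a b x) \<le> \<kappa>" if x: "x \<in> X" for x
      proof -
        let ?w = "mQ \<alpha> \<beta> (q x)"
        have w: "?w \<in> J" using mJ[OF \<alpha>J \<beta>J] q x by auto
        have lX: "l ?w \<in> X" "l \<alpha> \<in> X" "l \<beta> \<in> X" "l (q x) \<in> X" using l JV w V q x by auto
        have 1: "d (l ?w) (\<mu> (l \<alpha>) (l \<beta>) (l (q x))) \<le> \<kappa>0"
          using hom'[OF V q(1)[OF x]] .
        have "d (\<mu> (l \<alpha>) (l \<beta>) (l (q x))) (\<mu> a b (\<mu> a b x))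
            \<le> H * (d (l \<alpha>) a + d (l \<beta>) b + d (l (q x)) (\<mu> a b x)) + H"
          using \<mu>_lip lX ab x by simp
        also have "\<dots> \<le> H * (3 * \<kappa>0) + H"
          using \<alpha>\<beta> q(2)[OF x] H by (intro add_right_mono mult_left_mono) (auto simp: commute)
        finally have 2: "d (\<mu> (l \<alpha>) (l \<beta>) (l (q x))) (\<mu> a b (\<mu> a b x)) \<le> H * (3 * \<kappa>0) + H" .
        have 3: "d (\<mu> a b (\<mu> a b x)) (\<mu> a b x) \<le> H" using \<mu>_proj ab x by simp
        have "d (l ?w) (\<mu> a b x) \<le> d (l ?w) (\<mu> (l \<alpha>) (l \<beta>) (l (q x)))
            + d (\<mu> (l \<alpha>) (l \<beta>) (l (q x))) (\<mu> a b (\<mu> a b x)) + d (\<mu> a b (\<mu> a b x)) (\<mu> a b x)"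
          using triangle[of "l ?w" "\<mu> (l \<alpha>) (l \<beta>) (l (q x))" "\<mu> a b x"]
            triangle[of "\<mu> (l \<alpha>) (l \<beta>) (l (q x))" "\<mu> a b (\<mu> a b x)" "\<mu> a b x"] lX ab x by simp
        then show ?thesis unfolding \<kappa>_def o_apply e\<theta>[OF w] using 1 2 3 pos(1) by linarith
      qed
    qed
    then show ?thesis by blast
  qed
  then show thesis by (rule that)
qed

section \<open>Chains and crossing sets of coordinates\<close>

text \<open>Applied to \<open>(i, j)\<close> and \<open>(j, i)\<close> this fills two of the four
  quadrants of a pair of halfspaces; the sets \<open>{}\<close> and \<open>{..<n}\<close>, members
  of every model, fill the other two. Equivalently, \<open>T\<close> is an antichain for implication
  between coordinates.\<close>

definition crossing :: "nat set set \<Rightarrow> nat set \<Rightarrow> bool" where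
  "crossing L T \<longleftrightarrow> (\<forall>i\<in>T. \<forall>j\<in>T. i \<noteq> j \<longrightarrow> (\<exists>A\<in>L. i \<in> A \<and> j \<notin> A))"

text \<open>In a minimal subfamily with the same union every member has a private element, and private elements
  cross.\<close>

lemma Union_few:
  assumes "finite U" "L \<subseteq> Pow U" and S: "S \<subseteq> L" "S \<noteq> {}"
    and N: "N \<ge> 1" "\<And>T. T \<subseteq> U \<Longrightarrow> crossing L T \<Longrightarrow> card T \<le> N"
  obtains F where "finite F" "F \<noteq> {}" "F \<subseteq> S" "card F \<le> N" "\<Union>F = \<Union>S"
proof -
  have "finite S" using assms finite_subset[of S "Pow U"] by auto
  let ?P = "\<lambda>F. F \<noteq> {} \<and> F \<subseteq> S \<and> \<Union>F = \<Union>S"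
  define F where "F = arg_min card ?P"
  have F: "?P F" unfolding F_def by (rule arg_min_natI[of ?P S]) (use S in auto)
  have min: "card F \<le> card G" if "?P G" for G unfolding F_def by (rule arg_min_nat_le[of ?P, OF that])
  have fin: "finite F" using F \<open>finite S\<close> finite_subset by blast
  have "card F \<le> N"
  proof (cases "card F \<le> 1")
    case False
    have "\<exists>i\<in>A. \<forall>B\<in>F - {A}. i \<notin> B" if A: "A \<in> F" for A
    proof (rule ccontr)
      assume "\<not> ?thesis"
      then have "\<Union>(F - {A}) = \<Union>F" using A by blast
      moreover have "F - {A} \<noteq> {}"
      proof
        assume "F - {A} = {}"
        then have "card F \<le> card {A}" by (intro card_mono) auto
        then show False using False by simp
      qed
      ultimately have "card F \<le> card (F - {A})" using F by (intro min) auto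
      then show False using card_Diff1_less[OF fin A] by simp
    qed
    then obtain g where g: "\<And>A. A \<in> F \<Longrightarrow> g A \<in> A" "\<And>A B. A \<in> F \<Longrightarrow> B \<in> F \<Longrightarrow> A \<noteq> B \<Longrightarrow> g A \<notin> B"
      by (metis DiffI singletonD)
    have "inj_on g F" using g by (intro inj_onI) metis
    then have "card F = card (g ` F)" by (simp add: card_image)
    also have "\<dots> \<le> N"
    proof (rule N(2))
      show "g ` F \<subseteq> U" using g(1) F S(1) assms(2) by fast
      show "crossing L (g ` F)" unfolding crossing_def
        using g F S(1) by (smt (verit, ccfv_threshold) imageE subsetD)
    qed
    finally show ?thesis .
  qed (use N in simp)
  then show thesis using that fin F by blast
qed

text \<open>Complements in \<open>U\<close> turn intersections into unions, and a set crossing for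
  the complements is crossing for \<open>L\<close> with the roles of \<open>i\<close> and
  \<open>j\<close> exchanged.\<close>

lemma Inter_few:
  assumes U: "finite U" "L \<subseteq> Pow U" and S: "S \<subseteq> L" "S \<noteq> {}"
    and N: "N \<ge> 1" "\<And>T. T \<subseteq> U \<Longrightarrow> crossing L T \<Longrightarrow> card T \<le> N"
  obtains F where "finite F" "F \<noteq> {}" "F \<subseteq> S" "card F \<le> N" "\<Inter>F = \<Inter>S"
proof -
  let ?c = "\<lambda>A. U - A"
  have cr: "crossing L T" if cT: "crossing (?c ` L) T" "T \<subseteq> U" for T
    unfolding crossing_def
  proof (intro ballI impI)
    fix i j assume ij: "i \<in> T" "j \<in> T" "i \<noteq> j"
    then have "\<exists>B\<in>?c ` L. j \<in> B \<and> i \<notin> B"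
      using cT(1)[unfolded crossing_def, THEN bspec, THEN bspec, of j i] by blast
    then show "\<exists>A\<in>L. i \<in> A \<and> j \<notin> A" using ij cT(2) by auto
  qed
  obtain F where F: "finite F" "F \<noteq> {}" "F \<subseteq> ?c ` S" "card F \<le> N" "\<Union>F = \<Union>(?c ` S)"
    by (rule Union_few[of U "?c ` L" "?c ` S" N]) (use assms cr in auto)
  have cc: "U - (U - A) = A" if "A \<in> S" for A using that S U by blast
  have i1: "\<Inter>(?c ` F) = U - \<Union>F" using F(2) by blast
  have i2: "\<Inter>S = U - \<Union>(?c ` S)" using S U by blast
  have "\<Inter>(?c ` F) = \<Inter>S" by (simp only: i1 i2 F(5))
  moreover have "?c ` F \<subseteq> S" using F(3) cc by fastforce
  moreover have "card (?c ` F) \<le> N" using card_image_le[OF F(1), of ?c] F(4) by simp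
  ultimately show thesis using that[of "?c ` F"] F(1,2) by blast
qed

text \<open>Mirsky's argument: the minimal elements form an antichain; remove them and continue.\<close>

lemma chain_exists:
  fixes R :: "nat \<Rightarrow> nat \<Rightarrow> bool"
  assumes R: "\<And>i. R i i" "\<And>i j k. R i j \<Longrightarrow> R j k \<Longrightarrow> R i k"
    and S: "finite S" and le: "\<And>i j. i \<in> S \<Longrightarrow> j \<in> S \<Longrightarrow> R i j \<Longrightarrow> i \<le> j"
    and N: "\<And>T. T \<subseteq> S \<Longrightarrow> (\<forall>i\<in>T. \<forall>j\<in>T. i \<noteq> j \<longrightarrow> \<not> R j i) \<Longrightarrow> card T \<le> N"
  shows "\<exists>T\<subseteq>S. (\<forall>i\<in>T. \<forall>j\<in>T. R i j \<or> R j i) \<and> card S \<le> N * card T"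
  using S le N
proof (induction S rule: finite_psubset_induct)
  case (psubset S)
  show ?case
  proof (cases "S = {}")
    case False
    define M where "M = {i \<in> S. \<forall>j\<in>S. R j i \<longrightarrow> j = i}"
    have below: "\<exists>j\<in>M. R j t" if t: "t \<in> S" for t
    proof -
      define j where "j = (LEAST j. j \<in> S \<and> R j t)"
      have j: "j \<in> S" "R j t" using LeastI[of "\<lambda>j. j \<in> S \<and> R j t" t] t R(1) by (auto simp: j_def)
      have "j' = j" if "j' \<in> S" "R j' j" for j'
      proof -
        have "j \<le> j'" unfolding j_def by (rule Least_le) (use that j R(2) in blast)
        moreover have "j' \<le> j" using psubset.prems(1)[of j' j] that j by blast
        ultimately show ?thesis by simp
      qed
      then show ?thesis using j by (auto simp: M_def)
    qed
    have MS: "M \<subseteq> S" by (auto simp: M_def)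
    have M: "card M \<le> N" by (rule psubset.prems(2)) (auto simp: M_def)
    have ne: "M \<noteq> {}" using False below by blast
    have IH: "\<exists>T\<subseteq>S - M. (\<forall>i\<in>T. \<forall>j\<in>T. R i j \<or> R j i) \<and> card (S - M) \<le> N * card T"
    proof (rule psubset.IH)
      show "S - M \<subset> S" using ne MS by blast
      show "i \<le> j" if "i \<in> S - M" "j \<in> S - M" "R i j" for i j using psubset.prems(1)[of i j] that by blast
      show "card T \<le> N" if "T \<subseteq> S - M" "\<forall>i\<in>T. \<forall>j\<in>T. i \<noteq> j \<longrightarrow> \<not> R j i" for T
        using psubset.prems(2)[of T] that by blast
    qed
    then obtain T where T: "T \<subseteq> S - M" "\<forall>i\<in>T. \<forall>j\<in>T. R i j \<or> R j i" "card (S - M) \<le> N * card T"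
      by blast
    have finT: "finite T" "finite M" using T(1) MS psubset.hyps finite_subset by blast+
    have cS: "card S = card M + card (S - M)"
      using card_Diff_subset[OF finT(2) MS] card_mono[OF psubset.hyps(1) MS] by simp
    \<comment> \<open>In the chain \<open>T\<close> the element of least index is also least for
      \<open>R\<close>, because \<open>R\<close> respects the indices; a minimal element below it
      extends the whole chain.\<close>
    have "\<exists>j\<in>M. \<forall>t\<in>T. R j t"
    proof (cases "T = {}")
      case False
      define t where "t = Min T"
      have t: "t \<in> T" using False finT by (simp add: t_def)
      obtain j where j: "j \<in> M" "R j t" using below[of t] t T(1) by blast
      have "R j t'" if t': "t' \<in> T" for t'
      proof (cases "R t t'")
        case False
        then have "R t' t" using T(2) t t' by blast
        then have "t' \<le> t" using psubset.prems(1)[of t' t] t t' T(1) by blast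
        moreover have "t \<le> t'" using finT t' by (simp add: t_def)
        ultimately show ?thesis using j by simp
      qed (use j R(2) in blast)
      then show ?thesis using j by blast
    qed (use ne in blast)
    then obtain j where j: "j \<in> M" "\<forall>t\<in>T. R j t" by blast
    have "j \<notin> T" using j T(1) by blast
    then have "card S \<le> N * card (insert j T)" using finT cS M T(3) by simp
    moreover have "insert j T \<subseteq> S" using j MS T(1) by blast
    moreover have "\<forall>i\<in>insert j T. \<forall>k\<in>insert j T. R i k \<or> R k i" using T(2) j R(1) by blast
    ultimately show ?thesis by blast
  qed simp
qed

lemma card_majority_nested:
  assumes "finite A" "finite B" "finite C"
    and "A \<subseteq> B \<or> B \<subseteq> A" "B \<subseteq> C \<or> C \<subseteq> B" "A \<subseteq> C \<or> C \<subseteq> A"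
  shows "real (card (majority A B C)) = real_median (card A) (card B) (card C)"
proof -
  consider "A \<subseteq> B" "B \<subseteq> C"
    | "C \<subseteq> B" "B \<subseteq> A"
    | "B \<subseteq> A" "A \<subseteq> C"
    | "C \<subseteq> A" "A \<subseteq> B"
    | "A \<subseteq> C" "C \<subseteq> B"
    | "B \<subseteq> C" "C \<subseteq> A"
    using assms(4-6) by argo
  then show ?thesis
  proof cases
    case 1
    then have "majority A B C = B" by (auto simp: majority_def)
    moreover have "card A \<le> card B" "card B \<le> card C" using 1 assms by (auto intro: card_mono)
    ultimately show ?thesis by (simp add: real_median_def)
  next
    case 2
    then have "majority A B C = B" by (auto simp: majority_def)
    moreover have "card C \<le> card B" "card B \<le> card A" using 2 assms by (auto intro: card_mono)
    ultimately show ?thesis by (simp add: real_median_def)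
  next
    case 3
    then have "majority A B C = A" by (auto simp: majority_def)
    moreover have "card B \<le> card A" "card A \<le> card C" using 3 assms by (auto intro: card_mono)
    ultimately show ?thesis by (simp add: real_median_def)
  next
    case 4
    then have "majority A B C = A" by (auto simp: majority_def)
    moreover have "card C \<le> card A" "card A \<le> card B" using 4 assms by (auto intro: card_mono)
    ultimately show ?thesis by (simp add: real_median_def)
  next
    case 5
    then have "majority A B C = C" by (auto simp: majority_def)
    moreover have "card A \<le> card C" "card C \<le> card B" using 5 assms by (auto intro: card_mono)
    ultimately show ?thesis by (simp add: real_median_def)
  next
    case 6
    then have "majority A B C = C" by (auto simp: majority_def)
    moreover have "card B \<le> card C" "card C \<le> card A" using 6 assms by (auto intro: card_mono)
    ultimately show ?thesis by (simp add: real_median_def)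
  qed
qed

lemma abs_card_diff_le:
  assumes "finite A" "finite B"
  shows "\<bar>real (card (A \<inter> T)) - real (card (B \<inter> T))\<bar> \<le> real (card (sym_diff A B))"
proof -
  have "card (P \<inter> T) \<le> card (Q \<inter> T) + card (sym_diff P Q)" if "finite P" "finite Q" for P Q :: "'a set"
    using card_mono[of "(Q \<inter> T) \<union> sym_diff P Q" "P \<inter> T"] card_Un_le[of "Q \<inter> T" "sym_diff P Q"] that by fastforce
  from this[OF assms] this[OF assms(2,1)] show ?thesis by (simp add: Un_commute)
qed

context interval_model
begin

lemma finite_L: "A \<in> L \<Longrightarrow> finite A"
  using L_sub finite_subset by blast

lemma empty_L [simp]: "{} \<in> L" and full_L [simp]: "{..<n} \<in> L"
  using L_init[of 0] L_init[of n] by auto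

lemma majority_L [simp]: "A \<in> L \<Longrightarrow> B \<in> L \<Longrightarrow> C \<in> L \<Longrightarrow> majority A B C \<in> L"
  by (simp add: majority_def L_Int L_Un)

lemma L_UN: "finite J \<Longrightarrow> (\<And>j. j \<in> J \<Longrightarrow> B j \<in> L) \<Longrightarrow> (\<Union>j\<in>J. B j) \<in> L"
  by (induction J rule: finite_induct) (auto intro: L_Un)

lemma L_INT: "finite J \<Longrightarrow> (\<And>j. j \<in> J \<Longrightarrow> B j \<in> L) \<Longrightarrow> {..<n} \<inter> (\<Inter>j\<in>J. B j) \<in> L"
proof (induction J rule: finite_induct)
  case (insert j J)
  have "{..<n} \<inter> (\<Inter>j\<in>insert j J. B j) = B j \<inter> ({..<n} \<inter> (\<Inter>j\<in>J. B j))" by auto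
  then show ?case using insert by (simp add: L_Int)
qed simp

text \<open>The \<open>k\<close> directions of the cube correspond to disjoint blocks of \<open>s\<close> elements of \<open>T\<close>.\<close>

lemma crossing_cube:
  assumes T: "T \<subseteq> {..<n}" "crossing L T" "k * s \<le> card T"
  obtains g where "\<And>B. B \<subseteq> {..<k} \<Longrightarrow> g B \<in> L"
    "\<And>A B C. \<lbrakk>A \<subseteq> {..<k}; B \<subseteq> {..<k}; C \<subseteq> {..<k}\<rbrakk> \<Longrightarrow> g (majority A B C) = majority (g A) (g B) (g C)"
    "\<And>i. i < k \<Longrightarrow> s \<le> card (sym_diff (g {i}) (g {}))"
proof -
  have finT: "finite T" using T(1) finite_subset by blast
  obtain A where A: "\<And>i j. \<lbrakk>i \<in> T; j \<in> T; i \<noteq> j\<rbrakk> \<Longrightarrow> A i j \<in> L \<and> i \<in> A i j \<and> j \<notin> A i j"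
    using T(2) unfolding crossing_def by metis
  \<comment> \<open>Intersecting the separating members over all other \<open>j\<close> leaves
    \<open>i\<close> as the only element of \<open>T\<close>; the factor \<open>{..<n}\<close>
    covers the empty intersection.\<close>
  define c where "c i = {..<n} \<inter> (\<Inter>j\<in>T - {i}. A i j)" for i
  have c: "c i \<in> L" "c i \<inter> T = {i}" if "i \<in> T" for i
  proof -
    show "c i \<in> L" unfolding c_def by (rule L_INT) (use finT A that in auto)
    show "c i \<inter> T = {i}" using A that T(1) by (auto simp: c_def)
  qed
  obtain \<gamma> where \<gamma>: "bij_betw \<gamma> {0..<card T} T" using ex_bij_betw_nat_finite[OF finT] by blast
  define T' where "T' l = \<gamma> ` {l * s..<Suc l * s}" for l
  have sub: "{l * s..<Suc l * s} \<subseteq> {0..<card T}" if "l < k" for l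
  proof -
    have "Suc l * s \<le> k * s" using that by (intro mult_right_mono) auto
    then show ?thesis using T(3) by auto
  qed
  have T': "T' l \<subseteq> T" "card (T' l) = s" if "l < k" for l
  proof -
    show "T' l \<subseteq> T" using \<gamma> sub[OF that] unfolding T'_def bij_betw_def by blast
    have "inj_on \<gamma> {l * s..<Suc l * s}" using \<gamma> sub[OF that] unfolding bij_betw_def by (meson inj_on_subset)
    then show "card (T' l) = s" by (simp add: T'_def card_image)
  qed
  have T'_disj: "T' l \<inter> T' l' = {}" if "l < k" "l' < k" "l \<noteq> l'" for l l'
  proof -
    have "{l * s..<Suc l * s} \<inter> {l' * s..<Suc l' * s} = {}"
    proof (cases "l < l'")
      case True
      then have "Suc l * s \<le> l' * s" by (intro mult_right_mono) auto
      then show ?thesis by auto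
    next
      case False
      then have "Suc l' * s \<le> l * s" using that by (intro mult_right_mono) auto
      then show ?thesis by auto
    qed
    moreover have "inj_on \<gamma> {0..<card T}" using \<gamma> by (simp add: bij_betw_def)
    ultimately show ?thesis
      unfolding T'_def using inj_on_image_Int[OF _ sub[OF that(1)] sub[OF that(2)]] by force
  qed
  define e where "e l = (\<Union>i\<in>T' l. c i)" for l
  have e: "e l \<in> L" "e l \<inter> T = T' l" if "l < k" for l
  proof -
    have "finite (T' l)" by (simp add: T'_def)
    then show "e l \<in> L" unfolding e_def using c T' that by (intro L_UN) auto
    have "e l \<inter> T = (\<Union>i\<in>T' l. c i \<inter> T)" by (auto simp: e_def)
    also have "\<dots> = (\<Union>i\<in>T' l. {i})" using c(2) T'(1)[OF that] by (intro SUP_cong) auto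
    finally show "e l \<inter> T = T' l" by simp
  qed
  \<comment> \<open>As for median algebras, adding all overlaps to every member makes the family
    disjoint over \<open>b\<close>. The set \<open>b\<close> misses \<open>T\<close>, so each
    direction still changes the whole block \<open>T' l\<close>.\<close>
  define b where "b = (\<Union>(l, l')\<in>{(l, l'). l < k \<and> l' < k \<and> l \<noteq> l'}. e l \<inter> e l')"
  have "finite {(l, l'). l < k \<and> l' < k \<and> l \<noteq> l'}"
    by (rule finite_subset[of _ "{..<k} \<times> {..<k}"]) auto
  then have b: "b \<in> L" unfolding b_def by (rule L_UN) (use e L_Int in auto)
  have bT: "b \<inter> T = {}"
  proof (rule ccontr)
    assume "b \<inter> T \<noteq> {}"
    then obtain x l l' where x: "x \<in> e l \<inter> T" "x \<in> e l' \<inter> T" and l: "l < k" "l' < k" "l \<noteq> l'"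
      unfolding b_def by auto
    then show False using T'_disj[OF l] x unfolding e(2)[OF l(1)] e(2)[OF l(2)] by auto
  qed
  define g where "g B = b \<union> (\<Union>l\<in>B. e l)" for B
  show thesis
  proof (rule that[of g])
    show "g B \<in> L" if B: "B \<subseteq> {..<k}" for B
    proof -
      have "finite B" using B finite_subset by blast
      then have "(\<Union>l\<in>B. e l) \<in> L" using B e by (intro L_UN) auto
      then show ?thesis using b L_Un by (simp add: g_def)
    qed
    show "g (majority A B C) = majority (g A) (g B) (g C)"
      if "A \<subseteq> {..<k}" "B \<subseteq> {..<k}" "C \<subseteq> {..<k}" for A B C
    proof -
      have "g (A' \<inter> B') = g A' \<inter> g B'" if AB: "A' \<subseteq> {..<k}" "B' \<subseteq> {..<k}" for A' B'
      proof
        show "g A' \<inter> g B' \<subseteq> g (A' \<inter> B')"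
        proof
          fix x assume x: "x \<in> g A' \<inter> g B'"
          show "x \<in> g (A' \<inter> B')"
          proof (cases "x \<in> b")
            case False
            then obtain l l' where l: "l \<in> A'" "l' \<in> B'" "x \<in> e l" "x \<in> e l'" using x by (auto simp: g_def)
            have "l = l'"
            proof (rule ccontr)
              assume "l \<noteq> l'"
              then have "x \<in> b" unfolding b_def using l AB by blast
              then show False using False by simp
            qed
            then show ?thesis using l by (auto simp: g_def)
          qed (simp add: g_def)
        qed
      qed (auto simp: g_def)
      moreover have "g (A' \<union> B') = g A' \<union> g B'" for A' B' by (auto simp: g_def)
      ultimately show ?thesis using that unfolding majority_def by simp
    qed
    show "s \<le> card (sym_diff (g {i}) (g {}))" if i: "i < k" for i
    proof -
      have "T' i \<subseteq> sym_diff (g {i}) (g {})"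
        using e(2)[OF i] T'(1)[OF i] bT by (auto simp: g_def)
      moreover have "finite (sym_diff (g {i}) (g {}))"
        using finite_L[OF b] finite_L[OF e(1)[OF i]] by (simp add: g_def)
      ultimately show ?thesis using T'(2)[OF i] card_mono by metis
    qed
  qed
qed

end

text \<open>A crossing set that is too large would carry a coarse cube all of whose edges at the
  corner \<open>{}\<close> are longer than \<open>coarse_rank_cube\<close> allows.\<close>

lemma (in coarse_median) crossing_bound:
  assumes cm: "coarse_median_with X d \<mu> h (enat \<nu>)"
  obtains N where "N \<ge> (1::nat)" "\<And>a b n L f p T.
    \<lbrakk>interval_model X d \<mu> H \<kappa> a b n L f p; T \<subseteq> {..<n}; crossing L T\<rbrakk> \<Longrightarrow> card T \<le> N"
proof (cases "\<kappa> \<ge> 1")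
  case \<kappa>: True
  obtain E where E: "\<And>F. \<lbrakk>F \<in> Pow {..<Suc \<nu>} \<rightarrow> X;
      \<And>A B C. \<lbrakk>A \<subseteq> {..<Suc \<nu>}; B \<subseteq> {..<Suc \<nu>}; C \<subseteq> {..<Suc \<nu>}\<rbrakk> \<Longrightarrow>
        d (F (majority A B C)) (\<mu> (F A) (F B) (F C)) \<le> \<kappa>\<rbrakk> \<Longrightarrow> \<exists>i<Suc \<nu>. d (F {i}) (F {}) \<le> E"
    by (rule coarse_rank_cube[OF Metric_space_axioms _ cm, of \<kappa>]) (use \<kappa> in auto)
  \<comment> \<open>By \<open>f_lower\<close>, members of \<open>L\<close> that differ in at least
    \<open>s\<close> coordinates are sent to points at distance greater than
    \<open>E\<close>.\<close>
  obtain s :: nat where s: "real s > \<kappa> * E + \<kappa>" using reals_Archimedean2 by blast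
  show thesis
  proof (rule that[of "Suc (Suc \<nu> * s)"])
    fix a b n L f p T assume im: "interval_model X d \<mu> H \<kappa> a b n L f p" and T: "T \<subseteq> {..<n}" "crossing L T"
    interpret interval_model X d \<mu> H \<kappa> a b n L f p by (rule im)
    show "card T \<le> Suc (Suc \<nu> * s)"
    proof (rule ccontr)
      assume "\<not> ?thesis"
      then have sT: "Suc \<nu> * s \<le> card T" by simp
      obtain g where g: "\<And>B. B \<subseteq> {..<Suc \<nu>} \<Longrightarrow> g B \<in> L"
        "\<And>A B C. \<lbrakk>A \<subseteq> {..<Suc \<nu>}; B \<subseteq> {..<Suc \<nu>}; C \<subseteq> {..<Suc \<nu>}\<rbrakk> \<Longrightarrow> g (majority A B C) = majority (g A) (g B) (g C)"
        "\<And>i. i < Suc \<nu> \<Longrightarrow> s \<le> card (sym_diff (g {i}) (g {}))"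
        by (rule crossing_cube[OF T sT]) (rule that)
      have "\<exists>i<Suc \<nu>. d ((f \<circ> g) {i}) ((f \<circ> g) {}) \<le> E"
        by (rule E) (use g f_median in auto)
      then obtain i where i: "i < Suc \<nu>" "d (f (g {i})) (f (g {})) \<le> E" by auto
      have "real s \<le> real (card (sym_diff (g {i}) (g {})))" using g(3)[OF i(1)] by simp
      also have "\<dots> \<le> \<kappa> * d (f (g {i})) (f (g {})) + \<kappa>" using g(1) i(1) by (intro f_lower) auto
      also have "\<dots> \<le> \<kappa> * E + \<kappa>" using i(2) \<kappa> by (intro add_right_mono mult_left_mono) auto
      finally show False using s by simp
    qed
  qed simp
next
  case False
  \<comment> \<open>Models require \<open>\<kappa> \<ge> 1\<close>, so here the claim is
    vacuous.\<close>
  show thesis by (rule that[of 1]) (use False in \<open>auto simp: interval_model_def interval_model_axioms_def\<close>)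
qed

section \<open>Prolonging contractions\<close>

lemma real_median_mono_image:
  assumes "mono g"
  shows "real_median (g x) (g y) (g z) = g (real_median x y z)"
  by (simp add: real_median_def min_of_mono[OF assms] max_of_mono[OF assms])

lemma K_contraction_comp:
  assumes \<Phi>: "K_contraction X \<mu> d K \<Phi>" and g: "mono g" "\<And>x y. \<bar>g x - g y\<bar> \<le> \<bar>x - y\<bar>"
  shows "K_contraction X \<mu> d K (\<lambda>x. g (\<Phi> x))"
  using \<Phi> g(2) unfolding K_contraction_def real_median_mono_image[OF g(1)]
  by (meson order_trans)

context coarse_median
begin

text \<open>The first summand is \<open>\<Psi>\<close> truncated at \<open>\<rho> = r - G\<close>,
  and the second is positive only where the first has reached \<open>\<rho>\<close>. Hence both are
  truncations of the sum at level \<open>\<rho>\<close>, and on either side of this level the sum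
  inherits the error \<open>K\<close> of one summand. Only pairs, and medians, that jump across
  \<open>\<rho>\<close> need an argument; the bounds on \<open>G\<close> are what these cases
  consume.\<close>

lemma contraction_glue:
  assumes K: "K > 0" and C: "C \<ge> 0"
    and rg: "\<And>x y. x \<in> X \<Longrightarrow> y \<in> X \<Longrightarrow>
      \<exists>\<gamma>. qi_embedding {0..d x y} dist X d 1 C \<gamma> \<and> \<gamma> 0 = x \<and> \<gamma> (d x y) = y"
    and \<Phi>: "K_contraction X \<mu> d K \<Phi>" and \<Psi>: "K_contraction X \<mu> d K \<Psi>"
    and nested: "\<And>x. x \<in> X \<Longrightarrow> s \<le> \<Phi> x \<Longrightarrow> r - s' \<le> \<Psi> x"
    and G: "G \<ge> s + K" "G \<ge> s'" "2 * G \<ge> 3 * C + 3 * K + 2 + s + s'" "G \<le> r"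
  shows "K_contraction X \<mu> d K (\<lambda>x. min (max (\<Psi> x) 0) (r - G) + max (\<Phi> x - G) 0)"
proof -
  define \<rho> where "\<rho> = r - G"
  define gu gv :: "real \<Rightarrow> real" where "gu y = min (max y 0) \<rho>" and "gv y = max (y - G) 0" for y
  define u v w where "u x = gu (\<Psi> x)" and "v x = gv (\<Phi> x)" and "w x = u x + v x" for x
  have \<rho>: "\<rho> \<ge> 0" using G by (simp add: \<rho>_def)
  have u: "K_contraction X \<mu> d K u" unfolding u_def
    by (rule K_contraction_comp[OF \<Psi>]) (auto simp: gu_def mono_def)
  have v: "K_contraction X \<mu> d K v" unfolding v_def
    by (rule K_contraction_comp[OF \<Phi>]) (auto simp: gv_def mono_def)
  have u_bounds: "0 \<le> u x" "u x \<le> \<rho>" and v_nonneg: "0 \<le> v x" for x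
    using \<rho> by (auto simp: u_def v_def gu_def gv_def)
  have vu: "u x = \<rho>" if "x \<in> X" "v x > 0" for x
  proof -
    have "\<Phi> x > G" using that(2) by (simp add: v_def gv_def less_max_iff_disj)
    then have "\<Psi> x \<ge> \<rho>" using nested[OF that(1)] G K by (simp add: \<rho>_def)
    then show ?thesis using \<rho> by (simp add: u_def gu_def)
  qed
  have u_w: "u x = min (w x) \<rho>" and v_w: "v x = max (w x - \<rho>) 0" if "x \<in> X" for x
    using u_bounds[of x] v_nonneg[of x] vu[OF that] by (cases "v x > 0"; force simp: w_def)+
  have low: "\<Phi> x < s" if "x \<in> X" "w x < \<rho>" for x
  proof (rule ccontr)
    assume "\<not> \<Phi> x < s"
    then have "\<Psi> x \<ge> \<rho>" using nested[OF that(1)] G by (simp add: \<rho>_def)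
    then have "u x = \<rho>" using \<rho> by (simp add: u_def gu_def)
    then show False using u_w[OF that(1)] that(2) by simp
  qed
  have high: "\<Phi> x > G" if "x \<in> X" "w x > \<rho>" for x
    using v_w[OF that(1)] that by (auto simp: v_def gv_def)
  have \<Phi>_lip: "\<bar>\<Phi> x - \<Phi> y\<bar> \<le> d x y + K" and \<Psi>_lip: "\<bar>\<Psi> x - \<Psi> y\<bar> \<le> d x y + K"
    and u_lip: "\<bar>u x - u y\<bar> \<le> d x y + K" and v_lip: "\<bar>v x - v y\<bar> \<le> d x y + K"
    if "x \<in> X" "y \<in> X" for x y
    using \<Phi> \<Psi> u v that by (auto simp: K_contraction_def)
  \<comment> \<open>A rough geodesic from \<open>x\<close> to \<open>y\<close> crosses the level \<open>s\<close> of \<open>\<Phi>\<close> at a point where \<open>\<Psi>\<close> is already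
    large; the gap of width \<open>2 * G\<close> absorbs all additive errors.\<close>
  have mixed: "w y - w x \<le> d x y" if xy: "x \<in> X" "y \<in> X" and wx: "w x < \<rho>" and wy: "w y > \<rho>" for x y
  proof -
    obtain \<gamma> where \<gamma>: "qi_embedding {0..d x y} dist X d 1 C \<gamma>" "\<gamma> 0 = x" "\<gamma> (d x y) = y"
      using rg[OF xy] by blast
    have \<gamma>X: "\<gamma> t \<in> X" if "t \<in> {0..d x y}" for t
      using \<gamma>(1) that unfolding qi_embedding_def by blast
    have \<gamma>d: "d (\<gamma> t) (\<gamma> t') \<le> \<bar>t - t'\<bar> + C" if "t \<in> {0..d x y}" "t' \<in> {0..d x y}" for t t'
      using \<gamma>(1)[unfolded qi_embedding_def, THEN conjunct2, THEN bspec, THEN bspec, OF that]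
      by (simp add: dist_real_def)
    define S where "S = {t \<in> {0..d x y}. \<Phi> (\<gamma> t) < s}"
    have 0: "0 \<in> S" using low[OF xy(1) wx] \<gamma>(2) by (simp add: S_def)
    have bdd: "bdd_above S" by (auto intro!: bdd_aboveI[of _ "d x y"] simp: S_def)
    \<comment> \<open>\<open>\<Phi>\<close> along the path need not be continuous. The parameters
      \<open>t1\<close> and \<open>t2\<close>, within 1 before and after the supremum, bracket the
      crossing; they account for the 2 in the bound on \<open>2 * G\<close>.\<close>
    define t0 where "t0 = Sup S"
    obtain t1 where t1: "t1 \<in> S" "t0 - 1 < t1"
    proof -
      have "S \<noteq> {}" "t0 - 1 < Sup S" using 0 by (auto simp: t0_def)
      then show thesis using less_cSupD[of S "t0 - 1"] that by blast
    qed
    define t2 where "t2 = min (d x y) (t0 + 1)"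
    have t0: "t1 \<le> t0" "0 \<le> t0" "t0 \<le> d x y"
    proof -
      show "t1 \<le> t0" "0 \<le> t0" unfolding t0_def by (rule cSup_upper[OF t1(1) bdd] cSup_upper[OF 0 bdd])+
      have "S \<noteq> {}" using 0 by auto
      then show "t0 \<le> d x y" unfolding t0_def by (rule cSup_least) (simp add: S_def)
    qed
    have t2I: "t2 \<in> {0..d x y}" using t0 by (auto simp: t2_def)
    have "t2 \<notin> S"
    proof
      assume "t2 \<in> S"
      then have "t2 \<le> t0" unfolding t0_def by (rule cSup_upper[OF _ bdd])
      then have "t2 = d x y" by (auto simp: t2_def min_def split: if_splits)
      then show False using \<open>t2 \<in> S\<close> \<gamma>(3) high[OF xy(2) wy] G K by (simp add: S_def)
    qed
    then have z1: "s \<le> \<Phi> (\<gamma> t2)" using t2I by (simp add: S_def)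
    have t12: "\<bar>t2 - t1\<bar> \<le> 2" using t1 t0 by (auto simp: t2_def)
    have t1I: "t1 \<in> {0..d x y}" and t1s: "\<Phi> (\<gamma> t1) < s" using t1 by (auto simp: S_def)
    have z2: "\<Phi> (\<gamma> t2) \<le> s + 2 + C + K"
      using \<Phi>_lip[OF \<gamma>X[OF t2I] \<gamma>X[OF t1I]] \<gamma>d[OF t2I t1I] t12 t1s by linarith
    have dI: "0 \<in> {0..d x y}" "d x y \<in> {0..d x y}" by auto
    have dx: "d x (\<gamma> t2) \<le> t2 + C" using \<gamma>d[OF dI(1) t2I] \<gamma>(2) t2I by auto
    have dy: "d (\<gamma> t2) y \<le> d x y - t2 + C" using \<gamma>d[OF t2I dI(2)] \<gamma>(3) t2I by auto
    have "r - s' - \<Psi> x \<le> d x (\<gamma> t2) + K"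
      using nested[OF \<gamma>X[OF t2I] z1] \<Psi>_lip[OF xy(1) \<gamma>X[OF t2I]] by linarith
    moreover have "\<Phi> y - (s + 2 + C + K) \<le> d (\<gamma> t2) y + K"
      using z2 \<Phi>_lip[OF \<gamma>X[OF t2I] xy(2)] by linarith
    moreover have "w y = \<rho> + (\<Phi> y - G)"
      using vu[OF xy(2)] v_w[OF xy(2)] wy high[OF xy(2) wy] by (simp add: w_def v_def gv_def)
    moreover have "\<Psi> x \<le> w x"
      using u_w[OF xy(1)] wx v_nonneg[of x] by (auto simp: w_def u_def gu_def min_def max_def split: if_splits)
    ultimately show ?thesis using dx dy G(3) by (simp add: \<rho>_def)
  qed
  have "K_contraction X \<mu> d K w"
    unfolding K_contraction_def
  proof (intro conjI ballI)
    fix x y assume xy: "x \<in> X" "y \<in> X"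
    show "\<bar>w x - w y\<bar> \<le> d x y + K"
    proof -
      consider "w x < \<rho>" "w y > \<rho>" | "w y < \<rho>" "w x > \<rho>" | "w x \<le> \<rho>" "w y \<le> \<rho>" | "w x \<ge> \<rho>" "w y \<ge> \<rho>"
        by linarith
      then show ?thesis
      proof cases
        case 1 then show ?thesis using mixed[OF xy] K by simp
      next
        case 2 then show ?thesis using mixed[OF xy(2,1)] K by (simp add: commute)
      next
        case 3 then show ?thesis using u_lip[OF xy] u_w xy by simp
      next
        case 4 then show ?thesis using v_lip[OF xy] v_w xy by simp
      qed
    qed
  next
    fix x y z assume X: "x \<in> X" "y \<in> X" "z \<in> X"
    let ?M = "real_median (w x) (w y) (w z)" and ?q = "\<mu> x y z"
    have q: "?q \<in> X" using X by simp
    have m1: "mono (\<lambda>t. min t \<rho>)" and m2: "mono (\<lambda>t. max (t - \<rho>) 0)"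
      by (auto intro!: monoI)
    have mu: "real_median (u x) (u y) (u z) = min ?M \<rho>"
      using real_median_mono_image[OF m1, of "w x" "w y" "w z"] u_w X by simp
    have mv: "real_median (v x) (v y) (v z) = max (?M - \<rho>) 0"
      using real_median_mono_image[OF m2, of "w x" "w y" "w z"] v_w X by simp
    have U: "\<bar>min (w ?q) \<rho> - min ?M \<rho>\<bar> \<le> K"
      using u X u_w[OF q] mu unfolding K_contraction_def by metis
    have V: "\<bar>max (w ?q - \<rho>) 0 - max (?M - \<rho>) 0\<bar> \<le> K"
      using v X v_w[OF q] mv unfolding K_contraction_def by metis
    have P: "\<bar>\<Phi> ?q - real_median (\<Phi> x) (\<Phi> y) (\<Phi> z)\<bar> \<le> K"
      using \<Phi> X unfolding K_contraction_def by blast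
    \<comment> \<open>A median below \<open>\<rho>\<close> has two arguments below
      \<open>\<rho>\<close>, where \<open>\<Phi>\<close> is less than \<open>s\<close>, so
      \<open>\<Phi>\<close> is less than \<open>s + K\<close> at \<open>?q\<close>. But a value
      above \<open>\<rho>\<close> at \<open>?q\<close> requires \<open>\<Phi>\<close> to exceed
      \<open>G\<close>.\<close>
    have 1: False if "w ?q > \<rho>" "?M < \<rho>"
    proof -
      have "w x < \<rho> \<and> w y < \<rho> \<or> w y < \<rho> \<and> w z < \<rho> \<or> w x < \<rho> \<and> w z < \<rho>"
        using that(2) by (auto simp: real_median_def)
      then have "\<Phi> x < s \<and> \<Phi> y < s \<or> \<Phi> y < s \<and> \<Phi> z < s \<or> \<Phi> x < s \<and> \<Phi> z < s" using low X by blast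
      then have "real_median (\<Phi> x) (\<Phi> y) (\<Phi> z) < s" by (auto simp: real_median_def)
      then show False using P high[OF q that(1)] G(1) by linarith
    qed
    have 2: False if "w ?q < \<rho>" "?M > \<rho>"
    proof -
      have "w x > \<rho> \<and> w y > \<rho> \<or> w y > \<rho> \<and> w z > \<rho> \<or> w x > \<rho> \<and> w z > \<rho>"
        using that(2) by (auto simp: real_median_def less_max_iff_disj)
      then have "\<Phi> x > G \<and> \<Phi> y > G \<or> \<Phi> y > G \<and> \<Phi> z > G \<or> \<Phi> x > G \<and> \<Phi> z > G" using high X by blast
      then have "real_median (\<Phi> x) (\<Phi> y) (\<Phi> z) > G" by (auto simp: real_median_def less_max_iff_disj)
      then show False using P low[OF q that(1)] G(1) by linarith
    qed
    show "\<bar>w ?q - ?M\<bar> \<le> K"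
    proof (cases "w ?q \<le> \<rho>")
      case True
      then consider "?M \<le> \<rho>" | "?M > \<rho>" "w ?q = \<rho>" using 2 by fastforce
      then show ?thesis
      proof cases
        case 1 then show ?thesis using U True by simp
      next
        case 2 then show ?thesis using V by simp
      qed
    next
      case False
      then have "?M \<ge> \<rho>" using 1 by force
      then show ?thesis using V False by simp
    qed
  qed
  moreover have "w = (\<lambda>x. min (max (\<Psi> x) 0) (r - G) + max (\<Phi> x - G) 0)"
    by (simp add: fun_eq_iff w_def u_def v_def gu_def gv_def \<rho>_def)
  ultimately show ?thesis by simp
qed

end

section \<open>The metric \<open>\<sigma>\<close> along an interval\<close>

locale bounded_model = interval_model +
  fixes N :: nat and K :: real
  assumes N: "N \<ge> 1" and crossing_card: "\<lbrakk>T \<subseteq> {..<n}; crossing L T\<rbrakk> \<Longrightarrow> card T \<le> N"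
    and K: "K > 0"
begin

abbreviation "\<sigma> \<equiv> sigma_metric X \<mu> d K"
abbreviation "contr \<equiv> K_contraction X \<mu> d K"

lemmas le_sigma = K_contraction_le_sigma[OF K Metric_space_axioms]
lemmas sigma_le = sigma_leI[OF K Metric_space_axioms]

text \<open>Implication between coordinates is a preorder whose antichains are crossing sets, and it
  respects the indices because initial segments belong to \<open>L\<close>. Along a chain for it the
  traces of members are nested.\<close>

lemma long_chain:
  obtains T where "T \<subseteq> {..<n}" "n \<le> N * card T"
    "\<And>A B. A \<in> L \<Longrightarrow> B \<in> L \<Longrightarrow> A \<inter> T \<subseteq> B \<inter> T \<or> B \<inter> T \<subseteq> A \<inter> T"
proof -
  define R where "R i j \<longleftrightarrow> (\<forall>A\<in>L. j \<in> A \<longrightarrow> i \<in> A)" for i j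
  have "\<exists>T\<subseteq>{..<n}. (\<forall>i\<in>T. \<forall>j\<in>T. R i j \<or> R j i) \<and> card {..<n} \<le> N * card T"
  proof (rule chain_exists)
    show "R i i" for i by (simp add: R_def)
    show "R i k" if "R i j" "R j k" for i j k using that by (simp add: R_def)
    show "i \<le> j" if "j \<in> {..<n}" "R i j" for i j
    proof -
      have "{..<Suc j} \<in> L" using that L_init[of "Suc j"] by simp
      then show ?thesis using that(2) unfolding R_def by fastforce
    qed
    show "card T \<le> N" if "T \<subseteq> {..<n}" "\<forall>i\<in>T. \<forall>j\<in>T. i \<noteq> j \<longrightarrow> \<not> R j i" for T
      using that by (intro crossing_card) (auto simp: crossing_def R_def)
  qed simp
  then obtain T where T: "T \<subseteq> {..<n}" "\<forall>i\<in>T. \<forall>j\<in>T. R i j \<or> R j i" "n \<le> N * card T"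
    by auto
  have "A \<inter> T \<subseteq> B \<inter> T \<or> B \<inter> T \<subseteq> A \<inter> T" if "A \<in> L" "B \<in> L" for A B
  proof (rule ccontr)
    assume "\<not> ?thesis"
    then obtain i j where "i \<in> A" "i \<in> T" "i \<notin> B" "j \<in> B" "j \<in> T" "j \<notin> A" by auto
    then show False using T(2) that unfolding R_def by metis
  qed
  then show thesis using that T by blast
qed

lemma p_lip:
  assumes x: "x \<in> X" "y \<in> X"
  shows "real (card (sym_diff (p x) (p y))) \<le> \<kappa> * H * d x y + (\<kappa> * (2 * \<kappa> + H) + \<kappa>)"
proof -
  have "d (\<mu> a b x) (\<mu> a b y) \<le> H * d x y + H"
    using \<mu>_lip[of a b x a b y] x by simp
  then have "d (f (p x)) (f (p y)) \<le> \<kappa> + (H * d x y + H) + \<kappa>"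
    using triangle[of "f (p x)" "\<mu> a b x" "f (p y)"] triangle'[of "\<mu> a b x" "\<mu> a b y" "f (p y)"]
      f_p[OF x(1)] f_p[OF x(2)] x by simp
  then have "\<kappa> * d (f (p x)) (f (p y)) \<le> \<kappa> * (\<kappa> + (H * d x y + H) + \<kappa>)"
    using \<kappa> by (intro mult_left_mono) auto
  then have "\<kappa> * d (f (p x)) (f (p y)) + \<kappa> \<le> \<kappa> * H * d x y + (\<kappa> * (2 * \<kappa> + H) + \<kappa>)"
    by (simp add: algebra_simps)
  then show ?thesis using f_lower[of "p x" "p y"] x by simp
qed

text \<open>Up to bounded error \<open>f (p x)\<close> is \<open>\<mu> a b x\<close>, and projection
  to an interval respects medians by \<open>five_points\<close>; \<open>f_lower\<close> carries the
  estimate back to \<open>L\<close>.\<close>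

lemma p_median:
  assumes x: "x \<in> X" "y \<in> X" "z \<in> X"
  shows "real (card (sym_diff (p (\<mu> x y z)) (majority (p x) (p y) (p z)))) \<le> \<kappa> * (2 * \<kappa> + 2 * H + H * (3 * \<kappa>)) + \<kappa>"
proof -
  let ?q = "\<mu> x y z" and ?M = "majority (p x) (p y) (p z)"
  let ?\<mu>f = "\<mu> (f (p x)) (f (p y)) (f (p z))" and ?\<mu>g = "\<mu> (\<mu> a b x) (\<mu> a b y) (\<mu> a b z)"
  have "d ?\<mu>f ?\<mu>g \<le> H * (d (f (p x)) (\<mu> a b x) + d (f (p y)) (\<mu> a b y) + d (f (p z)) (\<mu> a b z)) + H"
    using \<mu>_lip x by simp
  also have "\<dots> \<le> H * (3 * \<kappa>) + H"
    using f_p[OF x(1)] f_p[OF x(2)] f_p[OF x(3)] H by (intro add_right_mono mult_left_mono) auto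
  finally have 1: "d ?\<mu>f ?\<mu>g \<le> H * (3 * \<kappa>) + H" .
  have 2: "d (f ?M) ?\<mu>f \<le> \<kappa>" using f_median x by simp
  have 3: "d (\<mu> a b ?q) ?\<mu>g \<le> H" using five_points x by simp
  have 4: "d (f (p ?q)) (\<mu> a b ?q) \<le> \<kappa>" using f_p x by simp
  have "d (f (p ?q)) (f ?M) \<le> d (f (p ?q)) (\<mu> a b ?q) + d (\<mu> a b ?q) ?\<mu>g + d ?\<mu>f ?\<mu>g + d (f ?M) ?\<mu>f"
    using triangle[of "f (p ?q)" "\<mu> a b ?q" "f ?M"] triangle[of "\<mu> a b ?q" ?\<mu>g "f ?M"]
      triangle''[of ?\<mu>g ?\<mu>f "f ?M"] x commute[of ?\<mu>f "f ?M"] by simp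
  then have "d (f (p ?q)) (f ?M) \<le> 2 * \<kappa> + 2 * H + H * (3 * \<kappa>)" using 1 2 3 4 by simp
  then have "\<kappa> * d (f (p ?q)) (f ?M) + \<kappa> \<le> \<kappa> * (2 * \<kappa> + 2 * H + H * (3 * \<kappa>)) + \<kappa>"
    using \<kappa> by (intro add_right_mono mult_left_mono) auto
  then show ?thesis using f_lower[of "p ?q" ?M] x by simp
qed

definition "c1 = \<kappa> * (2 * \<kappa> + H) + \<kappa>"
definition "c2 = \<kappa> * (2 * \<kappa> + 2 * H + H * (3 * \<kappa>)) + \<kappa>"
text \<open>Scaling by this factor brings the slope in \<open>p_lip\<close> down to at most 1 and
  the additive errors of \<open>p_lip\<close> and \<open>p_median\<close> down to at most
  \<open>K\<close>.\<close>

definition "\<epsilon> = min (1 / (\<kappa> * H)) (min (K / c1) (K / c2))"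

lemma c_pos: "c1 > 0" "c2 > 0" "\<kappa> * H > 0"
  using \<kappa> H by (auto simp: c1_def c2_def intro!: add_pos_pos mult_pos_pos add_nonneg_pos)

lemma \<epsilon>: "\<epsilon> > 0" "\<epsilon> * (\<kappa> * H) \<le> 1" "\<epsilon> * c1 \<le> K" "\<epsilon> * c2 \<le> K"
proof -
  show "\<epsilon> > 0" using c_pos K by (simp add: \<epsilon>_def)
  have "\<epsilon> \<le> 1 / (\<kappa> * H)" "\<epsilon> \<le> K / c1" "\<epsilon> \<le> K / c2" by (auto simp: \<epsilon>_def)
  then show "\<epsilon> * (\<kappa> * H) \<le> 1" "\<epsilon> * c1 \<le> K" "\<epsilon> * c2 \<le> K"
    using c_pos by (simp_all only: pos_le_divide_eq)
qed

text \<open>Counting a chain of coordinates is an exact median map to the reals; scaling it by \<open>\<epsilon>\<close> gives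
  a contraction.\<close>

lemma sigma_lower: "\<epsilon> * ((d a b - 3 * \<kappa>) / (\<kappa> * N) - 2 * (\<kappa> * (2 * \<kappa>) + \<kappa>)) \<le> \<sigma> a b"
proof -
  obtain T where T: "T \<subseteq> {..<n}" "n \<le> N * card T"
    "\<And>A B. A \<in> L \<Longrightarrow> B \<in> L \<Longrightarrow> A \<inter> T \<subseteq> B \<inter> T \<or> B \<inter> T \<subseteq> A \<inter> T"
    by (rule long_chain) (rule that)
  define \<psi> where "\<psi> x = real (card (p x \<inter> T))" for x
  have \<psi>_diff: "\<bar>real (card (A \<inter> T)) - real (card (B \<inter> T))\<bar> \<le> real (card (sym_diff A B))"
    if "A \<in> L" "B \<in> L" for A B
    by (rule abs_card_diff_le[OF finite_L finite_L]) (rule that)+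
  have contr: "contr (\<lambda>x. \<epsilon> * \<psi> x)"
    unfolding K_contraction_def
  proof (intro conjI ballI)
    fix x y assume xy: "x \<in> X" "y \<in> X"
    have "\<bar>\<psi> x - \<psi> y\<bar> \<le> \<kappa> * H * d x y + c1"
      using \<psi>_diff[of "p x" "p y"] p_lip[OF xy] xy by (simp add: \<psi>_def c1_def)
    then have "\<epsilon> * \<bar>\<psi> x - \<psi> y\<bar> \<le> \<epsilon> * (\<kappa> * H * d x y + c1)" using \<epsilon>(1) by (intro mult_left_mono) auto
    also have "\<dots> = \<epsilon> * (\<kappa> * H) * d x y + \<epsilon> * c1" by (simp add: algebra_simps)
    also have "\<dots> \<le> 1 * d x y + K" using \<epsilon> by (intro add_mono mult_right_mono) auto
    also have "\<epsilon> * \<bar>\<psi> x - \<psi> y\<bar> = \<bar>\<epsilon> * \<psi> x - \<epsilon> * \<psi> y\<bar>"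
      using \<epsilon>(1) by (simp add: abs_mult flip: right_diff_distrib)
    finally show "\<bar>\<epsilon> * \<psi> x - \<epsilon> * \<psi> y\<bar> \<le> d x y + K" by simp
  next
    fix x y z assume xyz: "x \<in> X" "y \<in> X" "z \<in> X"
    let ?M = "majority (p x) (p y) (p z)"
    have "?M \<inter> T = majority (p x \<inter> T) (p y \<inter> T) (p z \<inter> T)" by (auto simp: majority_def)
    then have "real (card (?M \<inter> T)) = real_median (\<psi> x) (\<psi> y) (\<psi> z)"
      using card_majority_nested[of "p x \<inter> T" "p y \<inter> T" "p z \<inter> T"] T(3) finite_L xyz by (simp add: \<psi>_def)
    then have "\<bar>\<psi> (\<mu> x y z) - real_median (\<psi> x) (\<psi> y) (\<psi> z)\<bar> \<le> c2"
      using \<psi>_diff[of "p (\<mu> x y z)" ?M] p_median[OF xyz] xyz by (simp add: \<psi>_def c2_def)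
    then have "\<epsilon> * \<bar>\<psi> (\<mu> x y z) - real_median (\<psi> x) (\<psi> y) (\<psi> z)\<bar> \<le> \<epsilon> * c2"
      using \<epsilon>(1) by (intro mult_left_mono) auto
    also have "\<dots> \<le> K" by (rule \<epsilon>)
    also have "\<epsilon> * \<bar>\<psi> (\<mu> x y z) - real_median (\<psi> x) (\<psi> y) (\<psi> z)\<bar>
        = \<bar>\<epsilon> * \<psi> (\<mu> x y z) - \<epsilon> * real_median (\<psi> x) (\<psi> y) (\<psi> z)\<bar>"
      using \<epsilon>(1) by (simp add: abs_mult flip: right_diff_distrib)
    also have "\<epsilon> * real_median (\<psi> x) (\<psi> y) (\<psi> z) = real_median (\<epsilon> * \<psi> x) (\<epsilon> * \<psi> y) (\<epsilon> * \<psi> z)"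
      using real_median_mono_image[of "\<lambda>t. \<epsilon> * t"] \<epsilon>(1) by (simp add: mono_def)
    finally show "\<bar>\<epsilon> * \<psi> (\<mu> x y z) - real_median (\<epsilon> * \<psi> x) (\<epsilon> * \<psi> y) (\<epsilon> * \<psi> z)\<bar> \<le> K" .
  qed
  have 1: "\<epsilon> * \<psi> b - \<epsilon> * \<psi> a \<le> \<sigma> a b" using le_sigma[OF a b contr] by simp
  \<comment> \<open>\<open>p a\<close> and \<open>p b\<close> are boundedly close to
    \<open>{}\<close> and \<open>{..<n}\<close>, so \<open>\<psi>\<close> counts almost nothing of
    \<open>T\<close> at \<open>a\<close> and almost all of it at \<open>b\<close>. The size of
    \<open>T\<close> is at least \<open>n / N\<close>, and \<open>f_upper\<close> bounds
    \<open>n\<close> from below in terms of \<open>d a b\<close>.\<close>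
  have 2: "(d a b - 3 * \<kappa>) / (\<kappa> * N) - 2 * (\<kappa> * (2 * \<kappa>) + \<kappa>) \<le> \<psi> b - \<psi> a"
  proof -
    have ends: "real (card (sym_diff A (p x))) \<le> \<kappa> * (2 * \<kappa>) + \<kappa>"
      if "A \<in> L" "d (f A) x \<le> \<kappa>" "x \<in> X" "\<mu> a b x = x" for A x
    proof -
      have "d (f A) (f (p x)) \<le> 2 * \<kappa>"
        using triangle'[of "f A" x "f (p x)"] that f_p[OF that(3)] by simp
      then have "\<kappa> * d (f A) (f (p x)) \<le> \<kappa> * (2 * \<kappa>)" using \<kappa> by (intro mult_left_mono) auto
      then show ?thesis using f_lower[of A "p x"] that by simp
    qed
    have "\<psi> a \<le> \<kappa> * (2 * \<kappa>) + \<kappa>"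
      using ends[of "{}" a] \<psi>_diff[of "{}" "p a"] f_a \<mu>_ends by (simp add: \<psi>_def)
    moreover have "real (card T) - \<psi> b \<le> \<kappa> * (2 * \<kappa>) + \<kappa>"
      using ends[of "{..<n}" b] \<psi>_diff[of "{..<n}" "p b"] f_b \<mu>_ends T(1)
      by (simp add: \<psi>_def Int_absorb1)
    moreover have "(d a b - 3 * \<kappa>) / (\<kappa> * N) \<le> card T"
    proof -
      have "d a b \<le> d a (f {}) + d (f {}) (f {..<n}) + d (f {..<n}) b"
        using triangle[of a "f {}" b] triangle[of "f {}" "f {..<n}" b] by simp
      also have "\<dots> \<le> \<kappa> + (\<kappa> * real n + \<kappa>) + \<kappa>"
        using f_a f_b f_upper[of "{}" "{..<n}"] by (simp add: commute[of a])
      finally have "d a b - 3 * \<kappa> \<le> \<kappa> * real n" by simp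
      also have "\<dots> \<le> \<kappa> * (real N * real (card T))"
        using T(2) \<kappa> by (intro mult_left_mono) (simp_all flip: of_nat_mult)
      finally show ?thesis using \<kappa> N by (simp add: pos_divide_le_eq mult_ac)
    qed
    moreover have "q - 2 * e \<le> \<psi> b - \<psi> a" if "\<psi> a \<le> e" "real (card T) - \<psi> b \<le> e" "q \<le> real (card T)"
      for q e :: real
      using that by linarith
    ultimately show ?thesis by blast
  qed
  have "\<epsilon> * ((d a b - 3 * \<kappa>) / (\<kappa> * N) - 2 * (\<kappa> * (2 * \<kappa>) + \<kappa>)) \<le> \<epsilon> * (\<psi> b - \<psi> a)"
    using 2 \<epsilon>(1) by (intro mult_left_mono) auto
  then show ?thesis using 1 by (simp add: right_diff_distrib)
qed

section \<open>Contractions on the ring of sets, and coarse gates of balls\<close>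

definition "\<eta> = \<kappa> + 2 * K"

text \<open>In \<open>\<eta>\<close>, the summand \<open>\<kappa>\<close> is the error of the model,
  and a contraction adds \<open>K\<close> once as a Lipschitz error and once as a median
  error.\<close>

lemma \<eta>: "\<eta> \<ge> 1" "2 * K \<le> \<eta>" "\<kappa> + K \<le> \<eta>"
  using \<kappa> K by (auto simp: \<eta>_def)

context
  fixes \<Phi> assumes \<Phi>: "contr \<Phi>"
begin

lemma contr_lip: "x \<in> X \<Longrightarrow> y \<in> X \<Longrightarrow> \<bar>\<Phi> x - \<Phi> y\<bar> \<le> d x y + K"
  and contr_median: "x \<in> X \<Longrightarrow> y \<in> X \<Longrightarrow> z \<in> X \<Longrightarrow> \<bar>\<Phi> (\<mu> x y z) - real_median (\<Phi> x) (\<Phi> y) (\<Phi> z)\<bar> \<le> K"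
  using \<Phi> by (simp_all add: K_contraction_def)

lemma contr_near: "A \<in> L \<Longrightarrow> x \<in> X \<Longrightarrow> d (f A) x \<le> \<kappa> \<Longrightarrow> \<bar>\<Phi> (f A) - \<Phi> x\<bar> \<le> \<eta>"
  using contr_lip[of "f A" x] \<eta> by simp

lemma contr_majority:
  assumes "A \<in> L" "B \<in> L" "C \<in> L"
  shows "\<bar>\<Phi> (f (majority A B C)) - real_median (\<Phi> (f A)) (\<Phi> (f B)) (\<Phi> (f C))\<bar> \<le> \<eta>"
  using contr_lip[of "f (majority A B C)" "\<mu> (f A) (f B) (f C)"] contr_median[of "f A" "f B" "f C"]
    f_median[OF assms] assms by (simp add: \<eta>_def)

lemma contr_p:
  assumes "x \<in> X"
  shows "\<bar>\<Phi> (f (p x)) - real_median (\<Phi> a) (\<Phi> b) (\<Phi> x)\<bar> \<le> \<eta>"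
  using contr_lip[of "f (p x)" "\<mu> a b x"] contr_median[of a b x] f_p[OF assms] assms by (simp add: \<eta>_def)

text \<open>An intersection is a majority with \<open>{}\<close>, and a real median is at least
  \<open>s\<close> as soon as two of its arguments are.\<close>

lemma contr_Int_ge:
  assumes AB: "A \<in> L" "B \<in> L" and s: "s \<le> \<Phi> (f A)" "s \<le> \<Phi> (f B)"
  shows "s - \<eta> \<le> \<Phi> (f (A \<inter> B))"
proof -
  have "majority {} A B = A \<inter> B" by (auto simp: majority_def)
  then have "\<bar>\<Phi> (f (A \<inter> B)) - real_median (\<Phi> (f {})) (\<Phi> (f A)) (\<Phi> (f B))\<bar> \<le> \<eta>"
    using contr_majority[of "{}" A B] AB by simp
  moreover have "s \<le> real_median (\<Phi> (f {})) (\<Phi> (f A)) (\<Phi> (f B))"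
    using s by (simp add: real_median_def le_max_iff_disj)
  ultimately show ?thesis by linarith
qed

lemma contr_Inter_ge:
  assumes "finite F" "F \<noteq> {}" "F \<subseteq> L" "\<And>A. A \<in> F \<Longrightarrow> s \<le> \<Phi> (f A)"
  shows "\<Inter>F \<in> L \<and> s - card F * \<eta> \<le> \<Phi> (f (\<Inter>F))"
  using assms
proof (induction F rule: finite_ne_induct)
  case (singleton A)
  have "s \<le> \<Phi> (f A)" using singleton by simp
  then show ?case using singleton \<eta> by simp
next
  case (insert A F)
  have IH: "\<Inter>F \<in> L" "s - card F * \<eta> \<le> \<Phi> (f (\<Inter>F))" using insert by auto
  have A: "A \<in> L" "s - card F * \<eta> \<le> \<Phi> (f A)"
  proof -
    have "0 \<le> card F * \<eta>" using \<eta> by simp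
    then show "s - card F * \<eta> \<le> \<Phi> (f A)" using insert.prems(2)[of A] by simp
  qed (use insert in simp)
  have "s - card F * \<eta> - \<eta> \<le> \<Phi> (f (A \<inter> \<Inter>F))" by (rule contr_Int_ge[OF A(1) IH(1) A(2) IH(2)])
  then show ?case using insert L_Int[OF A(1) IH(1)] by (simp add: algebra_simps)
qed

text \<open>Contractions are coarsely monotone along the interval. As \<open>J\<close> is the
  majority of \<open>{}\<close>, \<open>J\<close> and \<open>{..<n}\<close>, a value near 0 at
  \<open>J\<close> and a large one at \<open>b\<close> force a small one at \<open>{}\<close>. A
  member below \<open>J\<close> is a majority with \<open>{}\<close> and \<open>J\<close>, so its
  value is small too.\<close>

lemma contr_le_below:
  assumes J: "J \<in> L" "\<Phi> (f J) = 0" and b: "\<Phi> b > 2 * \<eta>"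
  shows "\<Phi> a \<le> 2 * \<eta>" and "\<lbrakk>A \<in> L; A \<subseteq> J\<rbrakk> \<Longrightarrow> \<Phi> (f A) \<le> 2 * \<eta>"
proof -
  have a': "\<bar>\<Phi> (f {}) - \<Phi> a\<bar> \<le> \<eta>" and b': "\<bar>\<Phi> (f {..<n}) - \<Phi> b\<bar> \<le> \<eta>"
    using contr_near f_a f_b by auto
  have "majority {} J {..<n} = J" using L_sub[OF J(1)] by (auto simp: majority_def)
  then have "\<bar>0 - real_median (\<Phi> (f {})) 0 (\<Phi> (f {..<n}))\<bar> \<le> \<eta>"
    using contr_majority[of "{}" J "{..<n}"] J by simp
  then have le: "\<Phi> (f {}) \<le> \<eta>"
    using b b' by (auto simp: real_median_def max_def min_def abs_if split: if_splits)
  then show "\<Phi> a \<le> 2 * \<eta>" using a' by linarith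
  show "\<Phi> (f A) \<le> 2 * \<eta>" if A: "A \<in> L" "A \<subseteq> J"
  proof -
    have "majority {} A J = A" using A by (auto simp: majority_def)
    then have "\<bar>\<Phi> (f A) - real_median (\<Phi> (f {})) (\<Phi> (f A)) 0\<bar> \<le> \<eta>"
      using contr_majority[of "{}" A J] J A by simp
    moreover have "real_median (\<Phi> (f {})) (\<Phi> (f A)) 0 \<le> \<eta>"
      using le \<eta> by (auto simp: real_median_def min_le_iff_disj)
    ultimately show ?thesis by linarith
  qed
qed

end

text \<open>A union is a majority with \<open>{..<n}\<close>. For every contraction, two of the
  three values lie within \<open>r\<close> of the value at \<open>a\<close>, hence so does their
  median, whatever the value at \<open>{..<n}\<close>.\<close>

lemma sigma_Un_le:
  assumes AB: "A \<in> L" "B \<in> L" and r: "\<sigma> a (f A) \<le> r" "\<sigma> a (f B) \<le> r"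
  shows "\<sigma> a (f (A \<union> B)) \<le> r + \<eta>"
proof (rule sigma_le)
  show "a \<in> X" "f (A \<union> B) \<in> X" using L_Un AB by auto
  fix \<Phi> assume \<Phi>: "contr \<Phi>"
  have 1: "\<bar>\<Phi> (f A) - \<Phi> a\<bar> \<le> r" "\<bar>\<Phi> (f B) - \<Phi> a\<bar> \<le> r"
    using le_sigma[OF a f \<Phi>] AB r order_trans by blast+
  have "majority A B {..<n} = A \<union> B" using L_sub AB by (auto simp: majority_def)
  then have 2: "\<bar>\<Phi> (f (A \<union> B)) - real_median (\<Phi> (f A)) (\<Phi> (f B)) (\<Phi> (f {..<n}))\<bar> \<le> \<eta>"
    using contr_majority[OF \<Phi>, of A B "{..<n}"] AB by simp
  have "\<bar>real_median (\<Phi> (f A)) (\<Phi> (f B)) (\<Phi> (f {..<n})) - \<Phi> a\<bar> \<le> r"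
    using 1 unfolding real_median_def max_def min_def abs_le_iff by (auto split: if_splits)
  then show "\<bar>\<Phi> (f (A \<union> B)) - \<Phi> a\<bar> \<le> r + \<eta>" using 2 by linarith
qed

lemma sigma_Union_le:
  assumes "finite F" "F \<noteq> {}" "F \<subseteq> L" "\<And>A. A \<in> F \<Longrightarrow> \<sigma> a (f A) \<le> r"
  shows "\<Union>F \<in> L \<and> \<sigma> a (f (\<Union>F)) \<le> r + card F * \<eta>"
  using assms
proof (induction F rule: finite_ne_induct)
  case (singleton A)
  have "\<sigma> a (f A) \<le> r" using singleton by simp
  then show ?case using singleton \<eta> by simp
next
  case (insert A F)
  have IH: "\<Union>F \<in> L" "\<sigma> a (f (\<Union>F)) \<le> r + card F * \<eta>" using insert by auto
  have A: "A \<in> L" "\<sigma> a (f A) \<le> r + card F * \<eta>"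
  proof -
    have "0 \<le> card F * \<eta>" using \<eta> by simp
    then show "\<sigma> a (f A) \<le> r + card F * \<eta>" using insert.prems(2)[of A] by simp
  qed (use insert in simp)
  have "\<sigma> a (f (A \<union> \<Union>F)) \<le> r + card F * \<eta> + \<eta>" by (rule sigma_Un_le[OF A(1) IH(1) A(2) IH(2)])
  then show ?case using insert L_Un[OF A(1) IH(1)] by (simp add: algebra_simps)
qed

text \<open>The coarse gate of \<open>b\<close> in the \<open>\<sigma>\<close>-ball of radius \<open>r\<close> about \<open>a\<close> lies at distance about \<open>r\<close> from \<open>a\<close>
  on a coarse \<open>\<sigma>\<close>-geodesic to \<open>b\<close>: a contraction \<open>\<Phi>\<close> witnessing the distance from the gate to \<open>b\<close> is
  small on the ball, so that its large values are separated from \<open>a\<close> by \<open>\<sigma>\<close>-distance at least \<open>r\<close>,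
  and a contraction witnessing the latter can be prolonged by \<open>\<Phi>\<close>.\<close>

lemma sigma_rough_geodesic_point:
  assumes C: "C \<ge> 0"
    and rg: "\<And>x y. x \<in> X \<Longrightarrow> y \<in> X \<Longrightarrow>
      \<exists>\<gamma>. qi_embedding {0..d x y} dist X d 1 C \<gamma> \<and> \<gamma> 0 = x \<and> \<gamma> (d x y) = y"
    and G: "G \<ge> (N + 10) * \<eta> + 3 * C + 5" and r: "0 \<le> r" "r \<le> \<sigma> a b"
  shows "\<exists>c\<in>X. \<bar>\<sigma> a c - r\<bar> \<le> N * \<eta> + 2 * G \<and> \<sigma> a c + \<sigma> c b \<le> \<sigma> a b + (N * \<eta> + 2 * G)"
proof -
  interpret S: Metric_space X \<sigma> by (rule Metric_space_sigma[OF K Metric_space_axioms])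
  define m where "m = N * \<eta>"
  have m: "0 \<le> m" using \<eta> by (simp add: m_def)
  have G': "G \<ge> m + 10 * \<eta> + 3 * C + 5" using G by (simp add: m_def algebra_simps)
  show ?thesis
  proof (cases "r \<le> G")
    case True
    then show ?thesis unfolding m_def[symmetric] using r m by (intro bexI[of _ a]) auto
  next
    case rG: False
    define S where "S = {A \<in> L. \<sigma> a (f A) \<le> r}"
    have "\<sigma> a (f {}) \<le> \<kappa> + K"
    proof (rule sigma_le)
      fix \<Phi> assume "contr \<Phi>"
      then show "\<bar>\<Phi> (f {}) - \<Phi> a\<bar> \<le> \<kappa> + K" using contr_lip[of \<Phi> "f {}" a] f_a by simp
    qed auto
    then have "{} \<in> S" using \<eta> rG G' C m by (auto simp: S_def)
    have few: "finite {..<n}" "L \<subseteq> Pow {..<n}" using L_sub by auto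
    have SL: "S \<subseteq> L" "S \<noteq> {}" using \<open>{} \<in> S\<close> by (unfold S_def, blast+)
    \<comment> \<open>Every union costs \<open>\<eta>\<close>, so \<open>\<Union>S\<close> has to be
      a union of at most \<open>N\<close> members; then the total loss is at most
      \<open>m\<close>.\<close>
    obtain F where F: "finite F" "F \<noteq> {}" "F \<subseteq> S" "card F \<le> N" "\<Union>F = \<Union>S"
      by (rule Union_few[OF few SL N crossing_card]) (assumption | rule that)+
    define J where "J = \<Union>S"
    have "J \<in> L \<and> \<sigma> a (f J) \<le> r + card F * \<eta>"
      unfolding J_def F(5)[symmetric] by (rule sigma_Union_le) (use F in \<open>auto simp: S_def\<close>)
    moreover have "card F * \<eta> \<le> m" unfolding m_def using F(4) \<eta> by (intro mult_right_mono) auto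
    ultimately have J: "J \<in> L" "\<sigma> a (f J) \<le> r + m" by auto
    have key: "t \<le> \<sigma> a b - r + 2 * G"
      if \<Phi>: "contr \<Phi>" "\<Phi> (f J) = 0" "\<Phi> b = t" for \<Phi> t
    proof (cases "t \<le> 2 * G")
      case False
      have t: "\<Phi> b > 2 * \<eta>" using False \<Phi>(3) G' \<eta> m C by linarith
      note below = contr_le_below[OF \<Phi>(1) J(1) \<Phi>(2) t]
      \<comment> \<open>Intersecting at most \<open>N\<close> members of \<open>T\<close> costs up
        to \<open>m\<close>. What remains at \<open>P\<close> still exceeds
        \<open>2 * \<eta>\<close>, the bound for members below \<open>J\<close>.\<close>
      define s1 where "s1 = m + 2 * \<eta> + 1"
      define T where "T = {B \<in> L. s1 \<le> \<Phi> (f B)}"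
      have "\<bar>\<Phi> (f {..<n}) - \<Phi> b\<bar> \<le> \<eta>" using contr_near[OF \<Phi>(1)] f_b by simp
      then have "{..<n} \<in> T" using False \<Phi>(3) G' \<eta> m C by (simp add: T_def s1_def)
      have TL: "T \<subseteq> L" "T \<noteq> {}" using \<open>{..<n} \<in> T\<close> by (unfold T_def, blast+)
      obtain F' where F': "finite F'" "F' \<noteq> {}" "F' \<subseteq> T" "card F' \<le> N" "\<Inter>F' = \<Inter>T"
        by (rule Inter_few[OF few TL N crossing_card]) (assumption | rule that)+
      define P where "P = \<Inter>T"
      have "P \<in> L \<and> s1 - card F' * \<eta> \<le> \<Phi> (f P)"
        unfolding P_def F'(5)[symmetric] by (rule contr_Inter_ge[OF \<Phi>(1)]) (use F' in \<open>auto simp: T_def\<close>)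
      moreover have "card F' * \<eta> \<le> m" unfolding m_def using F'(4) \<eta> by (intro mult_right_mono) auto
      ultimately have P: "P \<in> L" "2 * \<eta> < \<Phi> (f P)" by (auto simp: s1_def)
      \<comment> \<open>If \<open>P\<close> were in the ball it would belong to \<open>S\<close> and
        be contained in \<open>J\<close>, where \<open>\<Phi>\<close> is small. So some contraction
        separates \<open>a\<close> from \<open>f P\<close> by more than \<open>r\<close>.\<close>
      have "\<not> P \<subseteq> J" using below(2)[OF P(1)] P(2) by auto
      then have "\<not> \<sigma> a (f P) \<le> r" using P(1) by (auto simp: J_def S_def)
      then obtain \<Psi>' where \<Psi>': "contr \<Psi>'" "\<bar>\<Psi>' (f P) - \<Psi>' a\<bar> > r"
        using sigma_le[OF a f[OF P(1)], of \<mu> r] by force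
      obtain \<Psi> where \<Psi>: "contr \<Psi>" "\<Psi> a = 0" "\<Psi> (f P) > r"
      proof (cases "\<Psi>' (f P) \<ge> \<Psi>' a")
        case True
        then show thesis using \<Psi>' by (intro that[of "\<lambda>x. \<Psi>' x - \<Psi>' a"] K_contraction_translate) auto
      next
        case False
        then show thesis using \<Psi>'
          by (intro that[of "\<lambda>x. - \<Psi>' x - - \<Psi>' a"] K_contraction_translate K_contraction_uminus) auto
      qed
      \<comment> \<open>If \<open>\<Phi>\<close> is large at \<open>x\<close>, then
        \<open>p x\<close> belongs to \<open>T\<close> and contains \<open>P\<close>. Coarse
        monotonicity of \<open>\<Psi>\<close> then carries its large value from \<open>P\<close> to
        \<open>p x\<close>, and the gate map carries it on to \<open>x\<close>; each passage costs
        \<open>\<eta>\<close>.\<close>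
      have nested: "r - 2 * \<eta> \<le> \<Psi> x" if x: "x \<in> X" "s1 + \<eta> \<le> \<Phi> x" for x
      proof -
        have "s1 + \<eta> \<le> real_median (\<Phi> a) (\<Phi> b) (\<Phi> x)"
          using x(2) \<Phi>(3) False G' \<eta> m C by (auto simp: real_median_def le_max_iff_disj s1_def)
        then have "s1 \<le> \<Phi> (f (p x))" using contr_p[OF \<Phi>(1) x(1)] by linarith
        then have "P \<subseteq> p x" using x(1) by (auto simp: P_def T_def)
        then have "majority {} P (p x) = P" by (auto simp: majority_def)
        then have 1: "\<bar>\<Psi> (f P) - real_median (\<Psi> (f {})) (\<Psi> (f P)) (\<Psi> (f (p x)))\<bar> \<le> \<eta>"
          using contr_majority[OF \<Psi>(1), of "{}" P "p x"] P x by simp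
        have 2: "\<Psi> (f {}) \<le> \<eta>" using contr_near[OF \<Psi>(1) empty_L a f_a] \<Psi>(2) by linarith
        have "real_median (\<Psi> (f {})) (\<Psi> (f P)) (\<Psi> (f (p x))) \<le> max (\<Psi> (f {})) (\<Psi> (f (p x)))"
          by (auto simp: real_median_def)
        then have 3: "\<Psi> (f (p x)) > r - \<eta>" using 1 2 \<Psi>(3) rG G' \<eta> m C by linarith
        have "real_median (\<Psi> a) (\<Psi> b) (\<Psi> x) \<le> max 0 (\<Psi> x)" using \<Psi>(2) by (auto simp: real_median_def)
        then have "max 0 (\<Psi> x) > r - 2 * \<eta>" using 3 contr_p[OF \<Psi>(1) x(1)] by linarith
        then show ?thesis using rG G' \<eta> m C by (auto simp: max_def split: if_splits)
      qed
      have glued: "contr (\<lambda>x. min (max (\<Psi> x) 0) (r - G) + max (\<Phi> x - G) 0)"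
        by (rule contraction_glue[OF K C rg \<Phi>(1) \<Psi>(1) nested])
          (use rG G' \<eta> m C K in \<open>auto simp: s1_def\<close>)
      \<comment> \<open>The glued contraction is 0 at \<open>a\<close> and
        \<open>(r - G) + (t - G)\<close> at \<open>b\<close>, so \<open>\<sigma> a b\<close> is at
        least \<open>r + t - 2 * G\<close>.\<close>
      have "r - 2 * \<eta> \<le> \<Psi> b" using nested[OF b] \<Phi>(3) False G' \<eta> m C by (simp add: s1_def)
      then have "min (max (\<Psi> b) 0) (r - G) = r - G" using rG G' \<eta> m C by simp
      moreover have "max (\<Phi> b - G) 0 = t - G" using \<Phi>(3) False G' \<eta> m C by simp
      moreover have "max (\<Phi> a - G) 0 = 0" using below(1) G' \<eta> m C by simp
      moreover have "min (max (\<Psi> a) 0) (r - G) = 0" using \<Psi>(2) rG by simp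
      ultimately show ?thesis using le_sigma[OF a b glued] by linarith
    qed (use r in simp)
    have cb: "\<sigma> (f J) b \<le> \<sigma> a b - r + 2 * G"
    proof (rule sigma_le)
      fix \<Phi> assume \<Phi>: "contr \<Phi>"
      have "\<Phi> b - \<Phi> (f J) \<le> \<sigma> a b - r + 2 * G"
        by (rule key[OF K_contraction_translate[OF \<Phi>] _ refl]) simp
      moreover have "- \<Phi> b - - \<Phi> (f J) \<le> \<sigma> a b - r + 2 * G"
        by (rule key[OF K_contraction_translate[OF K_contraction_uminus[OF \<Phi>]] _ refl]) simp
      ultimately show "\<bar>\<Phi> b - \<Phi> (f J)\<bar> \<le> \<sigma> a b - r + 2 * G" by linarith
    qed (use J in auto)
    have "\<sigma> a b \<le> \<sigma> a (f J) + \<sigma> (f J) b" by (rule S.triangle) (use J in auto)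
    then show ?thesis unfolding m_def[symmetric] using J cb m G' \<eta> C by (intro bexI[of _ "f J"]) auto
  qed
qed

end

section \<open>Balls, isometries and the main theorem\<close>

lemma median_isometry_inv:
  assumes g: "median_isometry X \<mu> d g" and closed: "\<And>x y z. \<lbrakk>x \<in> X; y \<in> X; z \<in> X\<rbrakk> \<Longrightarrow> \<mu> x y z \<in> X"
  shows "median_isometry X \<mu> d (inv_into X g)"
proof -
  let ?h = "inv_into X g"
  have bij: "bij_betw g X X" and gd: "\<And>x y. x \<in> X \<Longrightarrow> y \<in> X \<Longrightarrow> d (g x) (g y) = d x y"
    and gm: "\<And>x y z. x \<in> X \<Longrightarrow> y \<in> X \<Longrightarrow> z \<in> X \<Longrightarrow> g (\<mu> x y z) = \<mu> (g x) (g y) (g z)"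
    using g by (auto simp: median_isometry_def)
  have hX: "?h x \<in> X" "g (?h x) = x" if "x \<in> X" for x
    using that bij by (auto simp: bij_betw_def inv_into_into f_inv_into_f)
  have hg: "?h (g x) = x" if "x \<in> X" for x
    using that bij by (simp add: bij_betw_def)
  have "?h (\<mu> x y z) = \<mu> (?h x) (?h y) (?h z)" if "x \<in> X" "y \<in> X" "z \<in> X" for x y z
    using gm[of "?h x" "?h y" "?h z"] hX that hg[of "\<mu> (?h x) (?h y) (?h z)"] closed by simp
  moreover have "d (?h x) (?h y) = d x y" if "x \<in> X" "y \<in> X" for x y
    using gd[of "?h x" "?h y"] hX that by simp
  ultimately show ?thesis using bij_betw_inv_into[OF bij] by (simp add: median_isometry_def)
qed

lemma sigma_median_isometry_le:
  assumes K: "K > 0" and X: "Metric_space X d" and closed: "\<And>x y z. \<lbrakk>x \<in> X; y \<in> X; z \<in> X\<rbrakk> \<Longrightarrow> \<mu> x y z \<in> X"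
    and g: "median_isometry X \<mu> d g" and xy: "x \<in> X" "y \<in> X"
  shows "sigma_metric X \<mu> d K (g x) (g y) \<le> sigma_metric X \<mu> d K x y"
proof -
  have gX: "g x \<in> X" if "x \<in> X" for x using g that by (auto simp: median_isometry_def bij_betw_def)
  show ?thesis
  proof (rule sigma_leI[OF K X gX[OF xy(1)] gX[OF xy(2)]])
    fix \<Phi> assume \<Phi>: "K_contraction X \<mu> d K \<Phi>"
    have gd: "d (g x) (g y) = d x y" and gm: "g (\<mu> x y z) = \<mu> (g x) (g y) (g z)"
      if "x \<in> X" "y \<in> X" "z \<in> X" for x y z
      using g that by (auto simp: median_isometry_def)
    have "K_contraction X \<mu> d K (\<lambda>x. \<Phi> (g x))"
      using \<Phi> gX gd gm unfolding K_contraction_def by (metis (no_types, lifting))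
    from K_contraction_le_sigma[OF K X xy this]
    show "\<bar>\<Phi> (g y) - \<Phi> (g x)\<bar> \<le> sigma_metric X \<mu> d K x y" .
  qed
qed

lemma sigma_median_isometry:
  assumes "K > 0" "Metric_space X d" and closed: "\<And>x y z. \<lbrakk>x \<in> X; y \<in> X; z \<in> X\<rbrakk> \<Longrightarrow> \<mu> x y z \<in> X"
    and g: "median_isometry X \<mu> d g" and xy: "x \<in> X" "y \<in> X"
  shows "sigma_metric X \<mu> d K (g x) (g y) = sigma_metric X \<mu> d K x y"
proof (rule antisym)
  have gX: "bij_betw g X X" using g by (simp add: median_isometry_def)
  then have "g x \<in> X" "g y \<in> X" "inv_into X g (g x) = x" "inv_into X g (g y) = y"
    using xy by (auto simp: bij_betw_def)
  then show "sigma_metric X \<mu> d K x y \<le> sigma_metric X \<mu> d K (g x) (g y)"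
    using sigma_median_isometry_le[where g = "inv_into X g" and x = "g x" and y = "g y", OF assms(1,2) closed]
      median_isometry_inv[OF g closed] by simp
qed (rule sigma_median_isometry_le[OF assms])

lemma sigma_le_dist:
  assumes "K > 0" "Metric_space X d" "x \<in> X" "y \<in> X"
  shows "sigma_metric X \<mu> d K x y \<le> d x y + K"
proof (rule sigma_leI[OF assms])
  fix \<Phi> assume "K_contraction X \<mu> d K \<Phi>"
  then have "\<bar>\<Phi> x - \<Phi> y\<bar> \<le> d x y + K" using assms by (simp add: K_contraction_def)
  then show "\<bar>\<Phi> y - \<Phi> x\<bar> \<le> d x y + K" by (simp add: abs_minus_commute)
qed

text \<open>For each contraction, two of the three values lie in the interval of radius
  \<open>r\<close> about \<open>\<Phi> c\<close>, which therefore contains their median; the third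
  point \<open>x\<close> is arbitrary.\<close>

lemma sigma_median_le:
  assumes K: "K > 0" and X: "Metric_space X d" and closed: "\<And>x y z. \<lbrakk>x \<in> X; y \<in> X; z \<in> X\<rbrakk> \<Longrightarrow> \<mu> x y z \<in> X"
    and c: "c \<in> X" and x: "x \<in> X" "y \<in> X" "z \<in> X"
    and le: "sigma_metric X \<mu> d K c y \<le> r" "sigma_metric X \<mu> d K c z \<le> r"
  shows "sigma_metric X \<mu> d K c (\<mu> x y z) \<le> r + K"
proof (rule sigma_leI[OF K X c closed[OF x]])
  fix \<Phi> assume \<Phi>: "K_contraction X \<mu> d K \<Phi>"
  have "\<bar>\<Phi> y - \<Phi> c\<bar> \<le> r" "\<bar>\<Phi> z - \<Phi> c\<bar> \<le> r"
    using K_contraction_le_sigma[OF K X c x(2) \<Phi>] K_contraction_le_sigma[OF K X c x(3) \<Phi>] le by linarith+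
  then have "\<bar>real_median (\<Phi> x) (\<Phi> y) (\<Phi> z) - \<Phi> c\<bar> \<le> r"
    unfolding real_median_def max_def min_def abs_le_iff by (auto split: if_splits)
  moreover have "\<bar>\<Phi> (\<mu> x y z) - real_median (\<Phi> x) (\<Phi> y) (\<Phi> z)\<bar> \<le> K"
    using \<Phi> x by (simp add: K_contraction_def)
  ultimately show "\<bar>\<Phi> (\<mu> x y z) - \<Phi> c\<bar> \<le> r + K" by linarith
qed

text \<open>Moving from a point just outside a ball towards the centre along a coarse geodesic enters the ball
  after a bounded distance.\<close>

lemma ball_within:
  assumes S: "Metric_space X s" and C: "C \<ge> 0" and e: "e \<ge> 0"
    and geod: "\<And>a b r. \<lbrakk>a \<in> X; b \<in> X; 0 \<le> r; r \<le> s a b\<rbrakk> \<Longrightarrow>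
      \<exists>c\<in>X. \<bar>s a c - r\<bar> \<le> C \<and> s a c + s c b \<le> s a b + C"
    and cq: "c \<in> X" "q \<in> X" "s c q \<le> r + e" and r: "r \<ge> 0"
  shows "\<exists>z\<in>X. (z = c \<or> s c z < r) \<and> s z q \<le> 3 * C + e + 1"
proof (cases "r \<le> C + 1")
  case True
  then show ?thesis using cq C by (intro bexI[of _ c]) auto
next
  case False
  interpret Metric_space X s by (rule S)
  \<comment> \<open>The target lies \<open>C + 1\<close> inside the sphere, so that an error of
    \<open>C\<close> still leaves \<open>z\<close> strictly inside; thus open balls are covered as
    well.\<close>
  define t where "t = min (s c q) (r - C - 1)"
  have "0 \<le> t" "t \<le> s c q" using False by (auto simp: t_def)
  then obtain z where z: "z \<in> X" "\<bar>s c z - t\<bar> \<le> C" "s c z + s z q \<le> s c q + C"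
    using geod[OF cq(1,2)] by blast
  have "t \<le> r - C - 1" "s c q - t \<le> e + C + 1" using cq C e by (auto simp: t_def)
  then have "s c z < r" "s z q \<le> 3 * C + e + 1" using z(2,3) by linarith+
  then show ?thesis using z(1) by blast
qed

theorem theorem2p13:
  fixes X :: "'a set" and \<mu> :: "'a \<Rightarrow> 'a \<Rightarrow> 'a \<Rightarrow> 'a" and d :: "'a \<Rightarrow> 'a \<Rightarrow> real" and K :: real
  assumes "coarse_median_space X \<mu> d"
    and "quasicubical_intervals X \<mu> d"
    and "roughly_geodesic X d"
    and "K > 0"
  shows "quasi_isometry X d X (sigma_metric X \<mu> d K) (\<lambda>x. x) \<and>
    weakly_roughly_geodesic X (sigma_metric X \<mu> d K) \<and>
    (\<exists>M\<ge>0. \<forall>c\<in>X. \<forall>r.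
       coarsely_median_convex X \<mu> d M (Metric_space.mball X (sigma_metric X \<mu> d K) c r) \<and>
       coarsely_median_convex X \<mu> d M (Metric_space.mcball X (sigma_metric X \<mu> d K) c r)) \<and>
    (\<forall>g. median_isometry X \<mu> d g \<longrightarrow>
       (\<forall>x\<in>X. \<forall>y\<in>X. sigma_metric X \<mu> d K (g x) (g y) = sigma_metric X \<mu> d K x y))"
proof -
  note K = assms(4)
  obtain H where H: "coarse_median X d \<mu> H" using coarse_median_of_space[OF assms(1)] .
  interpret coarse_median X d \<mu> H by (rule H)
  let ?\<sigma> = "sigma_metric X \<mu> d K"
  interpret S: Metric_space X ?\<sigma> by (rule Metric_space_sigma[OF K Metric_space_axioms])
  obtain \<kappa> where \<kappa>: "\<And>a b. a \<in> X \<Longrightarrow> b \<in> X \<Longrightarrow> \<exists>n L f p. interval_model X d \<mu> H \<kappa> a b n L f p"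
    using interval_models[OF assms(2)] by blast
  obtain \<nu> h where h: "coarse_median_with X d \<mu> h (enat \<nu>)"
    using assms(2) unfolding quasicubical_intervals_def has_coarse_rank_def coarse_rank_at_most_def
    by (elim exE conjE) (rule that)
  obtain N where N: "N \<ge> (1::nat)" "\<And>a b n L f p T.
    \<lbrakk>interval_model X d \<mu> H \<kappa> a b n L f p; T \<subseteq> {..<n}; crossing L T\<rbrakk> \<Longrightarrow> card T \<le> N"
    by (rule crossing_bound[OF h, where \<kappa> = \<kappa>]) (rule that)
  have model: "\<exists>n L f p. bounded_model X d \<mu> H \<kappa> a b n L f p N K" if ab: "a \<in> X" "b \<in> X" for a b
  proof -
    obtain n L f p where im: "interval_model X d \<mu> H \<kappa> a b n L f p" using \<kappa>[OF ab] by blast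
    have "bounded_model X d \<mu> H \<kappa> a b n L f p N K"
      using im N(1) N(2)[OF im] K by (simp add: bounded_model_def bounded_model_axioms_def)
    then show ?thesis by blast
  qed
  obtain C where C: "C \<ge> 0" and rg: "\<And>x y. x \<in> X \<Longrightarrow> y \<in> X \<Longrightarrow>
      \<exists>\<gamma>. qi_embedding {0..d x y} dist X d 1 C \<gamma> \<and> \<gamma> 0 = x \<and> \<gamma> (d x y) = y"
    using assms(3) unfolding roughly_geodesic_def by blast
  \<comment> \<open>Outside its locale this constant depends on \<open>H\<close>,
    \<open>\<kappa>\<close> and \<open>K\<close> only, which shows that it is common to all
    intervals.\<close>
  define \<epsilon> where "\<epsilon> = bounded_model.\<epsilon> H \<kappa> K"
  \<comment> \<open>\<open>P\<close> and \<open>R\<close> result from solving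
    \<open>sigma_lower\<close> for \<open>d a b\<close>. The maxima secure the signs even for empty
    \<open>X\<close>, where no model provides \<open>\<kappa> \<ge> 1\<close>.\<close>
  define P where "P = max 1 (\<kappa> * N / \<epsilon>)"
  define R where "R = max 0 (\<kappa> * N * (2 * (\<kappa> * (2 * \<kappa>) + \<kappa>)) + 3 * \<kappa>)"
  have PR: "P \<ge> 1" "R \<ge> 0" by (auto simp: P_def R_def)
  have upper: "?\<sigma> a b \<le> d a b + K" if "a \<in> X" "b \<in> X" for a b
    by (rule sigma_le_dist[OF K Metric_space_axioms that])
  have lower: "d a b \<le> P * ?\<sigma> a b + R" if ab: "a \<in> X" "b \<in> X" for a b
  proof -
    obtain n L f p where "bounded_model X d \<mu> H \<kappa> a b n L f p N K" using model[OF ab] by blast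
    then interpret B: bounded_model X d \<mu> H \<kappa> a b n L f p N K .
    have \<epsilon>: "\<epsilon> > 0" and pos: "\<kappa> * N > 0" using B.\<epsilon>(1) B.\<kappa> N(1) by (auto simp: \<epsilon>_def)
    have "(d a b - 3 * \<kappa>) / (\<kappa> * N) - 2 * (\<kappa> * (2 * \<kappa>) + \<kappa>) \<le> ?\<sigma> a b / \<epsilon>"
      using B.sigma_lower \<epsilon> by (simp add: \<epsilon>_def pos_le_divide_eq mult.commute)
    then have "(d a b - 3 * \<kappa>) / (\<kappa> * N) \<le> ?\<sigma> a b / \<epsilon> + 2 * (\<kappa> * (2 * \<kappa>) + \<kappa>)" by simp
    then have "d a b - 3 * \<kappa> \<le> (?\<sigma> a b / \<epsilon> + 2 * (\<kappa> * (2 * \<kappa>) + \<kappa>)) * (\<kappa> * N)"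
      unfolding pos_divide_le_eq[OF pos] .
    then have "d a b \<le> \<kappa> * N / \<epsilon> * ?\<sigma> a b + (\<kappa> * N * (2 * (\<kappa> * (2 * \<kappa>) + \<kappa>)) + 3 * \<kappa>)"
      by (simp add: algebra_simps)
    also have "\<dots> \<le> P * ?\<sigma> a b + R"
      by (intro add_mono mult_right_mono) (auto simp: P_def R_def)
    finally show ?thesis .
  qed
  have qi: "qi_embedding X d X ?\<sigma> P (max K R) (\<lambda>x. x)"
    unfolding qi_embedding_def
  proof (intro conjI ballI)
    fix x y assume xy: "x \<in> X" "y \<in> X"
    have "1 / P * d x y \<le> 1 / P * (P * ?\<sigma> x y + R)"
      using lower[OF xy] PR by (intro mult_left_mono) auto
    also have "\<dots> = ?\<sigma> x y + R / P" using PR by (simp add: field_simps)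
    also have "R / P \<le> R" using PR by (simp add: pos_divide_le_eq mult_left_mono[of 1 P R, simplified])
    finally show "1 / P * d x y - max K R \<le> ?\<sigma> x y" by simp
    have "1 * d x y \<le> P * d x y" using PR by (intro mult_right_mono) auto
    then show "?\<sigma> x y \<le> P * d x y + max K R" using upper[OF xy] by simp
  qed simp
  have "\<exists>x\<in>X. ?\<sigma> y x \<le> max K R" if "y \<in> X" for y
    using that PR by (intro bexI[of _ y]) auto
  then have onto: "coarsely_onto X X ?\<sigma> (max K R) (\<lambda>x. x)" by (simp add: coarsely_onto_def)
  have "max K R \<ge> 0" using PR by simp
  then have "quasi_isometry X d X ?\<sigma> (\<lambda>x. x)"
    unfolding quasi_isometry_def using PR(1) qi onto by blast
  moreover
  define \<eta> where "\<eta> = bounded_model.\<eta> \<kappa> K"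
  define G where "G = (N + 10) * \<eta> + 3 * C + 5"
  define W where "W = max 0 (N * \<eta> + 2 * G)"
  have W: "W \<ge> 0" by (simp add: W_def)
  have geod: "\<exists>c\<in>X. \<bar>?\<sigma> a c - r\<bar> \<le> W \<and> ?\<sigma> a c + ?\<sigma> c b \<le> ?\<sigma> a b + W"
    if ab: "a \<in> X" "b \<in> X" and r: "0 \<le> r" "r \<le> ?\<sigma> a b" for a b r
  proof -
    obtain n L f p where "bounded_model X d \<mu> H \<kappa> a b n L f p N K" using model[OF ab] by blast
    then interpret B: bounded_model X d \<mu> H \<kappa> a b n L f p N K .
    obtain c where "c \<in> X" "\<bar>?\<sigma> a c - r\<bar> \<le> N * \<eta> + 2 * G" "?\<sigma> a c + ?\<sigma> c b \<le> ?\<sigma> a b + (N * \<eta> + 2 * G)"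
      using B.sigma_rough_geodesic_point[OF C rg _ r, of G] by (auto simp: G_def \<eta>_def)
    moreover have "N * \<eta> + 2 * G \<le> W" by (simp add: W_def)
    ultimately show ?thesis by (intro bexI[of _ c]) auto
  qed
  then have "weakly_roughly_geodesic X ?\<sigma>"
    unfolding weakly_roughly_geodesic_def using W by blast
  moreover
  \<comment> \<open>\<open>ball_within\<close> is applied with excess \<open>K\<close>, and the
    resulting \<open>\<sigma>\<close>-distance is converted into a
    \<open>d\<close>-distance.\<close>
  define M where "M = P * (3 * W + K + 1) + R"
  have M: "M \<ge> 0" using PR W K by (simp add: M_def)
  \<comment> \<open>The hypotheses describe sets between the open and the closed ball, so that both
    kinds are treated at once. Those depending on \<open>Y \<noteq> {}\<close> allow for empty
    balls, which have no centre.\<close>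
  have convex: "coarsely_median_convex X \<mu> d M Y"
    if c: "c \<in> X" and Y: "Y \<subseteq> X" "\<And>y. y \<in> Y \<Longrightarrow> ?\<sigma> c y \<le> r"
      and Y': "\<And>z. \<lbrakk>Y \<noteq> {}; z \<in> X; ?\<sigma> c z < r\<rbrakk> \<Longrightarrow> z \<in> Y" "Y \<noteq> {} \<Longrightarrow> c \<in> Y" for c r Y
    unfolding coarsely_median_convex_def
  proof (intro conjI ballI)
    fix y y' x assume y: "y \<in> Y" "y' \<in> Y" "x \<in> X"
    have X: "y \<in> X" "y' \<in> X" using y Y by auto
    let ?q = "\<mu> x y y'"
    have q: "?q \<in> X" using X y by simp
    have "?\<sigma> c ?q \<le> r + K"
      by (rule sigma_median_le[OF K Metric_space_axioms \<mu>_closed c y(3) X Y(2)[OF y(1)] Y(2)[OF y(2)]])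
    moreover have "0 \<le> r" using Y(2)[OF y(1)] S.nonneg[of c y] by linarith
    ultimately obtain z where z: "z \<in> X" "z = c \<or> ?\<sigma> c z < r" "?\<sigma> z ?q \<le> 3 * W + K + 1"
      using ball_within[OF S.Metric_space_axioms W _ geod c q, of K r] K by auto
    have zY: "z \<in> Y" using z Y' y(1) by blast
    have "d z ?q \<le> P * ?\<sigma> z ?q + R" by (rule lower[OF z(1) q])
    also have "\<dots> \<le> M" unfolding M_def using z(3) PR by (intro add_right_mono mult_left_mono) auto
    finally have "d z ?q \<le> M" .
    moreover have "bdd_below ((\<lambda>z. d z ?q) ` Y)" by (rule bdd_belowI2[of _ 0]) simp
    ultimately show "(INF z\<in>Y. d z ?q) \<le> M" using zY by (intro cINF_lower2)
  qed (rule Y)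
  have "coarsely_median_convex X \<mu> d M (S.mball c r)" if "c \<in> X" for c r
  proof (rule convex[OF that])
    show "S.mball c r \<subseteq> X" "\<And>y. y \<in> S.mball c r \<Longrightarrow> ?\<sigma> c y \<le> r"
      "\<And>z. \<lbrakk>z \<in> X; ?\<sigma> c z < r\<rbrakk> \<Longrightarrow> z \<in> S.mball c r" using that by auto
    assume "S.mball c r \<noteq> {}"
    then obtain y where "?\<sigma> c y < r" by auto
    then have "0 < r" by (rule le_less_trans[OF S.nonneg])
    then show "c \<in> S.mball c r" using that by simp
  qed
  moreover have "coarsely_median_convex X \<mu> d M (S.mcball c r)" if "c \<in> X" for c r
  proof (rule convex[OF that])
    show "S.mcball c r \<subseteq> X" "\<And>y. y \<in> S.mcball c r \<Longrightarrow> ?\<sigma> c y \<le> r"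
      "\<And>z. \<lbrakk>z \<in> X; ?\<sigma> c z < r\<rbrakk> \<Longrightarrow> z \<in> S.mcball c r" using that by auto
    assume "S.mcball c r \<noteq> {}"
    then obtain y where "?\<sigma> c y \<le> r" by auto
    then have "0 \<le> r" by (rule order_trans[OF S.nonneg])
    then show "c \<in> S.mcball c r" using that by simp
  qed
  moreover have "?\<sigma> (g x) (g y) = ?\<sigma> x y" if "median_isometry X \<mu> d g" "x \<in> X" "y \<in> X" for g x y
    by (rule sigma_median_isometry[OF K Metric_space_axioms \<mu>_closed that])
  ultimately show ?thesis using M by blast
qed

end
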